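(* Let $T$ be the periodic square lattice of edge length $h$ in the unit square $\Omega$, let $S=S_1\cup S_2$ be the associated set of staggered points, so that $S$ and $T$ form a virtual staggered structure, and suppose that the node set $R=\{\mathbf x_1,\dots,\mathbf x_N\}$ realizes both $S$ and $T$. Let the reproducing degree satisfy $m\ge 2$ and let $\mathbf f\in C^{\alpha}$. Let $(\mathbf v,q)\in C^{2,\alpha}_{per}(\Omega)\times C^{1,\alpha}_{per}(\Omega)$ be the true solution of the periodic Stokes equations $$-\Delta\mathbf v+\nabla q=\mathbf f,\qquad \nabla\cdot\mathbf v=0,$$ and let $(U,P)$ be the discrete solution, i.e. a solution of $$-AU+DP=F,\qquad D^*U=0.$$ Then there is an absolute constant $C$ such that $$\|D(U-\Gamma\mathbf v)\|_{l^2}+\|P-\Gamma q\|_{l^2}\le C\,h^{\alpha-1}\|\mathbf f\|_{C^{\alpha}(\Omega)} .$$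
   Context: Everything is $1$-periodic in each variable; $\Omega=(0,1)^2$ is identified with the torus, $h=1/n$ for a positive integer $n$, and $\alpha>0$ is a Hölder exponent ($C^\alpha$, $C^{k,\alpha}$ are the Hölder spaces). $\mathbf e_1=(1,0)$, $\mathbf e_2=(0,1)$. The subscript $per$ denotes periodic functions; periodic velocities have zero mean, $\int_\Omega\mathbf v\,d\mathbf x=0$. Lattices: $T=\{\mathbf y_1,\dots,\mathbf y_M\}=\{(kh,jh)\}$ ($k,j$ integers, modulo periodicity), with $M=n^2$ points. $S_1=T+(h/2,0)$ carries the first velocity component and $S_2=T+(0,h/2)$ the second; $S=S_1\cup S_2$ has $2M$ points. Shape functions: $R=\{\mathbf x_1,\dots,\mathbf x_N\}\subset\Omega$ is a finite regular node set (a set of nodes for which the shape functions below are defined), $\rho>0$ a dilation parameter comparable to $h$, namely $0<\rho<C_0h$ for a constant $C_0$, $\Phi\ge0$ a smooth compactly supported window function on $\mathbb R^2$, $P_m(\mathbf x)$ the row vector of all monomials $x_1^{\alpha_1}x_2^{\alpha_2}$ with $\alpha_1+\alpha_2\le m$; $m$ is the reproducing degree. With differences of points taken modulo periods, $$M(\mathbf x)=\sum_{I}P_m^t\Big(\frac{\mathbf x-\mathbf x_I}{\rho}\Big)P_m\Big(\frac{\mathbf x-\mathbf x_I}{\rho}\Big)\frac1{\rho^2}\Phi\Big(\frac{\mathbf x-\mathbf x_I}{\rho}\Big),$$ $$\Psi_I(\mathbf x)=P_m(0)[M(\mathbf x)]^{-1}P_m^t\Big(\frac{\mathbf x-\mathbf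 x_I}{\rho}\Big)\frac1{\rho^2}\Phi\Big(\frac{\mathbf x-\mathbf x_I}{\rho}\Big).$$ The discrete projection is $\Gamma g=\sum_{I=1}^N\Psi_I\,g(\mathbf x_I)$, applied componentwise to vector fields; polynomials of degree two are reproduced by it locally. Realization: $R$ realizes a finite point set $\{\mathbf w_1,\dots,\mathbf w_L\}$ if for each $(W_1,\dots,W_L)\in\mathbb R^{L}$ there is $(w_1,\dots,w_N)\in\mathbb R^N$ such that $W_J=\sum_{I=1}^N\Psi_I(\mathbf w_J)w_I$ for $J=1,\dots,L$. Discrete unknowns: $U=(u,v)$ with $u:S_1\to\mathbb R$, $v:S_2\to\mathbb R$, and $P:T\to\mathbb R$, these being the values at the points of $S_1,S_2,T$ of functions of the form $\sum_I\Psi_Iu_I$, $\sum_I\Psi_Iv_I$, $\sum_I\Psi_Ip_I$. In $U-\Gamma\mathbf v$ and $P-\Gamma q$, the functions $\Gamma\mathbf v=(\Gamma v_1,\Gamma v_2)$ and $\Gamma q$ are restricted to $S_1$, $S_2$ and $T$ respectively. Discrete operators: $$(D^*U)(\mathbf y)=\frac{u(\mathbf y+\frac h2\mathbf e_1)-u(\mathbf y-\frac h2\mathbf e_1)}{h}+\frac{v(\mathbf y+\frac h2\mathbf e_2)-v(\mathbf y-\frac h2\mathbf e_2)}{h},\quad \mathbf y\in T;$$ $DP$ has the value $\frac{P(\mathbf z+\frac h2\mathbf e_i)-P(\mathbf z-\frac h2\mathbf e_i)}{h}$ at $\mathbf z\in S_i$, $i=1,2$; $DU$ is the collection of all first difference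 quotients $\frac{u(\mathbf z+h\mathbf e_i)-u(\mathbf z)}{h}$ ($\mathbf z\in S_1$) and $\frac{v(\mathbf z+h\mathbf e_i)-v(\mathbf z)}{h}$ ($\mathbf z\in S_2$), $i=1,2$; and $AU=D^*(DU)$ is the five-point discrete Laplacian applied to each component, i.e. $(AU)(\mathbf z)=h^{-2}\sum_{i=1}^2\big(w(\mathbf z+h\mathbf e_i)-2w(\mathbf z)+w(\mathbf z-h\mathbf e_i)\big)$ with $w=u$ on $S_1$ and $w=v$ on $S_2$. The right-hand side is the vector $F=(f_1(\mathbf y_1),\dots,f_1(\mathbf y_M),f_2(\mathbf y_1),\dots,f_2(\mathbf y_M))^t$ of values of $\mathbf f=(f_1,f_2)$ at the points of $T$, the entry $f_i(\mathbf y_I)$ belonging to the equation at the staggered point $\mathbf y_I+\frac h2\mathbf e_i$. $\|\cdot\|_{l^2}$ is the unweighted Euclidean norm.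
   Formalization: The pressures are normalized (q has zero mean on Ω, P has zero sum over T), and C may depend, besides α, m, Φ and C₀, on an upper bound K for Σ_I|Ψ_I| at the points of S and T; without these the estimate fails. *)

theory Defs
  imports
    "HOL-Analysis.Analysis"
    "Jordan_Normal_Form.Gauss_Jordan_Elimination"
begin

type_synonym point = "real \<times> real"

abbreviation e1 :: point where "e1 \<equiv> (1, 0)"
abbreviation e2 :: point where "e2 \<equiv> (0, 1)"

section \<open>Periodic functions and Hoelder spaces\<close>

text \<open>Functions on the torus are periodic functions on the whole plane. The half-open square
  contains exactly one representative of each point of the torus.\<close>

definition periodic :: "(point \<Rightarrow> 'b) \<Rightarrow> bool" where
  "periodic g \<longleftrightarrow> (\<forall>x. g (x + e1) = g x \<and> g (x + e2) = g x)"

definition Omega :: "point set" where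
  "Omega = {0<..<1} \<times> {0<..<1}"

definition cell :: "point set" where
  "cell = {0..<1} \<times> {0..<1}"

definition partial_deriv :: "point \<Rightarrow> (point \<Rightarrow> real) \<Rightarrow> point \<Rightarrow> real" where
  "partial_deriv e g x = frechet_derivative g (at x) e"

text \<open>\<open>partials_in B k g\<close>: \<open>g\<close> is \<open>k\<close> times differentiable and all its partial derivatives of
  order \<open>k\<close> satisfy \<open>B\<close>.\<close>

fun partials_in :: "((point \<Rightarrow> real) \<Rightarrow> bool) \<Rightarrow> nat \<Rightarrow> (point \<Rightarrow> real) \<Rightarrow> bool" where
  "partials_in B 0 g \<longleftrightarrow> B g"
| "partials_in B (Suc k) g \<longleftrightarrow> (\<forall>x. g differentiable (at x)) \<and>
     partials_in B k (partial_deriv e1 g) \<and> partials_in B k (partial_deriv e2 g)"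

definition smooth :: "(point \<Rightarrow> real) \<Rightarrow> bool" where
  "smooth g \<longleftrightarrow> (\<forall>k. partials_in (continuous_on UNIV) k g)"

definition hoelder :: "real \<Rightarrow> (point \<Rightarrow> 'b::real_normed_vector) \<Rightarrow> bool" where
  "hoelder \<alpha> g \<longleftrightarrow> (\<exists>L. \<forall>x y. norm (g x - g y) \<le> L * dist x y powr \<alpha>)"

text \<open>The space \<open>C\<^sup>k\<^sup>,\<^sup>\<alpha>\<close> of the torus. Boundedness of the derivatives and the Hoelder continuity of
  those of order less than \<open>k\<close> come from periodicity.\<close>

definition C_per :: "nat \<Rightarrow> real \<Rightarrow> (point \<Rightarrow> real) \<Rightarrow> bool" where
  "C_per k \<alpha> g \<longleftrightarrow> periodic g \<and> partials_in (hoelder \<alpha>) k g"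

text \<open>For periodic \<open>g\<close> the supremum over the plane is the supremum with respect to the distance
  of the torus.\<close>

definition hoelder_norm :: "real \<Rightarrow> (point \<Rightarrow> 'b::real_normed_vector) \<Rightarrow> real" where
  "hoelder_norm \<alpha> g =
     (SUP x. norm (g x)) +
     (SUP (x, y)\<in>{(x, y). x \<noteq> y}. norm (g x - g y) / dist x y powr \<alpha>)"

section \<open>The periodic Stokes equations\<close>

definition laplacian :: "(point \<Rightarrow> real) \<Rightarrow> point \<Rightarrow> real" where
  "laplacian g x =
     partial_deriv e1 (partial_deriv e1 g) x + partial_deriv e2 (partial_deriv e2 g) x"

text \<open>The equations determine the pressure only up to an additive constant, which is fixed here
  (and for the discrete pressure below) by a zero mean.\<close>

definition stokes_solution ::
  "real \<Rightarrow> (point \<Rightarrow> point) \<Rightarrow> (point \<Rightarrow> point) \<Rightarrow> (point \<Rightarrow> real) \<Rightarrow> bool" where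
  "stokes_solution \<alpha> f v q \<longleftrightarrow>
     C_per 2 \<alpha> (fst \<circ> v) \<and> C_per 2 \<alpha> (snd \<circ> v) \<and> integral Omega v = 0 \<and>
     C_per 1 \<alpha> q \<and> integral Omega q = 0 \<and>
     (\<forall>x. - laplacian (fst \<circ> v) x + partial_deriv e1 q x = fst (f x)) \<and>
     (\<forall>x. - laplacian (snd \<circ> v) x + partial_deriv e2 q x = snd (f x)) \<and>
     (\<forall>x. partial_deriv e1 (fst \<circ> v) x + partial_deriv e2 (snd \<circ> v) x = 0)"

section \<open>Shape functions\<close>

definition window_function :: "(point \<Rightarrow> real) \<Rightarrow> bool" where
  "window_function \<Phi> \<longleftrightarrow>
     (\<forall>x. 0 \<le> \<Phi> x) \<and> smooth \<Phi> \<and> compact (closure {x. \<Phi> x \<noteq> 0})"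

definition wrap :: "real \<Rightarrow> real" where
  "wrap t = frac (t + 1/2) - 1/2"

text \<open>The difference of two points modulo periods, with representative in \<open>[-1/2, 1/2)\<close> for each
  coordinate, divided by \<open>\<rho>\<close>.\<close>

definition scaled_diff :: "real \<Rightarrow> point \<Rightarrow> point \<Rightarrow> point" where
  "scaled_diff \<rho> x y = (wrap (fst x - fst y) / \<rho>, wrap (snd x - snd y) / \<rho>)"

definition exponents :: "nat \<Rightarrow> (nat \<times> nat) list" where
  "exponents m = [(a, b). a \<leftarrow> [0..<Suc m], b \<leftarrow> [0..<Suc (m - a)]]"

definition monomials :: "nat \<Rightarrow> point \<Rightarrow> real vec" where
  "monomials m x = vec_of_list (map (\<lambda>(a, b). fst x ^ a * snd x ^ b) (exponents m))"

definition weight :: "(point \<Rightarrow> real) \<Rightarrow> real \<Rightarrow> point \<Rightarrow> point \<Rightarrow> real" where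
  "weight \<Phi> \<rho> x y = 1 / \<rho>\<^sup>2 * \<Phi> (scaled_diff \<rho> x y)"

definition moment_matrix ::
  "nat \<Rightarrow> (point \<Rightarrow> real) \<Rightarrow> real \<Rightarrow> point set \<Rightarrow> point \<Rightarrow> real mat" where
  "moment_matrix m \<Phi> \<rho> R x =
     mat (length (exponents m)) (length (exponents m))
       (\<lambda>(i, j). \<Sum>y\<in>R. vec_index (monomials m (scaled_diff \<rho> x y)) i *
                        vec_index (monomials m (scaled_diff \<rho> x y)) j * weight \<Phi> \<rho> x y)"

text \<open>The shape functions are indexed by the nodes themselves: \<open>shape m \<Phi> \<rho> R y\<close> is the function
  \<open>\<Psi>\<^sub>I\<close> of the node \<open>y = x\<^sub>I\<close>.\<close>

definition shape ::
  "nat \<Rightarrow> (point \<Rightarrow> real) \<Rightarrow> real \<Rightarrow> point set \<Rightarrow> point \<Rightarrow> point \<Rightarrow> real" where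
  "shape m \<Phi> \<rho> R y x =
     scalar_prod (monomials m 0)
       (mult_mat_vec (the (mat_inverse (moment_matrix m \<Phi> \<rho> R x)))
          (monomials m (scaled_diff \<rho> x y))) * weight \<Phi> \<rho> x y"

definition regular_nodes ::
  "nat \<Rightarrow> (point \<Rightarrow> real) \<Rightarrow> real \<Rightarrow> point set \<Rightarrow> bool" where
  "regular_nodes m \<Phi> \<rho> R \<longleftrightarrow>
     finite R \<and> R \<subseteq> cell \<and> (\<forall>x. invertible_mat (moment_matrix m \<Phi> \<rho> R x))"

text \<open>For fixed nodes a combination of the shape functions, given by its coefficients.\<close>

definition combination ::
  "nat \<Rightarrow> (point \<Rightarrow> real) \<Rightarrow> real \<Rightarrow> point set \<Rightarrow> (point \<Rightarrow> real) \<Rightarrow> point \<Rightarrow> real" where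
  "combination m \<Phi> \<rho> R c x = (\<Sum>y\<in>R. shape m \<Phi> \<rho> R y x * c y)"

text \<open>The discrete projection \<open>\<Gamma>\<close> uses the nodal values of \<open>g\<close> as coefficients.\<close>

abbreviation projection ::
  "nat \<Rightarrow> (point \<Rightarrow> real) \<Rightarrow> real \<Rightarrow> point set \<Rightarrow> (point \<Rightarrow> real) \<Rightarrow> point \<Rightarrow> real" where
  "projection m \<Phi> \<rho> R g \<equiv> combination m \<Phi> \<rho> R g"

definition realizes ::
  "nat \<Rightarrow> (point \<Rightarrow> real) \<Rightarrow> real \<Rightarrow> point set \<Rightarrow> point set \<Rightarrow> bool" where
  "realizes m \<Phi> \<rho> R X \<longleftrightarrow>
     (\<forall>W. \<exists>c. \<forall>w\<in>X. W w = combination m \<Phi> \<rho> R c w)"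

text \<open>\<open>lebesgue_bound m \<Phi> \<rho> R X K\<close>: \<open>K\<close> bounds the Lebesgue function of the shape functions,
  which is the norm of \<open>g \<mapsto> \<Gamma> g x\<close> with respect to the maximum norm of the nodal values, at the
  points of \<open>X\<close>. Invertibility of the moment matrices alone gives no bound that is uniform in the
  node set; on the other hand every node set has such a \<open>K\<close> when \<open>X\<close> is finite.\<close>

definition lebesgue_bound ::
  "nat \<Rightarrow> (point \<Rightarrow> real) \<Rightarrow> real \<Rightarrow> point set \<Rightarrow> point set \<Rightarrow> real \<Rightarrow> bool" where
  "lebesgue_bound m \<Phi> \<rho> R X K \<longleftrightarrow> (\<forall>x\<in>X. (\<Sum>y\<in>R. \<bar>shape m \<Phi> \<rho> R y x\<bar>) \<le> K)"

section \<open>The staggered lattices and the discrete operators\<close>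

text \<open>The lattices consist of all points of the plane; intersecting with \<open>cell\<close> gives
  the \<open>n\<^sup>2\<close> points modulo periods when \<open>h = 1/n\<close>.\<close>

definition lattice_T :: "real \<Rightarrow> point set" where
  "lattice_T h = {(of_int k * h, of_int j * h) | k j. True}"

definition lattice_S1 :: "real \<Rightarrow> point set" where
  "lattice_S1 h = (\<lambda>y. y + (h/2) *\<^sub>R e1) ` lattice_T h"

definition lattice_S2 :: "real \<Rightarrow> point set" where
  "lattice_S2 h = (\<lambda>y. y + (h/2) *\<^sub>R e2) ` lattice_T h"

definition half_diff :: "real \<Rightarrow> point \<Rightarrow> (point \<Rightarrow> real) \<Rightarrow> point \<Rightarrow> real" where
  "half_diff h e g x = (g (x + (h/2) *\<^sub>R e) - g (x - (h/2) *\<^sub>R e)) / h"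

definition fwd_diff :: "real \<Rightarrow> point \<Rightarrow> (point \<Rightarrow> real) \<Rightarrow> point \<Rightarrow> real" where
  "fwd_diff h e g x = (g (x + h *\<^sub>R e) - g x) / h"

definition five_point :: "real \<Rightarrow> (point \<Rightarrow> real) \<Rightarrow> point \<Rightarrow> real" where
  "five_point h g x =
     (\<Sum>e\<in>{e1, e2}. g (x + h *\<^sub>R e) - 2 * g x + g (x - h *\<^sub>R e)) / h\<^sup>2"

text \<open>A function on a lattice is represented by a function on the plane of which only the values
  on the lattice matter. The discrete unknowns are those whose values on the lattice are values of
  a combination of shape functions; in particular they are periodic there.\<close>

definition discrete_unknown ::
  "nat \<Rightarrow> (point \<Rightarrow> real) \<Rightarrow> real \<Rightarrow> point set \<Rightarrow> point set \<Rightarrow> (point \<Rightarrow> real) \<Rightarrow> bool" where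
  "discrete_unknown m \<Phi> \<rho> R X g \<longleftrightarrow> (\<exists>c. \<forall>x\<in>X. g x = combination m \<Phi> \<rho> R c x)"

text \<open>The discrete velocity is \<open>(u, w)\<close>, with \<open>u\<close> on \<open>S\<^sub>1\<close> and \<open>w\<close> on \<open>S\<^sub>2\<close>. In the momentum equations
  the force is evaluated at \<open>y\<close> and not at the staggered point.\<close>

definition discrete_stokes_solution ::
  "nat \<Rightarrow> (point \<Rightarrow> real) \<Rightarrow> real \<Rightarrow> point set \<Rightarrow> real \<Rightarrow> (point \<Rightarrow> point) \<Rightarrow>
   (point \<Rightarrow> real) \<Rightarrow> (point \<Rightarrow> real) \<Rightarrow> (point \<Rightarrow> real) \<Rightarrow> bool" where
  "discrete_stokes_solution m \<Phi> \<rho> R h f u w P \<longleftrightarrow>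
     discrete_unknown m \<Phi> \<rho> R (lattice_S1 h) u \<and>
     discrete_unknown m \<Phi> \<rho> R (lattice_S2 h) w \<and>
     discrete_unknown m \<Phi> \<rho> R (lattice_T h) P \<and>
     (\<Sum>y\<in>lattice_T h \<inter> cell. P y) = 0 \<and>
     (\<forall>y\<in>lattice_T h.
        - five_point h u (y + (h/2) *\<^sub>R e1) + half_diff h e1 P (y + (h/2) *\<^sub>R e1) = fst (f y) \<and>
        - five_point h w (y + (h/2) *\<^sub>R e2) + half_diff h e2 P (y + (h/2) *\<^sub>R e2) = snd (f y) \<and>
        half_diff h e1 u y + half_diff h e2 w y = 0)"

text \<open>The Euclidean norms of \<open>D(u, w)\<close> and of a function on \<open>T\<close>.\<close>

definition grad_l2 :: "real \<Rightarrow> (point \<Rightarrow> real) \<Rightarrow> (point \<Rightarrow> real) \<Rightarrow> real" where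
  "grad_l2 h u w = sqrt (
     (\<Sum>z\<in>lattice_S1 h \<inter> cell. \<Sum>e\<in>{e1, e2}. (fwd_diff h e u z)\<^sup>2) +
     (\<Sum>z\<in>lattice_S2 h \<inter> cell. \<Sum>e\<in>{e1, e2}. (fwd_diff h e w z)\<^sup>2))"

definition pressure_l2 :: "real \<Rightarrow> (point \<Rightarrow> real) \<Rightarrow> real" where
  "pressure_l2 h P = L2_set P (lattice_T h \<inter> cell)"

end

theory Submission
  imports Defs
begin

text \<open>The discrete solution \<open>(U, P)\<close> is compared with local averages of the true solution instead of
  its point values: \<open>v\<^sub>1\<close> and \<open>v\<^sub>2\<close> are averaged over squares of side \<open>h\<close> and once more in the
  direction transverse to their flux, \<open>q\<close> over squares only. Then the discrete divergence of the
  averaged velocity and the sum of the averaged pressure over the lattice vanish exactly, and the \<open>l\<^sup>2\<close>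
  norm of the residual in the momentum equations is bounded by the \<open>L\<^sup>2\<close> norms of translation
  differences of the second derivatives of \<open>v\<close> and of the gradient of \<open>q\<close>. By the energy identity these
  are bounded by the translation differences of \<open>f\<close>, so no Schauder estimate is needed; in
  particular \<open>\<alpha> = 1\<close> is not exceptional. For \<open>\<alpha> > 1\<close> the force is constant, hence zero. Stability of the
  staggered scheme turns the residual into the error, and the distance between the averages and the
  discrete projection is estimated by local \<open>L\<^sup>2\<close> norms of second derivatives of \<open>v\<close>, and by fractional
  smoothness of the gradient of \<open>q\<close>.\<close>

section \<open>Integrals over the period cell\<close>

text \<open>Square means turn truncation errors into L2 quantities: over the lattice they add up
  exactly to \<open>(real n)\<^sup>2\<close> times the integral over the period cell
  (\<open>sum_box_means\<close>). The transverse averaging makes each difference quotient in the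
  discrete divergence a double square mean, of \<open>a1\<close> and of \<open>b2\<close>
  respectively, and these cancel because \<open>a1 + b2 = 0\<close>. The obstacle is the way back
  from averages to the discrete projection, which samples point values while only L2 information on
  derivatives is at hand. For the velocity, L2 bounds on second derivatives control point values in
  two dimensions. For the pressure, an L2 bound on the gradient just fails to do so; the missing
  smoothness comes from the L2 modulus of the gradient, of order \<open>\<beta>\<close>, and
  integrating the resulting singularity costs a factor \<open>1 / \<beta>\<close>. The norms are
  unweighted, so the \<open>n\<^sup>2\<close> lattice points contribute a factor
  \<open>n = 1 / h\<close>, which turns \<open>h powr \<beta>\<close> into
  \<open>h powr (\<beta> - 1)\<close>. The final constant is built from \<open>\<alpha>\<close>,
  \<open>C0\<close>, \<open>K\<close> and the radius of the support of the window.\<close>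

definition unit_interval :: "real set" where
  "unit_interval = {-1/2..1/2}"

text \<open>Measure one makes integrals over it means; the centring at the origin makes averages
  over its translates and dilates reproduce affine functions.\<close>

definition unit_square :: "point set" where
  "unit_square = cbox (-1/2, -1/2) (1/2, 1/2)"

abbreviation interval_mean :: "(real \<Rightarrow> real) \<Rightarrow> real" (\<open>\<mu>\<^sub>1\<close>) where
  "\<mu>\<^sub>1 \<equiv> integral unit_interval"

abbreviation cell_mean :: "(point \<Rightarrow> real) \<Rightarrow> real" (\<open>\<mu>\<close>) where
  "\<mu> \<equiv> integral unit_square"

abbreviation cell_mean_square :: "(point \<Rightarrow> real) \<Rightarrow> real" (\<open>\<nu>\<close>) where
  "\<nu> g \<equiv> \<mu> (\<lambda>x. (g x)\<^sup>2)"

lemma mem_unit_interval: "t \<in> unit_interval \<longleftrightarrow> \<bar>t\<bar> \<le> 1/2"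
  by (auto simp: unit_interval_def)

lemma mem_unit_square: "y \<in> unit_square \<longleftrightarrow> \<bar>fst y\<bar> \<le> 1/2 \<and> \<bar>snd y\<bar> \<le> 1/2"
  by (cases y) (auto simp: unit_square_def cbox_Pair_eq)

lemma continuous_comp:
  "continuous_on UNIV g \<Longrightarrow> continuous_on S \<phi> \<Longrightarrow> continuous_on S (\<lambda>x. g (\<phi> x))"
  by (rule continuous_on_compose2[of UNIV g]) auto

lemma content_unit_square: "measure lborel unit_square = 1"
  by (simp add: unit_square_def content_Pair)

lemma integral_unit_const [simp]:
  "\<mu>\<^sub>1 (\<lambda>t. c :: real) = c" "\<mu> (\<lambda>t. c :: real) = c"
  using content_unit_square by (simp_all add: unit_interval_def unit_square_def)

lemma integrable_unit:
  fixes g :: "real \<Rightarrow> real" and k :: "point \<Rightarrow> real"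
  shows "continuous_on unit_interval g \<Longrightarrow> g integrable_on unit_interval"
    and "continuous_on unit_square k \<Longrightarrow> k integrable_on unit_square"
  unfolding unit_interval_def unit_square_def
  by (auto intro: integrable_continuous integrable_continuous_real)

lemma integrable_on_cbox_UNIV:
  fixes g :: "'a::euclidean_space \<Rightarrow> real"
  shows "continuous_on UNIV g \<Longrightarrow> g integrable_on cbox a b"
  by (rule integrable_continuous) (rule continuous_on_subset, auto)

text \<open>The variance of \<open>\<phi>\<close> is nonnegative.\<close>

lemma integral_square_le:
  fixes \<phi> :: "'a::euclidean_space \<Rightarrow> real"
  assumes c: "continuous_on (cbox a b) \<phi>" and one: "measure lborel (cbox a b) = 1"
  shows "(integral (cbox a b) \<phi>)\<^sup>2 \<le> integral (cbox a b) (\<lambda>x. (\<phi> x)\<^sup>2)"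
proof -
  define m where "m = integral (cbox a b) \<phi>"
  have i1: "\<phi> integrable_on cbox a b" by (rule integrable_continuous[OF c])
  have i2: "(\<lambda>x. (\<phi> x)\<^sup>2) integrable_on cbox a b"
    by (rule integrable_continuous) (intro continuous_intros c)
  have "0 \<le> integral (cbox a b) (\<lambda>x. (\<phi> x - m)\<^sup>2)"
    by (rule integral_nonneg) (auto intro!: integrable_continuous continuous_intros c)
  also have "(\<lambda>x. (\<phi> x - m)\<^sup>2) = (\<lambda>x. (\<phi> x)\<^sup>2 - (2 * m * \<phi> x - m\<^sup>2))"
    by (auto simp: power2_eq_square algebra_simps)
  also have "integral (cbox a b) \<dots> = integral (cbox a b) (\<lambda>x. (\<phi> x)\<^sup>2) - (2 * m * m - m\<^sup>2)"
    using i1 i2 one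
    by (subst integral_diff; (subst integral_diff)?)
       (auto intro!: integrable_diff simp: m_def integrable_on_mult_right)
  finally show ?thesis by (simp add: m_def power2_eq_square)
qed

lemma cell_mean_le:
  fixes \<phi> :: "real \<Rightarrow> real" and \<psi> :: "point \<Rightarrow> real"
  shows "continuous_on unit_interval \<phi> \<Longrightarrow>
      (\<mu>\<^sub>1 \<phi>)\<^sup>2 \<le> \<mu>\<^sub>1 (\<lambda>x. (\<phi> x)\<^sup>2)"
    and "continuous_on unit_square \<psi> \<Longrightarrow>
      (\<mu> \<psi>)\<^sup>2 \<le> \<mu> (\<lambda>x. (\<psi> x)\<^sup>2)"
  using integral_square_le[of "-1/2" "1/2" \<phi>]
    integral_square_le[of "(-1/2, -1/2)" "(1/2, 1/2)" \<psi>] content_unit_square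
  unfolding unit_interval_def unit_square_def by simp_all

lemma integral_dilate_le:
  fixes w :: "point \<Rightarrow> real"
  assumes w: "continuous_on UNIV w" "\<And>x. 0 \<le> w x" and s: "0 < s"
    and sub: "\<And>y. y \<in> unit_square \<Longrightarrow> c + s *\<^sub>R y \<in> unit_square"
  shows "s\<^sup>2 * \<mu> (\<lambda>y. w (c + s *\<^sub>R y)) \<le> \<mu> w"
proof -
  let ?a = "s *\<^sub>R (-1/2, -1/2) + c" and ?b = "s *\<^sub>R (1/2, 1/2) + c"
  have im: "(\<lambda>y. s *\<^sub>R y + c) ` unit_square = cbox ?a ?b"
    using s unfolding unit_square_def by (subst image_affinity_cbox) (auto simp: cbox_Pair_eq)
  have "(w has_integral integral (cbox ?a ?b) w) (cbox ?a ?b)"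
    by (intro integrable_integral integrable_on_cbox_UNIV w)
  from has_integral_affinity'[OF this s, of c]
  have "((\<lambda>x. w (s *\<^sub>R x + c)) has_integral (integral (cbox ?a ?b) w /\<^sub>R s\<^sup>2)) unit_square"
    using s by (simp add: power2_eq_square unit_square_def)
  then have "\<mu> (\<lambda>y. w (c + s *\<^sub>R y)) = integral (cbox ?a ?b) w /\<^sub>R s\<^sup>2"
    by (intro integral_unique) (simp add: add.commute)
  moreover have "integral (cbox ?a ?b) w \<le> \<mu> w"
  proof (rule integral_subset_le)
    show "cbox ?a ?b \<subseteq> unit_square"
      unfolding im[symmetric] by (rule image_subsetI, subst add.commute, rule sub)
  qed (auto intro!: integrable_on_cbox_UNIV w simp: unit_square_def)
  ultimately show ?thesis using s by (simp add: field_simps)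
qed

lemma periodic_shift_nat:
  "periodic g \<Longrightarrow> g (x + (real i, real j)) = g x"
proof (induction i arbitrary: x)
  case 0
  then show ?case
  proof (induction j arbitrary: x)
    case (Suc j)
    have "x + (real 0, real (Suc j)) = (x + (real 0, real j)) + e2"
      by (simp add: prod_eq_iff)
    then show ?case using Suc by (metis periodic_def)
  qed (simp add: prod_eq_iff zero_prod_def[symmetric])
next
  case (Suc i)
  have "x + (real (Suc i), real j) = (x + (real i, real j)) + e1"
    by (simp add: prod_eq_iff)
  then show ?case using Suc by (metis periodic_def)
qed

lemma periodic_shift_int:
  assumes "periodic g"
  shows "g (x + (of_int i, of_int j)) = g x"
proof -
  \<comment> \<open>An integer is the difference of its positive and negative parts, so both sides
    are natural shifts, to which the previous lemma applies.\<close>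
  have "x + (of_int i, of_int j) + (real (nat (-i)), real (nat (-j))) = x + (real (nat i), real (nat j))"
    by (cases "0 \<le> i"; cases "0 \<le> j") (auto simp: prod_eq_iff)
  then show ?thesis using periodic_shift_nat[OF assms] by metis
qed

text \<open>For \<open>a \<le> b\<close> the integral from \<open>a\<close> to \<open>b + 1\<close>
  is split at \<open>b\<close> and at \<open>a + 1\<close>; the two remainders are translates of
  each other by one period.\<close>

lemma periodic_integral_shift:
  fixes \<phi> :: "real \<Rightarrow> real"
  assumes c: "continuous_on UNIV \<phi>" and p: "\<And>t. \<phi> (t + 1) = \<phi> t"
  shows "integral {a..a+1} \<phi> = integral {b..b+1} \<phi>"
proof -
  have *: "integral {a..a+1} \<phi> = integral {b..b+1} \<phi>" if "a \<le> b" for a b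
  proof -
    have i: "\<phi> integrable_on {u..v}" for u v
      using integrable_on_cbox_UNIV[OF c, of u v] by simp
    have "integral {a..b} \<phi> + integral {b..b+1} \<phi> = integral {a..b+1} \<phi>"
      using that by (intro Henstock_Kurzweil_Integration.integral_combine i) auto
    moreover have "integral {a..a+1} \<phi> + integral {a+1..b+1} \<phi> = integral {a..b+1} \<phi>"
      using that by (intro Henstock_Kurzweil_Integration.integral_combine i) auto
    moreover have "integral {a+1..b+1} \<phi> = integral {a..b} \<phi>"
      using integral_shift_real_ivl[of "a+1" 1 "b+1" \<phi>] p by simp
    ultimately show ?thesis by simp
  qed
  show ?thesis using *[of a b] *[of b a] by linarith
qed

lemma integral_unit_interval_shift:
  fixes \<phi> :: "real \<Rightarrow> real"
  assumes "continuous_on UNIV \<phi>" and "\<And>t. \<phi> (t + 1) = \<phi> t"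
  shows "\<mu>\<^sub>1 (\<lambda>t. \<phi> (a + t)) = \<mu>\<^sub>1 \<phi>"
  using integral_shift_real_ivl[of "a - 1/2" a "a + 1/2" \<phi>]
    periodic_integral_shift[OF assms, of "a - 1/2" "-1/2"]
  by (simp add: add.commute algebra_simps unit_interval_def)

lemma cell_mean_iterated:
  fixes g :: "point \<Rightarrow> real"
  assumes "continuous_on unit_square g"
  shows "\<mu> g
    = \<mu>\<^sub>1 (\<lambda>s. \<mu>\<^sub>1 (\<lambda>t. g (s, t)))"
  using integral_prod_continuous[of "-1/2" "-1/2" "1/2" "1/2" g] assms
  unfolding unit_interval_def unit_square_def by simp

lemma continuous_integral_interval:
  fixes k :: "'a::topological_space \<Rightarrow> real \<Rightarrow> real"
  assumes "continuous_on UNIV (\<lambda>(x, t). k x t)"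
  shows "continuous_on S (\<lambda>x. \<mu>\<^sub>1 (k x))"
  using integral_continuous_on_param[of S "-1/2" "1/2" k] continuous_on_subset[OF assms]
  unfolding unit_interval_def by simp

lemma continuous_integral_square:
  fixes k :: "'a::topological_space \<Rightarrow> point \<Rightarrow> real"
  assumes "continuous_on UNIV (\<lambda>(x, t). k x t)"
  shows "continuous_on S (\<lambda>x. \<mu> (k x))"
  unfolding unit_square_def
  by (rule integral_continuous_on_param) (rule continuous_on_subset[OF assms], simp)

lemma cell_mean_interval_swap:
  fixes k :: "point \<Rightarrow> real \<Rightarrow> real"
  assumes "continuous_on UNIV (\<lambda>(x, t). k x t)"
  shows "\<mu> (\<lambda>x. \<mu>\<^sub>1 (k x))
    = \<mu>\<^sub>1 (\<lambda>t. \<mu> (\<lambda>x. k x t))"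
  using integral_swap_continuous[of "(-1/2, -1/2)" "-1/2" "(1/2, 1/2)" "1/2" k]
    continuous_on_subset[OF assms]
  unfolding unit_interval_def unit_square_def by simp

lemma cell_mean_swap:
  fixes k :: "point \<Rightarrow> point \<Rightarrow> real"
  assumes "continuous_on UNIV (\<lambda>(x, t). k x t)"
  shows "\<mu> (\<lambda>x. \<mu> (k x))
    = \<mu> (\<lambda>t. \<mu> (\<lambda>x. k x t))"
  unfolding unit_square_def
  by (rule integral_swap_continuous) (rule continuous_on_subset[OF assms], simp)

lemma cell_mean_shift:
  fixes g :: "point \<Rightarrow> real"
  assumes c: "continuous_on UNIV g" and p: "periodic g"
  shows "\<mu> (\<lambda>y. g (a + y)) = \<mu> g"
proof -
  have *: "continuous_on S (\<lambda>x. g (\<phi> x))" if "continuous_on S \<phi>" for S \<phi>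
    by (rule continuous_comp[OF c that])
  have p1: "g (s + 1, t) = g (s, t)" "g (s, t + 1) = g (s, t)" for s t
    using p unfolding periodic_def by (metis add_Pair add.right_neutral)+
  define G where "G s = \<mu>\<^sub>1 (\<lambda>t. g (s, t))" for s
  have "\<mu> (\<lambda>y. g (a + y)) =
      \<mu>\<^sub>1 (\<lambda>s. \<mu>\<^sub>1 (\<lambda>t. g (fst a + s, snd a + t)))"
    by (subst cell_mean_iterated) (auto intro!: * continuous_intros simp: plus_prod_def)
  also have "\<dots> = \<mu>\<^sub>1 (\<lambda>s. G (fst a + s))"
    unfolding G_def
    by (intro integral_cong integral_unit_interval_shift[where \<phi> = "\<lambda>t. g (_, t)"])
       (auto intro!: * continuous_intros simp: p1)
  also have "\<dots> = \<mu>\<^sub>1 G"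
  proof (rule integral_unit_interval_shift)
    show "continuous_on UNIV G" unfolding G_def
      by (rule continuous_integral_interval) (auto simp: case_prod_unfold intro!: * continuous_intros)
  qed (simp add: G_def p1)
  also have "\<dots> = \<mu> g"
    unfolding G_def by (subst cell_mean_iterated) (auto intro!: continuous_on_subset[OF c])
  finally show ?thesis .
qed

section \<open>Means over segments and squares\<close>

definition line_mean :: "real \<Rightarrow> point \<Rightarrow> (point \<Rightarrow> real) \<Rightarrow> point \<Rightarrow> real" where
  "line_mean h e g x = \<mu>\<^sub>1 (\<lambda>t. g (x + (t * h) *\<^sub>R e))"

definition box_mean :: "real \<Rightarrow> (point \<Rightarrow> real) \<Rightarrow> point \<Rightarrow> real" where
  "box_mean h g x = \<mu> (\<lambda>y. g (x + h *\<^sub>R y))"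

lemma continuous_line_mean:
  assumes "continuous_on UNIV g"
  shows "continuous_on S (line_mean h e g)"
  unfolding line_mean_def
  by (rule continuous_integral_interval)
     (auto simp: case_prod_unfold intro!: continuous_comp[OF assms] continuous_intros)

lemma box_mean_nonneg:
  assumes "continuous_on UNIV g" "\<And>x. 0 \<le> g x"
  shows "0 \<le> box_mean h g z"
  unfolding box_mean_def
  by (intro integral_nonneg integrable_unit continuous_comp[OF assms(1)] continuous_intros assms(2))

lemma periodic_add:
  assumes "periodic g"
  shows "g (x + e1 + a) = g (x + a)" "g (x + e2 + a) = g (x + a)"
proof -
  have "x + e + a = x + a + e" for e :: point by (simp only: add_ac)
  then show "g (x + e1 + a) = g (x + a)" "g (x + e2 + a) = g (x + a)"
    using assms by (simp_all only: periodic_def)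
qed

lemma periodic_shift: "periodic g \<Longrightarrow> periodic (\<lambda>x. g (x + a))"
  using periodic_add[of g] unfolding periodic_def by simp

lemma periodic_line_mean: "periodic g \<Longrightarrow> periodic (line_mean h e g)"
  unfolding periodic_def[of "line_mean h e g"] line_mean_def
  by (simp only: periodic_add simp_thms)

lemma periodic_box_mean: "periodic g \<Longrightarrow> periodic (box_mean h g)"
  unfolding periodic_def[of "box_mean h g"] box_mean_def
  by (simp only: periodic_add simp_thms)

lemma cell_mean_shift':
  fixes g :: "point \<Rightarrow> real"
  assumes c: "continuous_on UNIV g" and p: "periodic g"
  shows "\<mu> (\<lambda>y. g (y + a)) = \<mu> g"
  using cell_mean_shift[OF assms, of a] by (simp add: add.commute)

lemma integral_line_mean:
  assumes c: "continuous_on UNIV g" and p: "periodic g"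
  shows "\<mu> (line_mean h e g) = \<mu> g"
proof -
  have "\<mu> (line_mean h e g) = \<mu>\<^sub>1 (\<lambda>t::real. \<mu> g)"
    unfolding line_mean_def
    by (subst cell_mean_interval_swap)
       (auto simp: case_prod_unfold cell_mean_shift'[OF c p]
             intro!: continuous_comp[OF c] continuous_intros)
  then show ?thesis by simp
qed

lemma line_mean_square_le:
  assumes c: "continuous_on UNIV g"
  shows "(line_mean h e g x)\<^sup>2 \<le> line_mean h e (\<lambda>x. (g x)\<^sup>2) x"
  unfolding line_mean_def
  by (rule cell_mean_le(1)) (intro continuous_comp[OF c] continuous_intros)

lemma box_mean_square_le:
  assumes c: "continuous_on UNIV g"
  shows "(box_mean h g x)\<^sup>2 \<le> box_mean h (\<lambda>x. (g x)\<^sup>2) x"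
  unfolding box_mean_def
  by (rule cell_mean_le(2)) (auto intro!: continuous_comp[OF c] continuous_intros)

lemma integral_line_mean_square_le:
  assumes c: "continuous_on UNIV g" and p: "periodic g"
  shows "\<mu> (\<lambda>x. (line_mean h e g x)\<^sup>2) \<le> \<nu> g"
proof -
  have c2: "continuous_on UNIV (\<lambda>x. (g x)\<^sup>2)" by (intro continuous_intros c)
  have "\<mu> (\<lambda>x. (line_mean h e g x)\<^sup>2) \<le> \<mu> (line_mean h e (\<lambda>x. (g x)\<^sup>2))"
    by (intro integral_le integrable_unit continuous_intros continuous_line_mean c2 c
          line_mean_square_le)
  also have "\<dots> = \<nu> g"
    by (rule integral_line_mean[OF c2]) (use p in \<open>auto simp: periodic_def\<close>)
  finally show ?thesis .
qed

text \<open>The deviation is itself a mean of translation differences over \<open>t\<close>;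
  Jensen's inequality and exchanging the integrals reduce it to the modulus in L2.\<close>

lemma integral_line_mean_deviation_le:
  assumes c: "continuous_on UNIV g" and p: "periodic g"
    and B: "\<And>t. t \<in> unit_interval \<Longrightarrow> \<mu> (\<lambda>x. (g (x + (t * h) *\<^sub>R e) - g x)\<^sup>2) \<le> B"
  shows "\<mu> (\<lambda>x. (line_mean h e g x - g x)\<^sup>2) \<le> B"
proof -
  note ci = continuous_comp[OF c] continuous_intros continuous_line_mean
  have "(line_mean h e g x - g x)\<^sup>2 \<le> \<mu>\<^sub>1 (\<lambda>t. (g (x + (t * h) *\<^sub>R e) - g x)\<^sup>2)" for x
  proof -
    have "line_mean h e g x - g x = \<mu>\<^sub>1 (\<lambda>t. g (x + (t * h) *\<^sub>R e) - g x)"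
      unfolding line_mean_def
      by (subst integral_diff) (auto intro!: integrable_unit ci)
    then show ?thesis
      by (simp only:) (rule cell_mean_le(1), intro ci)
  qed
  then have "\<mu> (\<lambda>x. (line_mean h e g x - g x)\<^sup>2) \<le>
      \<mu> (\<lambda>x. \<mu>\<^sub>1 (\<lambda>t. (g (x + (t * h) *\<^sub>R e) - g x)\<^sup>2))"
    by (intro integral_le integrable_unit ci c continuous_integral_interval)
       (auto simp: case_prod_unfold intro!: ci)
  also have "\<dots> = \<mu>\<^sub>1 (\<lambda>t. \<mu> (\<lambda>x. (g (x + (t * h) *\<^sub>R e) - g x)\<^sup>2))"
    by (rule cell_mean_interval_swap) (auto simp: case_prod_unfold intro!: ci)
  also have "\<dots> \<le> \<mu>\<^sub>1 (\<lambda>t::real. B)"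
    using B
    by (intro integral_le integrable_unit continuous_integral_square)
       (auto simp: case_prod_unfold intro!: ci)
  finally show ?thesis by simp
qed

text \<open>Both orders are wanted: the two terms of the discrete divergence produce the line means
  in opposite orders.\<close>

lemma box_mean_eq:
  assumes c: "continuous_on UNIV g"
  shows "box_mean h g x = line_mean h e1 (line_mean h e2 g) x" (is ?P1)
    and "box_mean h g x = line_mean h e2 (line_mean h e1 g) x" (is ?P2)
proof -
  note ci = continuous_comp[OF c] continuous_intros
  show 1: ?P1
    unfolding box_mean_def line_mean_def
    by (subst cell_mean_iterated) (auto intro!: ci simp: plus_prod_def mult.commute)
  show ?P2
    unfolding 1 unfolding line_mean_def
    using integral_swap_continuous[of "-1/2" "-1/2" "1/2" "1/2"
        "\<lambda>s t. g (x + ((s * h) *\<^sub>R e1 + (t * h) *\<^sub>R e2))"]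
    unfolding unit_interval_def by (simp add: case_prod_unfold ci add.assoc add.commute[of "(0, _)"])
qed

section \<open>Exact summation of means over the lattice\<close>

lemma periodic_sum_shift:
  fixes \<phi> :: "real \<Rightarrow> real"
  assumes p: "\<And>t. \<phi> (t + 1) = \<phi> t" and n: "0 < n"
  shows "(\<Sum>i<n. \<phi> (a + (real i + 1) / real n)) = (\<Sum>i<n. \<phi> (a + real i / real n))"
proof -
  obtain m where m: "n = Suc m" using n by (cases n) auto
  have "(\<Sum>i<n. \<phi> (a + (real i + 1) / real n)) = (\<Sum>i<m. \<phi> (a + real (Suc i) / real n)) + \<phi> (a + 1)"
    by (simp add: m add.commute)
  also have "\<dots> = (\<Sum>i<n. \<phi> (a + real i / real n))"
    by (subst (2) m, subst sum.lessThan_Suc_shift) (simp add: p)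
  finally show ?thesis .
qed

text \<open>The \<open>n\<close> segments of length \<open>1 / n\<close> are adjacent and tile one
  period; \<open>a\<close> is the midpoint of the first of them, hence the offset by half a
  segment.\<close>

lemma integral_subdivide:
  fixes \<psi> :: "real \<Rightarrow> real"
  assumes c: "continuous_on UNIV \<psi>" and n: "0 < n"
  shows "(\<Sum>i<n. \<mu>\<^sub>1 (\<lambda>t. \<psi> (a + (t + real i) / real n)))
    = real n * integral {a - 1 / (2 * real n)..a - 1 / (2 * real n) + 1} \<psi>"
proof -
  define b where "b = a - 1 / (2 * real n)"
  have i: "\<psi> integrable_on {u..v}" for u v
    using integrable_on_cbox_UNIV[OF c, of u v] by simp
  have part: "\<mu>\<^sub>1 (\<lambda>t. \<psi> (a + (t + real i) / real n))
      = real n * integral {b + real i / n..b + real (Suc i) / n} \<psi>" for i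
  proof -
    have "(\<psi> has_integral (integral {b + real i / n..b + real (Suc i) / n} \<psi>))
        (cbox (b + real i / n) (b + real (Suc i) / n))"
      using integrable_integral[OF i] by simp
    from has_integral_affinity'[OF this, of "1 / real n" "a + real i / n"] n
    have "((\<lambda>t. \<psi> (1 / real n * t + (a + real i / n))) has_integral
        real n * integral {b + real i / n..b + real (Suc i) / n} \<psi>) unit_interval"
      by (simp add: b_def unit_interval_def field_simps)
    then show ?thesis
      by (intro integral_unique) (simp add: add_divide_distrib algebra_simps)
  qed
  have "(\<Sum>i<k. integral {b + real i / n..b + real (Suc i) / n} \<psi>) = integral {b..b + real k / n} \<psi>" for k
  proof (induction k)
    case (Suc k)
    then show ?case
      using n by (simp only: sum.lessThan_Suc)
        (intro Henstock_Kurzweil_Integration.integral_combine i, auto simp: divide_simps)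
  qed simp
  from this[of n] show ?thesis using n
    by (simp only: part sum_distrib_left[symmetric] b_def[symmetric]) simp
qed

lemma integral_dilated_periodic:
  fixes \<theta> :: "real \<Rightarrow> real"
  assumes c: "continuous_on UNIV \<theta>" and p: "\<And>t. \<theta> (t + 1) = \<theta> t" and L: "0 < L"
  shows "\<mu>\<^sub>1 (\<lambda>t. \<theta> (t * real L)) = \<mu>\<^sub>1 \<theta>"
proof -
  have pn: "\<theta> (t + real i) = \<theta> t" for t i
  proof (induction i)
    case (Suc i)
    have "t + real (Suc i) = t + real i + 1" by simp
    then show ?case using p Suc by metis
  qed simp
  \<comment> \<open>\<open>?a\<close> is the midpoint of the first of \<open>L\<close> equal parts
    of the unit interval; on each part the dilated function runs through exactly one period.\<close>
  let ?\<psi> = "\<lambda>t. \<theta> (t * real L)" and ?a = "-1/2 + 1 / (2 * real L)"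
  have "real L * \<mu>\<^sub>1 ?\<psi> = (\<Sum>i<L. \<mu>\<^sub>1 (\<lambda>t. ?\<psi> (?a + (t + real i) / real L)))"
    using L by (subst integral_subdivide)
      (auto intro!: continuous_comp[OF c] continuous_intros simp: unit_interval_def)
  also have "\<dots> = (\<Sum>i<L. \<mu>\<^sub>1 (\<lambda>t. \<theta> (?a * real L + t)))"
  proof (intro sum.cong refl integral_cong)
    fix i t
    have "(?a + (t + real i) / real L) * real L = (?a * real L + t) + real i"
      using L by (simp add: field_simps)
    then show "?\<psi> (?a + (t + real i) / real L) = \<theta> (?a * real L + t)" by (simp only: pn)
  qed
  also have "\<dots> = real L * \<mu>\<^sub>1 \<theta>"
    by (simp only: integral_unit_interval_shift[OF c p]) simp
  finally show ?thesis using L by simp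
qed

text \<open>Segments of length \<open>L / n\<close> whose centres are \<open>1 / n\<close> apart
  cover every point of the circle exactly \<open>L\<close> times, and the mean over a segment
  divides by \<open>L\<close> again. Hence overlapping patches cost nothing.\<close>

lemma sum_line_means:
  fixes \<phi> :: "real \<Rightarrow> real"
  assumes c: "continuous_on UNIV \<phi>" and p: "\<And>t. \<phi> (t + 1) = \<phi> t" and n: "0 < n" and L: "0 < L"
  shows "(\<Sum>i<n. \<mu>\<^sub>1 (\<lambda>t. \<phi> (a + real i / real n + t * (real L / real n))))
    = real n * \<mu>\<^sub>1 \<phi>"
proof -
  \<comment> \<open>Increasing \<open>t\<close> by 1 only permutes the lattice cyclically, so
    \<open>\<theta>\<close> has period one. A mean over \<open>L\<close> lattice steps may therefore
    be replaced by a mean over a single step, where the segments tile.\<close>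
  define \<theta> where "\<theta> t = (\<Sum>i<n. \<phi> (a + t / real n + real i / real n))" for t
  have c\<theta>: "continuous_on UNIV \<theta>" unfolding \<theta>_def
    by (intro continuous_comp[OF c] continuous_intros) (use n in auto)
  have p\<theta>: "\<theta> (t + 1) = \<theta> t" for t
    unfolding \<theta>_def using periodic_sum_shift[of \<phi>, OF p n, where a = "a + t / real n"]
    by (simp add: add_divide_distrib add_ac)
  have "(\<Sum>i<n. \<mu>\<^sub>1 (\<lambda>t. \<phi> (a + real i / real n + t * (real L / real n)))) =
      \<mu>\<^sub>1 (\<lambda>t. \<theta> (t * real L))"
    unfolding \<theta>_def using n
    by (subst integral_sum)
       (auto intro!: integrable_unit continuous_comp[OF c] continuous_intros
             simp: add_ac)
  also have "\<dots> = \<mu>\<^sub>1 \<theta>"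
    by (rule integral_dilated_periodic[OF c\<theta> p\<theta> L])
  also have "\<dots> = (\<Sum>i<n. \<mu>\<^sub>1 (\<lambda>t. \<phi> (a + (t + real i) / real n)))"
    unfolding \<theta>_def using n
    by (subst integral_sum)
       (auto intro!: integrable_unit continuous_comp[OF c] continuous_intros
             simp: add_ac add_divide_distrib)
  also have "\<dots> = real n * \<mu>\<^sub>1 \<phi>"
    using periodic_integral_shift[OF c p, of "a - 1 / (2 * real n)" "-1/2"]
    unfolding integral_subdivide[OF c n] by (simp add: unit_interval_def)
  finally show ?thesis .
qed

text \<open>The one-dimensional identity in each coordinate. With \<open>L = 1\<close> it serves the
  residual and the pressure mean, with larger \<open>L\<close> the interpolation errors, whose
  patches overlap.\<close>

lemma sum_box_means:
  assumes c: "continuous_on UNIV g" and p: "periodic g" and n: "0 < n" and L: "0 < L"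
  shows "(\<Sum>i<n. \<Sum>j<n. box_mean (real L / real n) g (x + (real i / real n, real j / real n)))
    = (real n)\<^sup>2 * \<mu> g"
proof -
  note ci = continuous_comp[OF c] continuous_intros
  have p1: "g (s + 1, t) = g (s, t)" "g (s, t + 1) = g (s, t)" for s t
    using p unfolding periodic_def by (metis add_Pair add.right_neutral)+
  define G where "G s = \<mu>\<^sub>1 (\<lambda>t. g (s, t))" for s
  let ?h = "real L / real n"
  have cG: "continuous_on S G" for S unfolding G_def
    by (rule continuous_integral_interval) (auto simp: case_prod_unfold intro!: ci)
  have b: "box_mean ?h g (x + (real i / real n, real j / real n)) =
      \<mu>\<^sub>1 (\<lambda>s. \<mu>\<^sub>1 (\<lambda>t.
        g (fst x + real i / real n + s * ?h, snd x + real j / real n + t * ?h)))" for i j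
    unfolding box_mean_def
    by (subst cell_mean_iterated)
       (use n in \<open>auto intro!: ci simp: plus_prod_def mult.commute\<close>)
  have "(\<Sum>j<n. box_mean ?h g (x + (real i / real n, real j / real n))) =
      \<mu>\<^sub>1 (\<lambda>s. \<Sum>j<n. \<mu>\<^sub>1 (\<lambda>t.
        g (fst x + real i / real n + s * ?h, snd x + real j / real n + t * ?h)))" for i
    unfolding b
    by (subst integral_sum)
       (use n in \<open>auto intro!: integrable_unit continuous_integral_interval ci
          simp: case_prod_unfold\<close>)
  also have "\<mu>\<^sub>1 (\<lambda>s. \<Sum>j<n. \<mu>\<^sub>1 (\<lambda>t.
        g (fst x + real i / real n + s * ?h, snd x + real j / real n + t * ?h)))
      = \<mu>\<^sub>1 (\<lambda>s. real n * G (fst x + real i / real n + s * ?h))" for i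
    unfolding G_def
    by (intro integral_cong sum_line_means[where \<phi> = "\<lambda>t. g (_, t)"]) (auto intro!: ci simp: p1 n L)
  finally have "(\<Sum>i<n. \<Sum>j<n. box_mean ?h g (x + (real i / real n, real j / real n))) =
      real n * (\<Sum>i<n. \<mu>\<^sub>1 (\<lambda>s. G (fst x + real i / real n + s * ?h)))"
    by (simp add: sum_distrib_left)
  also have "\<dots> = real n * (real n * \<mu>\<^sub>1 G)"
    by (subst sum_line_means[OF cG _ n L]) (auto simp: G_def p1)
  also have "\<mu>\<^sub>1 G = \<mu> g"
    unfolding G_def by (subst cell_mean_iterated) (auto intro!: continuous_on_subset[OF c])
  finally show ?thesis by (simp add: power2_eq_square)
qed

section \<open>Stability of the discrete Stokes equations\<close>

definition grid_sum :: "nat \<Rightarrow> (int \<Rightarrow> int \<Rightarrow> real) \<Rightarrow> real" where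
  "grid_sum n a = (\<Sum>i<n. \<Sum>j<n. a (int i) (int j))"

text \<open>Lattice functions live on all integer pairs with explicit periodicity instead of on
  residues, so that differences across the edge of the cell need no special treatment.\<close>

definition grid_periodic :: "nat \<Rightarrow> (int \<Rightarrow> int \<Rightarrow> 'a) \<Rightarrow> bool" where
  "grid_periodic n a \<longleftrightarrow> (\<forall>k j. a (k + int n) j = a k j \<and> a k (j + int n) = a k j)"

abbreviation grid_sq :: "nat \<Rightarrow> (int \<Rightarrow> int \<Rightarrow> real) \<Rightarrow> real" where
  "grid_sq n a \<equiv> grid_sum n (\<lambda>k j. (a k j)\<^sup>2)"

abbreviation grid_grad :: "(int \<Rightarrow> int \<Rightarrow> real) \<Rightarrow> int \<Rightarrow> int \<Rightarrow> real" where
  "grid_grad a k j \<equiv> (a (k + 1) j - a k j)\<^sup>2 + (a k (j + 1) - a k j)\<^sup>2"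

lemma grid_linear:
  "grid_sum n (\<lambda>k j. a k j + b k j) = grid_sum n a + grid_sum n b"
  "grid_sum n (\<lambda>k j. a k j - b k j) = grid_sum n a - grid_sum n b"
  "grid_sum n (\<lambda>k j. c * a k j) = c * grid_sum n a"
  "grid_sum n (\<lambda>k j. c) = (real n)\<^sup>2 * c"
  by (simp_all add: grid_sum_def sum.distrib sum_subtractf sum_distrib_left power2_eq_square)

lemma grid_sum_mono:
  "(\<And>k j. a k j \<le> b k j) \<Longrightarrow> grid_sum n a \<le> grid_sum n b"
  unfolding grid_sum_def by (intro sum_mono)

lemma grid_sum_nonneg: "(\<And>k j. 0 \<le> a k j) \<Longrightarrow> 0 \<le> grid_sum n a"
  unfolding grid_sum_def by (intro sum_nonneg)

lemma sum_int_shift: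
  fixes \<phi> :: "int \<Rightarrow> real"
  assumes "\<phi> (int n) = \<phi> 0"
  shows "(\<Sum>i<n. \<phi> (int i + 1)) = (\<Sum>i<n. \<phi> (int i))"
proof -
  have "(\<Sum>i<n. \<phi> (int i + 1) - \<phi> (int i)) = \<phi> (int n) - \<phi> 0"
    using sum_lessThan_telescope[of "\<lambda>i. \<phi> (int i)" n] by (simp add: add.commute)
  then show ?thesis using assms by (simp add: sum_subtractf)
qed

lemma grid_sum_telescope:
  assumes "grid_periodic n a"
  shows "grid_sum n (\<lambda>k j. a (k + 1) j - a k j) = 0" (is ?P1)
    and "grid_sum n (\<lambda>k j. a k (j + 1) - a k j) = 0" (is ?P2)
proof -
  have *: "a (int n) j = a 0 j" "a k (int n) = a k 0" for k j
    using assms unfolding grid_periodic_def by (metis add_0)+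
  show ?P1
    unfolding grid_sum_def sum_subtractf
    by (subst (1 2) sum.swap, subst sum_int_shift[where \<phi> = "\<lambda>k. a k _"]) (simp_all add: *)
  show ?P2
    unfolding grid_sum_def sum_subtractf
    by (subst sum_int_shift[where \<phi> = "a _"]) (simp_all add: *)
qed

text \<open>Summation by parts: it suffices to exhibit periodic fluxes \<open>F\<close> and
  \<open>G\<close> whose differences account for the discrepancy.\<close>

lemma grid_sum_eq_telescope:
  assumes "grid_periodic n F" "grid_periodic n G"
    and "\<And>k j. a k j = b k j + (F (k + 1) j - F k j) + (G k (j + 1) - G k j)"
  shows "grid_sum n a = grid_sum n b"
  unfolding assms(3) grid_linear(1) grid_sum_telescope(1)[OF assms(1)]
    grid_sum_telescope(2)[OF assms(2)] by simp

section \<open>Discrete Poincare inequality\<close>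

lemma oscillation_square_le:
  fixes \<phi> :: "int \<Rightarrow> real"
  assumes "i < n" "i' < n"
  shows "(\<phi> (int i) - \<phi> (int i'))\<^sup>2 \<le> real n * (\<Sum>l<n. (\<phi> (int l + 1) - \<phi> (int l))\<^sup>2)"
proof -
  define d where "d l = \<phi> (int l + 1) - \<phi> (int l)" for l :: nat
  have *: "\<bar>\<phi> (int i) - \<phi> (int i')\<bar> \<le> (\<Sum>l<n. \<bar>d l\<bar>)" if "i' \<le> i" "i < n" for i i'
  proof -
    have "\<phi> (int i) - \<phi> (int i') = (\<Sum>l=i'..<i. d l)"
      using sum_Suc_diff'[OF that(1), of "\<lambda>l. \<phi> (int l)"] by (simp add: d_def add.commute)
    then have "\<bar>\<phi> (int i) - \<phi> (int i')\<bar> \<le> (\<Sum>l=i'..<i. \<bar>d l\<bar>)"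
      by (simp add: sum_abs)
    also have "\<dots> \<le> (\<Sum>l<n. \<bar>d l\<bar>)"
      using that by (intro sum_mono2) auto
    finally show ?thesis .
  qed
  have "\<bar>\<phi> (int i) - \<phi> (int i')\<bar> \<le> (\<Sum>l<n. \<bar>d l\<bar>)"
    using *[of i' i] *[of i i'] assms by (cases "i' \<le> i") (auto simp: abs_minus_commute)
  then have "(\<phi> (int i) - \<phi> (int i'))\<^sup>2 \<le> (\<Sum>l<n. \<bar>d l\<bar>)\<^sup>2"
    by (metis abs_ge_zero power2_abs power_mono)
  also have "\<dots> \<le> real n * (\<Sum>l<n. (d l)\<^sup>2)"
    using sum_squared_le_sum_of_squares[of "\<lambda>l. \<bar>d l\<bar>" "{..<n}"] by (simp add: mult.commute)
  finally show ?thesis unfolding d_def .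
qed

text \<open>For zero mean, the sum of squared differences over all pairs of grid points is
  \<open>2 * (real n)\<^sup>2\<close> times the sum of squares. Each difference is bounded along a
  path with one horizontal and one vertical leg. In terms of difference quotients with step
  \<open>1 / n\<close> the constant is one.\<close>

lemma grid_Poincare:
  assumes p: "grid_periodic n a" and n: "0 < n" and m: "grid_sum n a = 0"
  shows "grid_sq n a \<le> (real n)\<^sup>2 *
    grid_sum n (\<lambda>k j. grid_grad a k j)"
proof -
  define A where "A k j = (\<Sum>l<n. (a (int l + 1) j - a (int l) j)\<^sup>2)" for k j :: int
  define B where "B k j = (\<Sum>l<n. (a k (int l + 1) - a k (int l))\<^sup>2)" for k j :: int
  have pw: "(a (int k) (int j) - a (int k') (int j'))\<^sup>2 \<le> 2 * real n * (A k j + B k' j')"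
    if "k < n" "j < n" "k' < n" "j' < n" for k j k' j'
  proof -
    \<comment> \<open>The path turns at the corner \<open>(k', j)\<close>: row \<open>j\<close>
      first, then column \<open>k'\<close>. Thus \<open>A\<close> depends only on the first point
      and \<open>B\<close> only on the second.\<close>
    have "(a (int k) (int j) - a (int k') (int j'))\<^sup>2 \<le>
        2 * (a (int k) (int j) - a (int k') (int j))\<^sup>2 + 2 * (a (int k') (int j) - a (int k') (int j'))\<^sup>2"
      using zero_le_power2[of "(a (int k) (int j) - a (int k') (int j)) - (a (int k') (int j) - a (int k') (int j'))"]
      by (simp add: power2_eq_square algebra_simps)
    also have "\<dots> \<le> 2 * (real n * A k j) + 2 * (real n * B k' j')"
      using oscillation_square_le[OF that(1,3), of "\<lambda>k. a k (int j)"]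
        oscillation_square_le[OF that(2,4), of "a (int k')"]
      by (intro add_mono mult_left_mono) (auto simp: A_def B_def)
    finally show ?thesis by (simp add: algebra_simps)
  qed
  define Q where "Q = grid_sq n a"
  have "grid_sum n (\<lambda>k j. grid_sum n (\<lambda>k' j'. (a k j - a k' j')\<^sup>2)) \<le>
      grid_sum n (\<lambda>k j. grid_sum n (\<lambda>k' j'. 2 * real n * (A k j + B k' j')))"
    unfolding grid_sum_def by (intro sum_mono) (use pw in auto)
  moreover have "grid_sum n (\<lambda>k j. grid_sum n (\<lambda>k' j'. (a k j - a k' j')\<^sup>2)) = 2 * (real n)\<^sup>2 * Q"
  proof -
    have "grid_sum n (\<lambda>k' j'. (c - a k' j')\<^sup>2) = (real n)\<^sup>2 * c\<^sup>2 + Q" for c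
      unfolding power2_diff grid_linear m Q_def by simp
    then show ?thesis by (simp only: grid_linear) (simp add: Q_def)
  qed
  moreover have "grid_sum n (\<lambda>k j. grid_sum n (\<lambda>k' j'. 2 * real n * (A k j + B k' j'))) =
      2 * real n * ((real n)\<^sup>2 * (grid_sum n A + grid_sum n B))"
  proof -
    have "grid_sum n (\<lambda>k' j'. 2 * real n * (c + B k' j')) = 2 * real n * ((real n)\<^sup>2 * c + grid_sum n B)" for c
      unfolding grid_linear by simp
    then show ?thesis by (simp only: grid_linear) (simp add: algebra_simps)
  qed
  moreover have "grid_sum n A = real n * grid_sum n (\<lambda>k j. (a (k + 1) j - a k j)\<^sup>2)"
    unfolding grid_sum_def A_def by (subst (2) sum.swap) simp
  moreover have "grid_sum n B = real n * grid_sum n (\<lambda>k j. (a k (j + 1) - a k j)\<^sup>2)"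
    unfolding grid_sum_def B_def by (simp add: sum_distrib_left)
  ultimately have "2 * (real n)\<^sup>2 * grid_sq n a \<le> 2 * (real n)\<^sup>2 * ((real n)\<^sup>2 *
    grid_sum n (\<lambda>k j. grid_grad a k j))"
    unfolding grid_linear Q_def by (simp add: power2_eq_square algebra_simps)
  then show ?thesis by (rule mult_left_le_imp_le) (use n in simp)
qed

section \<open>Summation by parts for the discrete Laplacian, divergence and gradient\<close>

definition grid_laplacian :: "(int \<Rightarrow> int \<Rightarrow> real) \<Rightarrow> int \<Rightarrow> int \<Rightarrow> real" where
  "grid_laplacian a k j = a (k + 1) j + a (k - 1) j + a k (j + 1) + a k (j - 1) - 4 * a k j"

lemma grid_periodicD:
  assumes "grid_periodic n a"
  shows "a (k + int n) j = a k j" "a k (j + int n) = a k j"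
    "a (k + int n + 1) j = a (k + 1) j" "a (k + int n - 1) j = a (k - 1) j"
    "a k (j + int n + 1) = a k (j + 1)" "a k (j + int n - 1) = a k (j - 1)"
  using assms unfolding grid_periodic_def
  by (auto simp: algebra_simps) (metis add.commute add.left_commute add_diff_eq diff_add_eq)+

lemma grid_laplacian_sum_zero:
  assumes "grid_periodic n a"
  shows "grid_sum n (grid_laplacian a) = 0"
proof -
  have "grid_sum n (grid_laplacian a) = grid_sum n (\<lambda>k j. 0)"
    by (rule grid_sum_eq_telescope[where F = "\<lambda>k j. a k j - a (k - 1) j" and G = "\<lambda>k j. a k j - a k (j - 1)"])
       (auto simp: grid_periodic_def grid_periodicD[OF assms] grid_laplacian_def)
  then show ?thesis by (simp add: grid_sum_def)
qed

lemma grid_energy: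
  assumes "grid_periodic n a"
  shows "grid_sum n (\<lambda>k j. grid_laplacian a k j * a k j) =
    - grid_sum n (\<lambda>k j. grid_grad a k j)"
proof -
  have "grid_sum n (\<lambda>k j. grid_laplacian a k j * a k j) =
      grid_sum n (\<lambda>k j. (-1) * (grid_grad a k j))"
    by (rule grid_sum_eq_telescope[where F = "\<lambda>k j. a k j * (a k j - a (k - 1) j)"
          and G = "\<lambda>k j. a k j * (a k j - a k (j - 1))"])
       (auto simp: grid_periodic_def grid_periodicD[OF assms] grid_laplacian_def power2_eq_square algebra_simps)
  then show ?thesis unfolding grid_linear(3) by simp
qed

text \<open>The discrete gradient is minus the adjoint of the discrete divergence, so
  divergence-free fields are orthogonal to gradients. This eliminates the pressure from the energy
  estimate and the viscous term from the pressure estimate.\<close>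

lemma grid_div_adjoint:
  assumes "grid_periodic n a" "grid_periodic n b" "grid_periodic n p"
    and div: "\<And>k j. a k j - a (k - 1) j + b k j - b k (j - 1) = 0"
  shows "grid_sum n (\<lambda>k j. a k j * (p (k + 1) j - p k j) + b k j * (p k (j + 1) - p k j)) = 0"
proof -
  have "grid_sum n (\<lambda>k j. a k j * (p (k + 1) j - p k j) + b k j * (p k (j + 1) - p k j))
      = grid_sum n (\<lambda>k j. - p k j * (a k j - a (k - 1) j + b k j - b k (j - 1)))"
    by (rule grid_sum_eq_telescope[where F = "\<lambda>k j. p k j * a (k - 1) j"
          and G = "\<lambda>k j. p k j * b k (j - 1)"])
       (auto simp: grid_periodic_def grid_periodicD[OF assms(1)] grid_periodicD[OF assms(2)]
          grid_periodicD[OF assms(3)] algebra_simps)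
  then show ?thesis by (simp add: div grid_sum_def)
qed

text \<open>As \<open>g\<close> has zero sum, \<open>a\<close> may be replaced by its deviation from
  the mean, to which the Poincare inequality applies. The coefficient of the gradient is what the
  energy can absorb.\<close>

lemma grid_sum_centered_product_le:
  assumes p: "grid_periodic n a" and n: "0 < n" and g: "grid_sum n g = 0"
  shows "2 * grid_sum n (\<lambda>k j. g k j * a k j) \<le> grid_sq n g +
    (real n)\<^sup>2 * grid_sum n (\<lambda>k j. grid_grad a k j)"
proof -
  define m where "m = grid_sum n a / (real n)\<^sup>2"
  have z: "grid_sum n (\<lambda>k j. a k j - m) = 0"
    unfolding grid_linear m_def using n by simp
  have "2 * grid_sum n (\<lambda>k j. g k j * a k j) = 2 * grid_sum n (\<lambda>k j. g k j * a k j) - 2 * m * grid_sum n g"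
    by (simp add: g)
  also have "\<dots> = grid_sum n (\<lambda>k j. 2 * (g k j * a k j) - 2 * m * g k j)"
    unfolding grid_linear ..
  also have "\<dots> \<le> grid_sum n (\<lambda>k j. (g k j)\<^sup>2 + (a k j - m)\<^sup>2)"
  proof (rule grid_sum_mono)
    fix k j
    show "2 * (g k j * a k j) - 2 * m * g k j \<le> (g k j)\<^sup>2 + (a k j - m)\<^sup>2"
      using zero_le_power2[of "g k j - (a k j - m)"] by (simp add: power2_eq_square algebra_simps)
  qed
  also have "\<dots> = grid_sq n g + grid_sum n (\<lambda>k j. (a k j - m)\<^sup>2)"
    unfolding grid_linear ..
  also have "grid_sum n (\<lambda>k j. (a k j - m)\<^sup>2) \<le>
      (real n)\<^sup>2 * grid_sum n (\<lambda>k j. grid_grad a k j)"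
    using grid_Poincare[OF _ n z] p by (simp add: grid_periodic_def)
  finally show ?thesis by simp
qed

text \<open>The pressure is controlled by testing the momentum equations with the discrete pressure
  gradient: the discrete Laplacian commutes with the discrete divergence, so the viscous term drops
  out.\<close>

lemma discrete_Stokes_stability:
  fixes n :: nat and a b p g1 g2 :: "int \<Rightarrow> int \<Rightarrow> real"
  defines "N \<equiv> real n"
  assumes n: "0 < n" and pa: "grid_periodic n a" and pb: "grid_periodic n b" and pp: "grid_periodic n p"
    and mom1: "\<And>k j. - N\<^sup>2 * grid_laplacian a k j + N * (p (k + 1) j - p k j) = g1 k j"
    and mom2: "\<And>k j. - N\<^sup>2 * grid_laplacian b k j + N * (p k (j + 1) - p k j) = g2 k j"
    and div: "\<And>k j. a k j - a (k - 1) j + b k j - b k (j - 1) = 0"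
    and mean: "grid_sum n p = 0"
  shows "N\<^sup>2 * grid_sum n (\<lambda>k j. grid_grad a k j
        + (b (k + 1) j - b k j)\<^sup>2 + (b k (j + 1) - b k j)\<^sup>2)
      \<le> grid_sum n (\<lambda>k j. (g1 k j)\<^sup>2 + (g2 k j)\<^sup>2)" (is ?P1)
    and "grid_sq n p \<le> grid_sum n (\<lambda>k j. (g1 k j)\<^sup>2 + (g2 k j)\<^sup>2)" (is ?P2)
proof -
  have g1: "g1 = (\<lambda>k j. - N\<^sup>2 * grid_laplacian a k j + N * (p (k + 1) j - p k j))"
    and g2: "g2 = (\<lambda>k j. - N\<^sup>2 * grid_laplacian b k j + N * (p k (j + 1) - p k j))"
    using mom1 mom2 by auto
  \<comment> \<open>The left sides of the momentum equations are sums of differences of periodic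
    functions; this compatibility permits testing with velocities of arbitrary mean.\<close>
  have z1: "grid_sum n g1 = 0" and z2: "grid_sum n g2 = 0"
    unfolding g1 g2 grid_linear(1,3) grid_laplacian_sum_zero[OF pa] grid_laplacian_sum_zero[OF pb]
      grid_sum_telescope[OF pp] by auto
  define A where "A = grid_sum n (\<lambda>k j. grid_grad a k j)"
  define B where "B = grid_sum n (\<lambda>k j. grid_grad b k j)"
  define G1 where "G1 = grid_sq n g1"
  define G2 where "G2 = grid_sq n g2"
  have "grid_sum n (\<lambda>k j. g1 k j * a k j) + grid_sum n (\<lambda>k j. g2 k j * b k j) =
      - N\<^sup>2 * grid_sum n (\<lambda>k j. grid_laplacian a k j * a k j)
      + - N\<^sup>2 * grid_sum n (\<lambda>k j. grid_laplacian b k j * b k j)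
      + N * grid_sum n (\<lambda>k j. a k j * (p (k + 1) j - p k j) + b k j * (p k (j + 1) - p k j))"
    unfolding grid_linear(1,3)[symmetric] by (simp add: g1 g2 algebra_simps)
  also have "\<dots> = N\<^sup>2 * (A + B)"
    unfolding grid_div_adjoint[OF pa pb pp div] grid_energy[OF pa] grid_energy[OF pb] A_def B_def
    by (simp add: algebra_simps)
  \<comment> \<open>Of the two copies of the energy on the left, one absorbs the gradients on the
    right.\<close>
  finally have "2 * (N\<^sup>2 * (A + B)) \<le> (G1 + N\<^sup>2 * A) + (G2 + N\<^sup>2 * B)"
    using grid_sum_centered_product_le[OF pa n z1] grid_sum_centered_product_le[OF pb n z2]
    unfolding A_def B_def G1_def G2_def N_def by simp
  then have "N\<^sup>2 * (A + B) \<le> G1 + G2" by (simp add: algebra_simps)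
  then show ?P1
    unfolding A_def B_def G1_def G2_def grid_linear by (simp only: add.assoc)
  define D where "D = grid_sum n (\<lambda>k j. grid_grad p k j)"
  have pl: "grid_periodic n (grid_laplacian a)" "grid_periodic n (grid_laplacian b)"
    by (auto simp: grid_periodic_def grid_laplacian_def grid_periodicD[OF pa] grid_periodicD[OF pb])
  \<comment> \<open>The divergence equation at the five points of the stencil, combined with the
    weights of the Laplacian.\<close>
  have dl: "grid_laplacian a k j - grid_laplacian a (k - 1) j
      + grid_laplacian b k j - grid_laplacian b k (j - 1) = 0" for k j
    unfolding grid_laplacian_def
    using div[of k j] div[of "k + 1" j] div[of "k - 1" j] div[of k "j + 1"] div[of k "j - 1"] by simp
  have "N\<^sup>2 * D = grid_sum n (\<lambda>k j. g1 k j * (N * (p (k + 1) j - p k j)) + g2 k j * (N * (p k (j + 1) - p k j)))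
      + N\<^sup>2 * N * grid_sum n (\<lambda>k j. grid_laplacian a k j * (p (k + 1) j - p k j)
          + grid_laplacian b k j * (p k (j + 1) - p k j))"
    unfolding D_def grid_linear(1,3)[symmetric] g1 g2
    by (rule arg_cong[of _ _ "grid_sum n"]) (auto simp: fun_eq_iff power2_eq_square algebra_simps)
  also have "\<dots> = grid_sum n (\<lambda>k j. g1 k j * (N * (p (k + 1) j - p k j)) + g2 k j * (N * (p k (j + 1) - p k j)))"
    unfolding grid_div_adjoint[OF pl pp dl] by simp
  finally have "2 * (N\<^sup>2 * D) = grid_sum n (\<lambda>k j. 2 * (g1 k j * (N * (p (k + 1) j - p k j))
      + g2 k j * (N * (p k (j + 1) - p k j))))"
    unfolding grid_linear(3) by simp
  also have "\<dots> \<le> grid_sum n (\<lambda>k j. ((g1 k j)\<^sup>2 + (g2 k j)\<^sup>2)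
      + N\<^sup>2 * (grid_grad p k j))"
  proof (rule grid_sum_mono)
    fix k j
    have "2 * (x * y) \<le> x\<^sup>2 + y\<^sup>2" for x y :: real
      using sum_squares_bound[of x y] by simp
    from add_mono[OF this[of "g1 k j" "N * (p (k + 1) j - p k j)"] this[of "g2 k j" "N * (p k (j + 1) - p k j)"]]
    show "2 * (g1 k j * (N * (p (k + 1) j - p k j)) + g2 k j * (N * (p k (j + 1) - p k j)))
      \<le> ((g1 k j)\<^sup>2 + (g2 k j)\<^sup>2) + N\<^sup>2 * (grid_grad p k j)"
      unfolding power_mult_distrib distrib_left by linarith
  qed
  also have "\<dots> = grid_sum n (\<lambda>k j. (g1 k j)\<^sup>2 + (g2 k j)\<^sup>2) + N\<^sup>2 * D"
    unfolding D_def grid_linear ..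
  finally show ?P2
    using grid_Poincare[OF pp n mean] unfolding D_def N_def by simp
qed

section \<open>Periodic differentiable functions\<close>

text \<open>The partial derivatives are explicit arguments, so that those of translates, differences
  and products are given by formulas and need not be recomputed from
  \<open>frechet_derivative\<close>.\<close>

definition C1_per :: "(point \<Rightarrow> real) \<Rightarrow> (point \<Rightarrow> real) \<Rightarrow> (point \<Rightarrow> real) \<Rightarrow> bool" where
  "C1_per g g1 g2 \<longleftrightarrow> periodic g \<and> continuous_on UNIV g1 \<and> continuous_on UNIV g2 \<and>
     (\<forall>x. (g has_derivative (\<lambda>d. g1 x * fst d + g2 x * snd d)) (at x))"

lemma C1_perD:
  assumes "C1_per g g1 g2"
  shows "periodic g" "continuous_on UNIV g1" "continuous_on UNIV g2"
    "(g has_derivative (\<lambda>d. g1 x * fst d + g2 x * snd d)) (at x)"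
  using assms unfolding C1_per_def by blast+

lemma C1_per_cont:
  assumes "C1_per g g1 g2"
  shows "continuous_on UNIV g"
  using has_derivative_continuous[OF C1_perD(4)[OF assms]]
  by (simp add: continuous_on_eq_continuous_at)

lemma has_derivative_shift:
  fixes g :: "point \<Rightarrow> real"
  assumes "(g has_derivative g') (at (x + a))"
  shows "((\<lambda>x. g (x + a)) has_derivative g') (at x)"
proof -
  have "((\<lambda>x. x + a) has_derivative (\<lambda>d. d)) (at x)"
    by (auto intro!: derivative_eq_intros)
  from has_derivative_compose[OF this assms] show ?thesis by simp
qed

text \<open>Translating \<open>g\<close> by a period leaves it unchanged, and derivatives are
  unique.\<close>

lemma C1_per_periodic:
  assumes "C1_per g g1 g2"
  shows "periodic g1" "periodic g2"
proof -
  note D = C1_perD(4)[OF assms]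
  have *: "g1 (x + e) = g1 x \<and> g2 (x + e) = g2 x" if e: "\<And>x. g (x + e) = g x" for x e
  proof -
    have "(\<lambda>x. g (x + e)) = g" using e by (rule ext)
    with has_derivative_shift[OF D[of "x + e"]]
    have "(g has_derivative (\<lambda>d. g1 (x + e) * fst d + g2 (x + e) * snd d)) (at x)" by (simp only:)
    note eq = has_derivative_unique[OF this D]
    show ?thesis using fun_cong[OF eq, of e1] fun_cong[OF eq, of e2] by simp
  qed
  have p: "\<And>x. g (x + e1) = g x" "\<And>x. g (x + e2) = g x"
    using C1_perD(1)[OF assms] by (auto simp: periodic_def)
  show "periodic g1" "periodic g2"
    unfolding periodic_def using *[OF p(1)] *[OF p(2)] by blast+
qed

lemma C1_per_shift:
  assumes "C1_per g g1 g2"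
  shows "C1_per (\<lambda>x. g (x + a)) (\<lambda>x. g1 (x + a)) (\<lambda>x. g2 (x + a))"
  unfolding C1_per_def
  by (intro conjI allI periodic_shift has_derivative_shift C1_perD(1,4)[OF assms]
      continuous_comp[OF C1_perD(2)[OF assms]] continuous_comp[OF C1_perD(3)[OF assms]]
      continuous_intros)

lemma C1_per_mult:
  assumes "C1_per f f1 f2" "C1_per g g1 g2"
  shows "C1_per (\<lambda>x. f x * g x) (\<lambda>x. f1 x * g x + f x * g1 x) (\<lambda>x. f2 x * g x + f x * g2 x)"
  unfolding C1_per_def
proof (intro conjI allI)
  show "periodic (\<lambda>x. f x * g x)"
    using C1_perD(1)[OF assms(1)] C1_perD(1)[OF assms(2)] by (simp add: periodic_def)
  show "((\<lambda>x. f x * g x) has_derivative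
      (\<lambda>d. (f1 x * g x + f x * g1 x) * fst d + (f2 x * g x + f x * g2 x) * snd d)) (at x)" for x
    by (rule has_derivative_eq_rhs[OF has_derivative_mult[OF C1_perD(4)[OF assms(1)] C1_perD(4)[OF assms(2)]]])
       (auto simp: algebra_simps)
qed (intro continuous_intros C1_perD(2,3)[OF assms(1)] C1_perD(2,3)[OF assms(2)]
      C1_per_cont[OF assms(1)] C1_per_cont[OF assms(2)])+

lemma C1_per_diff:
  assumes "C1_per f f1 f2" "C1_per g g1 g2"
  shows "C1_per (\<lambda>x. f x - g x) (\<lambda>x. f1 x - g1 x) (\<lambda>x. f2 x - g2 x)"
  unfolding C1_per_def
proof (intro conjI allI)
  show "periodic (\<lambda>x. f x - g x)"
    using C1_perD(1)[OF assms(1)] C1_perD(1)[OF assms(2)] by (simp add: periodic_def)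
  show "((\<lambda>x. f x - g x) has_derivative (\<lambda>d. (f1 x - g1 x) * fst d + (f2 x - g2 x) * snd d)) (at x)" for x
    by (rule has_derivative_eq_rhs[OF has_derivative_diff[OF C1_perD(4)[OF assms(1)] C1_perD(4)[OF assms(2)]]])
       (auto simp: algebra_simps)
qed (intro continuous_intros C1_perD(2,3)[OF assms(1)] C1_perD(2,3)[OF assms(2)])+

lemma C1_per_divide:
  assumes "C1_per f f1 f2"
  shows "C1_per (\<lambda>x. f x / c) (\<lambda>x. f1 x / c) (\<lambda>x. f2 x / c)"
  unfolding C1_per_def
proof (intro conjI allI)
  show "periodic (\<lambda>x. f x / c)"
    using C1_perD(1)[OF assms(1)] by (simp add: periodic_def)
  show "((\<lambda>x. f x / c) has_derivative (\<lambda>d. f1 x / c * fst d + f2 x / c * snd d)) (at x)" for x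
    unfolding divide_inverse
    by (rule has_derivative_eq_rhs[OF has_derivative_mult_left[OF C1_perD(4)[OF assms(1)]]])
       (auto simp: algebra_simps)
qed (unfold divide_inverse, (intro continuous_on_mult continuous_on_const C1_perD(2,3)[OF assms])+)

lemma C1_per_along:
  assumes "C1_per g g1 g2"
  shows "((\<lambda>t. g (a + t *\<^sub>R d)) has_real_derivative g1 (a + t *\<^sub>R d) * fst d + g2 (a + t *\<^sub>R d) * snd d)
    (at t within S)"
proof -
  have "((\<lambda>t. a + t *\<^sub>R d) has_derivative (\<lambda>s. s *\<^sub>R d)) (at t within S)"
    by (auto intro!: derivative_eq_intros)
  from has_derivative_compose[OF this C1_perD(4)[OF assms]]
  show ?thesis unfolding has_field_derivative_def
    by (rule has_derivative_eq_rhs) (auto simp: algebra_simps)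
qed

section \<open>Difference quotients as averages of derivatives\<close>

lemma C1_per_half_diff:
  assumes "C1_per g g1 g2"
  shows "C1_per (half_diff h e g) (half_diff h e g1) (half_diff h e g2)"
proof -
  have *: "half_diff h e g = (\<lambda>x. (g (x + (h/2) *\<^sub>R e) - g (x + - ((h/2) *\<^sub>R e))) / h)" for g
    by (auto simp: half_diff_def fun_eq_iff)
  show ?thesis unfolding * by (intro C1_per_divide C1_per_diff C1_per_shift assms)
qed

lemma continuous_half_diff:
  assumes c: "continuous_on UNIV g"
  shows "continuous_on S (half_diff h e g)"
  unfolding half_diff_def divide_inverse
  by (intro continuous_intros continuous_comp[OF c])

lemma periodic_half_diff: "periodic g \<Longrightarrow> periodic (half_diff h e g)"
  using periodic_add[of g] unfolding periodic_def half_diff_def by (simp add: diff_conv_add_uminus del: add_uminus_conv_diff)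

text \<open>The fundamental theorem of calculus on the segment of length \<open>h\<close> centred at
  the point. The identity is exact, so differences of the averaged solution are averages of its
  derivatives, with no Taylor remainder.\<close>

lemma half_diff_eq_line_mean:
  assumes g: "C1_per g g1 g2" and h: "0 < h"
  shows "half_diff h e1 g = line_mean h e1 g1" (is ?P1) "half_diff h e2 g = line_mean h e2 g2"
proof -
  have *: "half_diff h e g x = line_mean h e (\<lambda>x. g1 x * fst e + g2 x * snd e) x" for e x
  proof -
    have "((\<lambda>t. h * (g1 (x + (t * h) *\<^sub>R e) * fst e + g2 (x + (t * h) *\<^sub>R e) * snd e)) has_integral
        (g (x + (1/2) *\<^sub>R (h *\<^sub>R e)) - g (x + (-1/2) *\<^sub>R (h *\<^sub>R e)))) {-1/2..1/2}"
      using C1_per_along[OF g, of x "h *\<^sub>R e"]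
      by (intro fundamental_theorem_of_calculus)
         (auto simp: has_real_derivative_iff_has_vector_derivative[symmetric] algebra_simps)
    then have "h * line_mean h e (\<lambda>x. g1 x * fst e + g2 x * snd e) x = h * half_diff h e g x"
      unfolding line_mean_def unit_interval_def half_diff_def using h
      by (subst integral_mult_right[symmetric]) (auto dest!: integral_unique)
    then show ?thesis using h by simp
  qed
  show ?P1 "half_diff h e2 g = line_mean h e2 g2"
    using *[of e1] *[of e2] by (auto simp: fun_eq_iff)
qed

lemma half_diff_line_mean:
  assumes c: "continuous_on UNIV g"
  shows "half_diff h' e' (line_mean h e g) = line_mean h e (half_diff h' e' g)"
proof
  fix x
  have "line_mean h e (half_diff h' e' g) x = \<mu>\<^sub>1 (\<lambda>t. (1 / h') *
      (g ((x + (h'/2) *\<^sub>R e') + (t * h) *\<^sub>R e) - g ((x - (h'/2) *\<^sub>R e') + (t * h) *\<^sub>R e)))"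
    unfolding line_mean_def half_diff_def
    by (intro integral_cong) (simp only: add.commute[of _ "(_ * h) *\<^sub>R e"] add.assoc add_diff_eq, simp)
  also have "\<dots> = (1 / h') * (line_mean h e g (x + (h'/2) *\<^sub>R e') - line_mean h e g (x - (h'/2) *\<^sub>R e'))"
    unfolding line_mean_def
    by (subst integral_mult_right, subst integral_diff) (auto intro!: integrable_unit continuous_comp[OF c] continuous_intros)
  finally show "half_diff h' e' (line_mean h e g) x = line_mean h e (half_diff h' e' g) x"
    by (simp add: half_diff_def)
qed

lemma half_diff_twice_eq_line_mean:
  assumes g: "C1_per g g1 g2" "C1_per g1 g11 g12" "C1_per g2 g21 g22" and h: "0 < h"
  shows "half_diff h e1 (half_diff h e1 g) = line_mean h e1 (line_mean h e1 g11)"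
    and "half_diff h e2 (half_diff h e2 g) = line_mean h e2 (line_mean h e2 g22)"
  using half_diff_eq_line_mean[OF g(1) h] half_diff_eq_line_mean(1)[OF g(2) h] half_diff_eq_line_mean(2)[OF g(3) h]
    half_diff_line_mean[OF C1_per_cont[OF g(2)]] half_diff_line_mean[OF C1_per_cont[OF g(3)]]
  by simp_all

lemma five_point_eq_half_diff:
  assumes "h \<noteq> 0"
  shows "five_point h g x = half_diff h e1 (half_diff h e1 g) x + half_diff h e2 (half_diff h e2 g) x"
proof -
  have "half_diff h e (half_diff h e g) x = (g (x + h *\<^sub>R e) - 2 * g x + g (x - h *\<^sub>R e)) / h\<^sup>2" for e
  proof -
    let ?d = "(h/2) *\<^sub>R e"
    have d: "?d + ?d = h *\<^sub>R e" by (simp flip: scaleR_add_left)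
    have "half_diff h e (half_diff h e g) x =
        ((g (x + (?d + ?d)) - g x) / h - (g x - g (x - (?d + ?d))) / h) / h"
      by (simp only: half_diff_def add_diff_cancel_right' diff_add_cancel add.assoc diff_diff_eq)
    then show ?thesis unfolding d
      by (simp add: diff_divide_distrib add_divide_distrib power2_eq_square)
  qed
  then show ?thesis unfolding five_point_def by (simp add: add_divide_distrib diff_divide_distrib)
qed

text \<open>With step 1 the difference quotient vanishes by periodicity and equals a line mean of
  the derivative; line means preserve the integral over the cell.\<close>

lemma integral_partial_zero:
  assumes g: "C1_per g g1 g2"
  shows "\<mu> g1 = 0" (is ?P1) "\<mu> g2 = 0"
proof -
  have "half_diff 1 e g = (\<lambda>x. 0)" if e: "\<And>x. g (x + e) = g x" for e
  proof
    fix x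
    define a where "a = (1/2) *\<^sub>R e"
    have a: "e = a + a" unfolding a_def by (simp flip: scaleR_add_left)
    have "g (x - a + (a + a)) = g (x - a)"
      using e[of "x - a"] unfolding a[symmetric] .
    then show "half_diff 1 e g x = 0" by (simp add: half_diff_def flip: a_def)
  qed
  then have "line_mean 1 e1 g1 = (\<lambda>x. 0)" "line_mean 1 e2 g2 = (\<lambda>x. 0)"
    unfolding half_diff_eq_line_mean[OF g, of 1, symmetric, simplified]
    using C1_perD(1)[OF g] unfolding periodic_def by blast+
  then show ?P1 "\<mu> g2 = 0"
    using integral_line_mean[of g1 1 e1] integral_line_mean[of g2 1 e2]
      C1_perD[OF g] C1_per_periodic[OF g] by auto
qed

lemma cell_mean_linear:
  fixes f g :: "point \<Rightarrow> real"
  assumes "continuous_on UNIV f" "continuous_on UNIV g"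
  shows "\<mu> (\<lambda>x. f x + g x) = \<mu> f + \<mu> g" (is ?P1)
    and "\<mu> (\<lambda>x. f x - g x) = \<mu> f - \<mu> g" (is ?P2)
    and "\<mu> (\<lambda>x. - f x) = - \<mu> f"
    and "\<mu> (\<lambda>x. c * f x) = c * \<mu> f"
proof -
  have "f integrable_on unit_square" "g integrable_on unit_square"
    using continuous_on_subset[OF assms(1)] continuous_on_subset[OF assms(2)]
    by (auto intro!: integrable_unit)
  then show ?P1 and ?P2
    by (simp_all add: integral_add integral_diff)
qed simp_all

lemma integral_by_parts_torus:
  assumes f: "C1_per f f1 f2" and g: "C1_per g g1 g2"
  shows "\<mu> (\<lambda>x. f1 x * g x) = - \<mu> (\<lambda>x. f x * g1 x)" (is ?P1)
    and "\<mu> (\<lambda>x. f2 x * g x) = - \<mu> (\<lambda>x. f x * g2 x)" (is ?P2)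
proof -
  note c = C1_perD(2,3)[OF f] C1_perD(2,3)[OF g] C1_per_cont[OF f] C1_per_cont[OF g]
  show ?P1 and ?P2
    using integral_partial_zero[OF C1_per_mult[OF f g]]
    by (auto simp: cell_mean_linear(1) continuous_on_mult c)
qed

text \<open>Translation invariance of the integral moves each shift to the other factor, where it
  acts with the opposite sign.\<close>

lemma half_diff_by_parts:
  assumes f: "continuous_on UNIV f" "periodic f" and g: "continuous_on UNIV g" "periodic g"
  shows "\<mu> (\<lambda>x. f x * half_diff h e g x) = - \<mu> (\<lambda>x. half_diff h e f x * g x)"
proof -
  note ci = continuous_comp[OF f(1)] continuous_comp[OF g(1)] f(1) g(1) continuous_intros
  let ?d = "(h/2) *\<^sub>R e"
  have s: "\<mu> (\<lambda>x. f x * g (x + b)) = \<mu> (\<lambda>x. f (x - b) * g x)" for b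
  proof -
    have "continuous_on UNIV (\<lambda>x. f (x - b) * g x)" by (intro ci)
    moreover have "periodic (\<lambda>x. f (x - b) * g x)"
      using periodic_shift[OF f(2), of "- b"] g(2) by (simp add: periodic_def)
    ultimately show ?thesis using cell_mean_shift'[of "\<lambda>x. f (x - b) * g x" b] by simp
  qed
  have l: "(\<lambda>x. f x * half_diff h e g x) = (\<lambda>x. (1 / h) * (f x * g (x + ?d) - f x * g (x + - ?d)))"
    and r: "(\<lambda>x. half_diff h e f x * g x) = (\<lambda>x. (1 / h) * (f (x - - ?d) * g x - f (x - ?d) * g x))"
    by (simp_all add: half_diff_def fun_eq_iff algebra_simps diff_divide_distrib)
  have "\<mu> (\<lambda>x. f x * half_diff h e g x) = (1 / h) *
      (\<mu> (\<lambda>x. f x * g (x + ?d)) - \<mu> (\<lambda>x. f x * g (x + - ?d)))"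
    unfolding l by (subst integral_mult_right, subst cell_mean_linear(2)) (intro ci refl)+
  also have "\<dots> = - ((1 / h) *
      (\<mu> (\<lambda>x. f (x - - ?d) * g x) - \<mu> (\<lambda>x. f (x - ?d) * g x)))"
    unfolding s by (simp add: algebra_simps)
  also have "\<dots> = - \<mu> (\<lambda>x. half_diff h e f x * g x)"
    unfolding r by (subst integral_mult_right, subst cell_mean_linear(2)) (intro ci refl)+
  finally show ?thesis .
qed

section \<open>The energy identity for the Stokes equations\<close>

lemma continuous_eq_at_zero:
  fixes \<Phi> \<Psi> :: "real \<Rightarrow> real"
  assumes "continuous_on UNIV \<Phi>" "continuous_on UNIV \<Psi>" and eq: "\<And>\<delta>. 0 < \<delta> \<Longrightarrow> \<Phi> \<delta> = \<Psi> \<delta>"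
  shows "\<Phi> 0 = \<Psi> 0"
proof -
  have "\<Phi> 0 - \<Psi> 0 = 0"
  proof (rule continuous_constant_on_closure[where S = "{0<..}" and f = "\<lambda>\<delta>. \<Phi> \<delta> - \<Psi> \<delta>"])
    show "continuous_on (closure {0<..}) (\<lambda>\<delta>. \<Phi> \<delta> - \<Psi> \<delta>)"
      by (intro continuous_intros continuous_on_subset[OF assms(1)] continuous_on_subset[OF assms(2)]) auto
  qed (auto simp: eq)
  then show ?thesis by simp
qed

lemma line_mean_zero [simp]: "line_mean 0 e g = g"
  by (simp add: line_mean_def fun_eq_iff)

lemma continuous_line_mean_param:
  assumes "continuous_on UNIV (\<lambda>(\<delta>, x). k \<delta> x)"
  shows "continuous_on UNIV (\<lambda>(\<delta>, x). line_mean \<delta> e (k \<delta>) x)"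
proof -
  have "continuous_on UNIV (\<lambda>z::(real \<times> point) \<times> real. (\<lambda>(\<delta>, x). k \<delta> x) (fst (fst z), snd (fst z) + (snd z * fst (fst z)) *\<^sub>R e))"
    by (intro continuous_comp[OF assms] continuous_intros)
  then show ?thesis
    unfolding line_mean_def case_prod_unfold
    by (intro continuous_integral_interval) (simp add: case_prod_unfold)
qed

lemma continuous_integral_param:
  fixes k :: "real \<Rightarrow> point \<Rightarrow> real"
  assumes "continuous_on UNIV (\<lambda>(\<delta>, x). k \<delta> x)" and "continuous_on UNIV r"
  shows "continuous_on UNIV (\<lambda>\<delta>::real. \<mu> (\<lambda>x. k \<delta> x * r x))"
  using assms
  by (intro continuous_integral_square)
     (auto simp: case_prod_unfold intro!: continuous_on_mult continuous_comp[OF assms(2)] continuous_intros)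

lemma C1_per_half_diff_twice_by_parts:
  assumes f: "C1_per f f1 f2" and g: "C1_per g g1 g2"
  shows "\<mu> (\<lambda>x. half_diff h e (half_diff h e f) x * g1 x) =
      - \<mu> (\<lambda>x. half_diff h e (half_diff h e f1) x * g x)"
    and "\<mu> (\<lambda>x. half_diff h e (half_diff h e f) x * g2 x) =
      - \<mu> (\<lambda>x. half_diff h e (half_diff h e f2) x * g x)"
  using integral_by_parts_torus[OF C1_per_half_diff[OF C1_per_half_diff[OF f]] g, of h e h e] by simp_all

lemma half_diff_twice_by_parts:
  assumes f: "continuous_on UNIV f" "periodic f"
  shows "\<mu> (\<lambda>x. half_diff h e (half_diff h e f) x * f x) =
      - \<mu> (\<lambda>x. half_diff h e f x * half_diff h e f x)"
  using half_diff_by_parts[OF continuous_half_diff[OF f(1)] periodic_half_diff[OF f(2)] f, of h e h e]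
  by simp

text \<open>The two mixed derivatives have separate names; the energy identity yields the norm of
  each, so their symmetry never enters.\<close>

definition C2_per where
  "C2_per g g1 g2 g11 g12 g21 g22 \<longleftrightarrow> C1_per g g1 g2 \<and> C1_per g1 g11 g12 \<and> C1_per g2 g21 g22"

text \<open>For functions that are only twice differentiable the third derivatives in the usual
  integrations by parts are replaced by second differences with step \<open>\<delta>\<close>, and \<open>\<delta>\<close> tends to zero.\<close>

lemma integral_hessian_minor:
  assumes "C2_per g g1 g2 g11 g12 g21 g22"
  shows "\<mu> (\<lambda>x. g22 x * g11 x) = \<nu> g12" (is ?P1)
    and "\<mu> (\<lambda>x. g11 x * g22 x) = \<nu> g21" (is ?P2)
proof -
  have g: "C1_per g g1 g2" "C1_per g1 g11 g12" "C1_per g2 g21 g22"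
    using assms by (auto simp: C2_per_def)
  note c = C1_perD(2,3)[OF g(2)] C1_perD(2,3)[OF g(3)]
  \<comment> \<open>Passage to the limit: both sides depend continuously on \<open>\<delta>\<close>,
    and \<open>line_mean 0 e\<close> is the identity. Identities for differences with positive step
    thus become identities for derivatives.\<close>
  have lim: "\<mu> (\<lambda>x. line_mean 0 e (line_mean 0 e k) x * r x) =
      \<mu> (\<lambda>x. line_mean 0 e l x * line_mean 0 e l x)"
    if k: "continuous_on UNIV k" and r: "continuous_on UNIV r" and l: "continuous_on UNIV l"
      and eq: "\<And>\<delta>. 0 < \<delta> \<Longrightarrow> \<mu> (\<lambda>x. line_mean \<delta> e (line_mean \<delta> e k) x * r x) =
         \<mu> (\<lambda>x. line_mean \<delta> e l x * line_mean \<delta> e l x)" for e k l r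
  proof (rule continuous_eq_at_zero[OF _ _ eq])
    have *: "continuous_on UNIV (\<lambda>(\<delta>::real, x). m x)" if "continuous_on UNIV m" for m :: "point \<Rightarrow> real"
      unfolding case_prod_unfold by (intro continuous_comp[OF that] continuous_intros)
    show "continuous_on UNIV (\<lambda>\<delta>. \<mu> (\<lambda>x. line_mean \<delta> e (line_mean \<delta> e k) x * r x))"
      by (intro continuous_integral_param continuous_line_mean_param * k r)
    show "continuous_on UNIV (\<lambda>\<delta>. \<mu> (\<lambda>x. line_mean \<delta> e l x * line_mean \<delta> e l x))"
      using continuous_line_mean_param[OF *[OF l], of e]
      by (intro continuous_integral_square) (simp add: case_prod_unfold continuous_on_mult)
  qed
  have "\<mu> (\<lambda>x. line_mean 0 e2 (line_mean 0 e2 g22) x * g11 x) =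
      \<mu> (\<lambda>x. line_mean 0 e2 g12 x * line_mean 0 e2 g12 x)"
  proof (rule lim)
    fix \<delta> :: real assume \<delta>: "0 < \<delta>"
    show "\<mu> (\<lambda>x. line_mean \<delta> e2 (line_mean \<delta> e2 g22) x * g11 x) =
      \<mu> (\<lambda>x. line_mean \<delta> e2 g12 x * line_mean \<delta> e2 g12 x)"
      \<comment> \<open>The derivative in \<open>e1\<close> is moved from \<open>g1\<close> onto the
        second difference of \<open>g\<close> in \<open>e2\<close>; then one of the two differences
        is moved back. Only derivatives of order at most two occur.\<close>
      unfolding half_diff_twice_eq_line_mean(2)[OF g \<delta>, symmetric] half_diff_eq_line_mean(2)[OF g(2) \<delta>, symmetric]
        C1_per_half_diff_twice_by_parts(1)[OF g(1,2)]
      by (subst half_diff_twice_by_parts) (auto intro: C1_per_cont[OF g(2)] C1_perD(1)[OF g(2)])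
  qed (fact c)+
  then show ?P1
    by (simp add: power2_eq_square)
  have "\<mu> (\<lambda>x. line_mean 0 e1 (line_mean 0 e1 g11) x * g22 x) =
      \<mu> (\<lambda>x. line_mean 0 e1 g21 x * line_mean 0 e1 g21 x)"
  proof (rule lim)
    fix \<delta> :: real assume \<delta>: "0 < \<delta>"
    show "\<mu> (\<lambda>x. line_mean \<delta> e1 (line_mean \<delta> e1 g11) x * g22 x) =
      \<mu> (\<lambda>x. line_mean \<delta> e1 g21 x * line_mean \<delta> e1 g21 x)"
      unfolding half_diff_twice_eq_line_mean(1)[OF g \<delta>, symmetric] half_diff_eq_line_mean(1)[OF g(3) \<delta>, symmetric]
        C1_per_half_diff_twice_by_parts(2)[OF g(1,3)]
      by (subst half_diff_twice_by_parts) (auto intro: C1_per_cont[OF g(3)] C1_perD(1)[OF g(3)])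
  qed (fact c)+
  then show ?P2
    by (simp add: power2_eq_square)
qed

text \<open>Second derivatives of a divergence-free field in a fixed direction form again a
  divergence-free field, hence are orthogonal to gradients. Each direction is treated separately;
  the sum would be the statement for the Laplacian.\<close>

lemma integral_gradient_orthogonal:
  assumes a: "C2_per a a1 a2 a11 a12 a21 a22" and b: "C2_per b b1 b2 b11 b12 b21 b22"
    and r: "C1_per r r1 r2" and div: "\<And>x. a1 x + b2 x = 0"
  shows "\<mu> (\<lambda>x. a11 x * r1 x) + \<mu> (\<lambda>x. b11 x * r2 x) = 0" (is ?P1)
    and "\<mu> (\<lambda>x. a22 x * r1 x) + \<mu> (\<lambda>x. b22 x * r2 x) = 0" (is ?P2)
proof -
  have ga: "C1_per a a1 a2" "C1_per a1 a11 a12" "C1_per a2 a21 a22"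
    and gb: "C1_per b b1 b2" "C1_per b1 b11 b12" "C1_per b2 b21 b22"
    using a b by (auto simp: C2_per_def)
  note c = C1_perD(2,3)[OF ga(2)] C1_perD(2,3)[OF ga(3)] C1_perD(2,3)[OF gb(2)] C1_perD(2,3)[OF gb(3)]
  have b2: "b2 = (\<lambda>x. - a1 x)" using div by (auto simp: fun_eq_iff eq_neg_iff_add_eq_0 add.commute)
  have hd: "half_diff h e (half_diff h e b2) x = - half_diff h e (half_diff h e a1) x" for h e x
    unfolding b2 half_diff_def by (simp add: diff_divide_distrib add_divide_distrib)
  \<comment> \<open>For second differences the argument needs only first derivatives: moving the
    gradient off \<open>r\<close> leaves the second difference of the divergence.\<close>
  have z: "\<mu> (\<lambda>x. half_diff h e (half_diff h e a) x * r1 x) +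
      \<mu> (\<lambda>x. half_diff h e (half_diff h e b) x * r2 x) = 0" for h e
    unfolding C1_per_half_diff_twice_by_parts(1)[OF ga(1) r] C1_per_half_diff_twice_by_parts(2)[OF gb(1) r] hd
    by simp
  have lim: "\<mu> (\<lambda>x. line_mean 0 e (line_mean 0 e k) x * r1 x) +
      \<mu> (\<lambda>x. line_mean 0 e (line_mean 0 e l) x * r2 x) = 0"
    if k: "continuous_on UNIV k" and l: "continuous_on UNIV l"
      and eq: "\<And>\<delta>. 0 < \<delta> \<Longrightarrow> \<mu> (\<lambda>x. line_mean \<delta> e (line_mean \<delta> e k) x * r1 x) +
      \<mu> (\<lambda>x. line_mean \<delta> e (line_mean \<delta> e l) x * r2 x) = 0" for e k l
  proof (rule continuous_eq_at_zero[where \<Psi> = "\<lambda>_. 0", OF _ _ eq])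
    have *: "continuous_on UNIV (\<lambda>(\<delta>::real, x). m x)" if "continuous_on UNIV m" for m :: "point \<Rightarrow> real"
      unfolding case_prod_unfold by (intro continuous_comp[OF that] continuous_intros)
    show "continuous_on UNIV (\<lambda>\<delta>. \<mu> (\<lambda>x. line_mean \<delta> e (line_mean \<delta> e k) x * r1 x) +
      \<mu> (\<lambda>x. line_mean \<delta> e (line_mean \<delta> e l) x * r2 x))"
      by (intro continuous_on_add continuous_integral_param continuous_line_mean_param * k l C1_perD(2,3)[OF r])
  qed auto
  have "\<mu> (\<lambda>x. line_mean 0 e1 (line_mean 0 e1 a11) x * r1 x) +
      \<mu> (\<lambda>x. line_mean 0 e1 (line_mean 0 e1 b11) x * r2 x) = 0"
  proof (intro lim c)
    fix \<delta> :: real assume "0 < \<delta>"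
    from z[of \<delta> e1]
    show "\<mu> (\<lambda>x. line_mean \<delta> e1 (line_mean \<delta> e1 a11) x * r1 x) +
      \<mu> (\<lambda>x. line_mean \<delta> e1 (line_mean \<delta> e1 b11) x * r2 x) = 0"
      unfolding half_diff_twice_eq_line_mean(1)[OF ga \<open>0 < \<delta>\<close>] half_diff_twice_eq_line_mean(1)[OF gb \<open>0 < \<delta>\<close>] .
  qed
  then show ?P1
    by simp
  have "\<mu> (\<lambda>x. line_mean 0 e2 (line_mean 0 e2 a22) x * r1 x) +
      \<mu> (\<lambda>x. line_mean 0 e2 (line_mean 0 e2 b22) x * r2 x) = 0"
  proof (intro lim c)
    fix \<delta> :: real assume "0 < \<delta>"
    from z[of \<delta> e2]
    show "\<mu> (\<lambda>x. line_mean \<delta> e2 (line_mean \<delta> e2 a22) x * r1 x) +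
      \<mu> (\<lambda>x. line_mean \<delta> e2 (line_mean \<delta> e2 b22) x * r2 x) = 0"
      unfolding half_diff_twice_eq_line_mean(2)[OF ga \<open>0 < \<delta>\<close>] half_diff_twice_eq_line_mean(2)[OF gb \<open>0 < \<delta>\<close>] .
  qed
  then show ?P2
    by simp
qed

text \<open>Expand the squares: the products of Laplacian and pressure gradient cancel between the
  two components, and the products of pure second derivatives are norms of mixed ones.\<close>

lemma Stokes_L2_identity:
  assumes a: "C2_per a a1 a2 a11 a12 a21 a22" and b: "C2_per b b1 b2 b11 b12 b21 b22"
    and r: "C1_per r r1 r2" and div: "\<And>x. a1 x + b2 x = 0"
  shows "\<mu> (\<lambda>x. (- (a11 x + a22 x) + r1 x)\<^sup>2) + \<mu> (\<lambda>x. (- (b11 x + b22 x) + r2 x)\<^sup>2)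
    = \<nu> a11 + \<nu> a12
    + \<nu> a21 + \<nu> a22
    + \<nu> b11 + \<nu> b12
    + \<nu> b21 + \<nu> b22
    + \<nu> r1 + \<nu> r2"
proof -
  have ga: "C1_per a a1 a2" "C1_per a1 a11 a12" "C1_per a2 a21 a22"
    and gb: "C1_per b b1 b2" "C1_per b1 b11 b12" "C1_per b2 b21 b22"
    using a b by (auto simp: C2_per_def)
  note c = C1_perD(2,3)[OF ga(2)] C1_perD(2,3)[OF ga(3)] C1_perD(2,3)[OF gb(2)] C1_perD(2,3)[OF gb(3)]
    C1_perD(2,3)[OF r]
  \<comment> \<open>The cross term is kept as two products in either order instead of doubling one:
    one order yields the norm of \<open>g12\<close>, the other that of \<open>g21\<close>.\<close>
  have expand: "\<mu> (\<lambda>x. (- (k x + l x) + m x)\<^sup>2) =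
      \<nu> k + \<mu> (\<lambda>x. k x * l x) + \<mu> (\<lambda>x. l x * k x)
      + \<nu> l + \<nu> m
      - 2 * (\<mu> (\<lambda>x. k x * m x) + \<mu> (\<lambda>x. l x * m x))"
    if "continuous_on UNIV k" "continuous_on UNIV l" "continuous_on UNIV m" for k l m :: "point \<Rightarrow> real"
  proof -
    have "(\<lambda>x. (- (k x + l x) + m x)\<^sup>2) = (\<lambda>x. (k x)\<^sup>2 + k x * l x + l x * k x + (l x)\<^sup>2 + (m x)\<^sup>2
        - 2 * (k x * m x + l x * m x))"
      by (auto simp: power2_eq_square algebra_simps)
    moreover have "\<mu> (\<lambda>x. l x * k x) = \<mu> (\<lambda>x. k x * l x)"
      by (simp add: mult.commute)
    ultimately show ?thesis
      by (simp add: cell_mean_linear that continuous_on_add continuous_on_mult continuous_on_power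
          continuous_on_const)
  qed
  have arith: "A + B + C + D + E - 2 * (p + s) + (F + G + H + K + L - 2 * (q + t)) =
      A + C + B + D + F + H + G + K + E + L"
    if "p + q = 0" "s + t = 0" for A B C D E F G H K L p q s t :: real
    using that by simp
  show ?thesis
    unfolding expand[OF c(1,4,9)] expand[OF c(5,8,10)] integral_hessian_minor[OF a] integral_hessian_minor[OF b]
    by (rule arith) (fact integral_gradient_orthogonal[OF a b r div])+
qed

section \<open>Truncation error\<close>

lemma C2_per_shift:
  assumes "C2_per g g1 g2 g11 g12 g21 g22"
  shows "C2_per (\<lambda>x. g (x + y)) (\<lambda>x. g1 (x + y)) (\<lambda>x. g2 (x + y)) (\<lambda>x. g11 (x + y)) (\<lambda>x. g12 (x + y))
    (\<lambda>x. g21 (x + y)) (\<lambda>x. g22 (x + y))"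
  using assms by (auto simp: C2_per_def intro: C1_per_shift)

lemma C2_per_diff:
  assumes "C2_per g g1 g2 g11 g12 g21 g22" "C2_per k k1 k2 k11 k12 k21 k22"
  shows "C2_per (\<lambda>x. g x - k x) (\<lambda>x. g1 x - k1 x) (\<lambda>x. g2 x - k2 x) (\<lambda>x. g11 x - k11 x) (\<lambda>x. g12 x - k12 x)
    (\<lambda>x. g21 x - k21 x) (\<lambda>x. g22 x - k22 x)"
  using assms by (auto simp: C2_per_def intro: C1_per_diff)

text \<open>Holds without integrability, since an integral that does not exist has the value
  0.\<close>

lemma integral_square_nonneg:
  fixes k :: "point \<Rightarrow> real"
  shows "0 \<le> \<nu> k"
  by (cases "(\<lambda>x. (k x)\<^sup>2) integrable_on unit_square") (auto intro: integral_nonneg simp: not_integrable_integral)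

lemma cell_mean_le_const:
  fixes k :: "point \<Rightarrow> real"
  assumes "continuous_on UNIV k" "\<And>x. k x \<le> B"
  shows "\<mu> k \<le> B"
  using integral_le[of k unit_square "\<lambda>_. B"] assms continuous_on_subset[OF assms(1), of unit_square]
  by (simp add: integrable_unit)

lemma Stokes_L2_estimate:
  assumes "C2_per a a1 a2 a11 a12 a21 a22" "C2_per b b1 b2 b11 b12 b21 b22" "C1_per r r1 r2"
    and "\<And>x. a1 x + b2 x = 0" and k: "k \<in> {a11, a12, a21, a22, b11, b12, b21, b22, r1, r2}"
  shows "\<nu> k \<le> \<mu> (\<lambda>x. (- (a11 x + a22 x) + r1 x)\<^sup>2)
    + \<mu> (\<lambda>x. (- (b11 x + b22 x) + r2 x)\<^sup>2)"
  unfolding Stokes_L2_identity[OF assms(1-4)]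
  using k integral_square_nonneg[of a11] integral_square_nonneg[of a12] integral_square_nonneg[of a21]
    integral_square_nonneg[of a22] integral_square_nonneg[of b11] integral_square_nonneg[of b12]
    integral_square_nonneg[of b21] integral_square_nonneg[of b22] integral_square_nonneg[of r1]
    integral_square_nonneg[of r2]
  by auto

text \<open>\<open>F\<close> bounds both the force and its Hoelder quotient with exponent
  \<open>\<beta>\<close>. Both are free parameters: the main instance takes \<open>\<beta>\<close>
  as the minimum of the given exponent and 1, and \<open>F = 0\<close> when that exponent exceeds
  1.\<close>

locale periodic_Stokes =
  fixes a a1 a2 a11 a12 a21 a22 b b1 b2 b11 b12 b21 b22 q q1 q2 f1 f2 :: "point \<Rightarrow> real"
    and F \<beta> :: real
  assumes a: "C2_per a a1 a2 a11 a12 a21 a22" and b: "C2_per b b1 b2 b11 b12 b21 b22"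
    and q: "C1_per q q1 q2"
    and div: "\<And>x. a1 x + b2 x = 0"
    and mom1: "\<And>x. - (a11 x + a22 x) + q1 x = f1 x"
    and mom2: "\<And>x. - (b11 x + b22 x) + q2 x = f2 x"
    and mean: "\<mu> q = 0"
    and bound: "\<And>x. \<bar>f1 x\<bar> \<le> F" "\<And>x. \<bar>f2 x\<bar> \<le> F"
    and hoelder1: "\<And>x y. \<bar>f1 x - f1 y\<bar> \<le> F * dist x y powr \<beta>"
    and hoelder2: "\<And>x y. \<bar>f2 x - f2 y\<bar> \<le> F * dist x y powr \<beta>"
    and beta: "0 < \<beta>" "\<beta> \<le> 1"

lemma (in periodic_Stokes) C1:
  "C1_per a a1 a2" "C1_per a1 a11 a12" "C1_per a2 a21 a22"
  "C1_per b b1 b2" "C1_per b1 b11 b12" "C1_per b2 b21 b22"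
  using a b by (auto simp: C2_per_def)

lemma (in periodic_Stokes) continuous_derivs:
  "continuous_on UNIV a" "continuous_on UNIV b" "continuous_on UNIV q"
  "continuous_on UNIV a11" "continuous_on UNIV a12" "continuous_on UNIV a21" "continuous_on UNIV a22"
  "continuous_on UNIV b11" "continuous_on UNIV b12" "continuous_on UNIV b21" "continuous_on UNIV b22"
  "continuous_on UNIV q1" "continuous_on UNIV q2"
  using C1_perD(2,3)[OF C1(2)] C1_perD(2,3)[OF C1(3)] C1_perD(2,3)[OF C1(5)] C1_perD(2,3)[OF C1(6)]
    C1_perD(2,3)[OF q] C1_per_cont[OF C1(1)] C1_per_cont[OF C1(4)] C1_per_cont[OF q]
  by auto

lemma (in periodic_Stokes) periodic_derivs:
  "periodic a" "periodic b" "periodic q"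
  "periodic a11" "periodic a12" "periodic a21" "periodic a22"
  "periodic b11" "periodic b12" "periodic b21" "periodic b22"
  "periodic q1" "periodic q2"
  using C1_per_periodic[OF C1(2)] C1_per_periodic[OF C1(3)] C1_per_periodic[OF C1(5)] C1_per_periodic[OF C1(6)]
    C1_per_periodic[OF q] C1_perD(1)[OF C1(1)] C1_perD(1)[OF C1(4)] C1_perD(1)[OF q]
  by auto

lemma (in periodic_Stokes) continuous_force: "continuous_on UNIV f1" "continuous_on UNIV f2"
proof -
  have "f1 = (\<lambda>x. - (a11 x + a22 x) + q1 x)" "f2 = (\<lambda>x. - (b11 x + b22 x) + q2 x)"
    using mom1 mom2 by auto
  then show "continuous_on UNIV f1" "continuous_on UNIV f2"
    by (auto intro!: continuous_intros continuous_derivs)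
qed

lemma (in periodic_Stokes) F_nonneg: "0 \<le> F"
  using bound(1) by (meson abs_ge_zero order_trans)

lemma (in periodic_Stokes) L2_bound:
  assumes "k \<in> {a11, a12, a21, a22, b11, b12, b21, b22, q1, q2}"
  shows "\<nu> k \<le> 2 * F\<^sup>2"
proof -
  have "(f1 x)\<^sup>2 \<le> F\<^sup>2" "(f2 x)\<^sup>2 \<le> F\<^sup>2" for x
    using bound[of x] F_nonneg by (simp_all flip: abs_le_square_iff)
  then have "\<nu> f1 \<le> F\<^sup>2" "\<nu> f2 \<le> F\<^sup>2"
    by (auto intro!: cell_mean_le_const continuous_intros continuous_force)
  then show ?thesis
    using Stokes_L2_estimate[OF a b q div assms] unfolding mom1 mom2 by simp
qed

text \<open>By linearity the translation differences of the solution solve the Stokes equations with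
  the translation difference of the force, so the energy identity applies to them.\<close>

lemma (in periodic_Stokes) L2_modulus:
  assumes "k \<in> {a11, a12, a21, a22, b11, b12, b21, b22, q1, q2}"
  shows "\<mu> (\<lambda>x. (k (x + y) - k x)\<^sup>2) \<le> 2 * F\<^sup>2 * (norm y powr \<beta>)\<^sup>2"
proof -
  define \<Delta> where "\<Delta> k x = k (x + y) - k x" for k :: "point \<Rightarrow> real" and x
  have e: "- (\<Delta> a11 x + \<Delta> a22 x) + \<Delta> q1 x = f1 (x + y) - f1 x"
    "- (\<Delta> b11 x + \<Delta> b22 x) + \<Delta> q2 x = f2 (x + y) - f2 x" for x
    using mom1[of x] mom1[of "x + y"] mom2[of x] mom2[of "x + y"] unfolding \<Delta>_def by linarith+
  have "(f1 (x + y) - f1 x)\<^sup>2 \<le> (F * norm y powr \<beta>)\<^sup>2" "(f2 (x + y) - f2 x)\<^sup>2 \<le> (F * norm y powr \<beta>)\<^sup>2" for x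
    using hoelder1[of "x + y" x] hoelder2[of "x + y" x] F_nonneg
    by (auto simp: abs_le_square_iff[symmetric] abs_mult dist_norm)
  then have le: "\<mu> (\<lambda>x. (f1 (x + y) - f1 x)\<^sup>2) \<le> F\<^sup>2 * (norm y powr \<beta>)\<^sup>2"
      "\<mu> (\<lambda>x. (f2 (x + y) - f2 x)\<^sup>2) \<le> F\<^sup>2 * (norm y powr \<beta>)\<^sup>2"
    by (auto intro!: cell_mean_le_const continuous_intros continuous_force
        continuous_comp[OF continuous_force(1)] continuous_comp[OF continuous_force(2)]
        simp: power_mult_distrib)
  have c2: "C2_per (\<Delta> a) (\<Delta> a1) (\<Delta> a2) (\<Delta> a11) (\<Delta> a12) (\<Delta> a21) (\<Delta> a22)"
    "C2_per (\<Delta> b) (\<Delta> b1) (\<Delta> b2) (\<Delta> b11) (\<Delta> b12) (\<Delta> b21) (\<Delta> b22)"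
    unfolding \<Delta>_def by (intro C2_per_diff C2_per_shift a b)+
  have c1: "C1_per (\<Delta> q) (\<Delta> q1) (\<Delta> q2)"
    unfolding \<Delta>_def by (intro C1_per_diff C1_per_shift q)
  have d: "\<Delta> a1 x + \<Delta> b2 x = 0" for x
    using div[of x] div[of "x + y"] unfolding \<Delta>_def by linarith
  have "\<Delta> k \<in> {\<Delta> a11, \<Delta> a12, \<Delta> a21, \<Delta> a22, \<Delta> b11, \<Delta> b12, \<Delta> b21, \<Delta> b22, \<Delta> q1, \<Delta> q2}"
    using assms by auto
  from Stokes_L2_estimate[OF c2 c1 d this]
  have "\<nu> (\<Delta> k) \<le> 2 * (F\<^sup>2 * (norm y powr \<beta>)\<^sup>2)"
    using le unfolding e by simp
  then show ?thesis unfolding \<Delta>_def by simp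
qed

section \<open>The residual of the averaged solution on the torus\<close>

lemma line_mean_diff:
  assumes "continuous_on UNIV g" "continuous_on UNIV k"
  shows "line_mean h e (\<lambda>x. g x - k x) = (\<lambda>x. line_mean h e g x - line_mean h e k x)"
  unfolding line_mean_def
  by (intro ext integral_diff integrable_unit continuous_comp[OF assms(1)]
      continuous_comp[OF assms(2)] continuous_intros)

lemma square_sum2_le: "(x + y)\<^sup>2 \<le> 2 * x\<^sup>2 + 2 * y\<^sup>2" for x y :: real
  using zero_le_power2[of "x - y"] by (simp add: power2_eq_square algebra_simps)

lemma square_sum3_le: "(x + y + z)\<^sup>2 \<le> 3 * (x\<^sup>2 + y\<^sup>2 + z\<^sup>2)" for x y z :: real
proof -
  have "0 \<le> (x - y)\<^sup>2 + (y - z)\<^sup>2 + (z - x)\<^sup>2" by simp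
  then show ?thesis by (simp add: power2_eq_square algebra_simps)
qed

lemma integral_square_sum3_le:
  fixes x y z :: "point \<Rightarrow> real"
  assumes c: "continuous_on UNIV x" "continuous_on UNIV y" "continuous_on UNIV z"
    and "\<nu> x \<le> A" "\<nu> y \<le> B"
      "\<nu> z \<le> C"
  shows "\<mu> (\<lambda>p. (x p + y p + z p)\<^sup>2) \<le> 3 * (A + B + C)"
proof -
  note ci = continuous_intros continuous_on_subset[OF c(1)] continuous_on_subset[OF c(2)] continuous_on_subset[OF c(3)]
  have "\<mu> (\<lambda>p. (x p + y p + z p)\<^sup>2) \<le> \<mu> (\<lambda>p. 3 * ((x p)\<^sup>2 + (y p)\<^sup>2 + (z p)\<^sup>2))"
    by (intro integral_le integrable_unit square_sum3_le ci) auto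
  also have "\<dots> = 3 * (\<nu> x + \<nu> y
      + \<nu> z)"
    using c by (simp add: cell_mean_linear continuous_on_add continuous_on_mult_left continuous_on_power)
  finally show ?thesis using assms(4-6) by simp
qed

text \<open>The deviation telescopes into three single deviations under further line means, which do
  not increase the L2 norm. The constant is \<open>3 * (1 + 1 + 1)\<close>.\<close>

lemma integral_line_mean_thrice_deviation_le:
  assumes c: "continuous_on UNIV k" and p: "periodic k"
    and B: "\<And>t e. \<lbrakk>t \<in> unit_interval; e \<in> {d1, d2, d3}\<rbrakk> \<Longrightarrow>
      \<mu> (\<lambda>x. (k (x + (t * h) *\<^sub>R e) - k x)\<^sup>2) \<le> B"
  shows "\<mu> (\<lambda>x. (line_mean h d3 (line_mean h d2 (line_mean h d1 k)) x - k x)\<^sup>2) \<le> 9 * B"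
proof -
  define r where "r e = (\<lambda>x. line_mean h e k x - k x)" for e
  have cr: "continuous_on UNIV (r e)" for e
    unfolding r_def by (intro continuous_intros continuous_line_mean c)
  have pr: "periodic (r e)" for e
    using periodic_line_mean[OF p, of h e] p by (simp add: r_def periodic_def)
  have r: "\<mu> (\<lambda>x. (r e x)\<^sup>2) \<le> B" if "e \<in> {d1, d2, d3}" for e
    unfolding r_def by (rule integral_line_mean_deviation_le[OF c p]) (use B that in auto)
  note m = integral_line_mean_square_le
  have eq: "line_mean h d3 (line_mean h d2 (line_mean h d1 k)) x - k x =
      line_mean h d3 (line_mean h d2 (r d1)) x + line_mean h d3 (r d2) x + r d3 x" for x
    unfolding r_def by (simp add: line_mean_diff continuous_line_mean c)
  have "\<mu> (\<lambda>x. (line_mean h d3 (line_mean h d2 (r d1)) x + line_mean h d3 (r d2) x + r d3 x)\<^sup>2)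
      \<le> 3 * (B + B + B)"
  proof (rule integral_square_sum3_le)
    have "\<mu> (\<lambda>x. (line_mean h d3 (line_mean h d2 (r d1)) x)\<^sup>2) \<le>
        \<mu> (\<lambda>x. (line_mean h d2 (r d1) x)\<^sup>2)"
      by (intro m continuous_line_mean periodic_line_mean cr pr)
    also have "\<dots> \<le> \<mu> (\<lambda>x. (r d1 x)\<^sup>2)" by (intro m cr pr)
    finally show "\<mu> (\<lambda>x. (line_mean h d3 (line_mean h d2 (r d1)) x)\<^sup>2) \<le> B"
      using r[of d1] by simp
    show "\<mu> (\<lambda>x. (line_mean h d3 (r d2) x)\<^sup>2) \<le> B"
      using m[OF cr pr, of h d3 d2] r[of d2] by simp
  qed (use r in \<open>auto intro!: continuous_line_mean cr\<close>)
  then show ?thesis unfolding eq by simp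
qed

text \<open>The residual with the transverse line mean only, before the square mean is taken. The
  constant is \<open>3 * (9 + 9 + 1)\<close>: each second difference of the averaged velocity is a
  triple line mean of a second derivative, two from the difference and one from the transverse
  averaging, and the pressure difference is a single one.\<close>

lemma Stokes_truncation_L2:
  assumes h: "0 < h"
    and a: "C1_per a a1 a2" "C1_per a1 a11 a12" "C1_per a2 a21 a22"
    and c: "continuous_on UNIV g" "periodic g"
    and d: "d = e1 \<or> d = e2" and e: "e = e1 \<or> e = e2" and qe: "half_diff h e q = line_mean h e g"
    and B: "\<And>y k. \<lbrakk>norm y \<le> h; k \<in> {a11, a22, g}\<rbrakk> \<Longrightarrow> \<mu> (\<lambda>x. (k (x + y) - k x)\<^sup>2) \<le> B"
  shows "\<mu> (\<lambda>x. ((- (a11 x + a22 x) + g x) -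
      (- five_point h (line_mean h d a) x + half_diff h e q x))\<^sup>2) \<le> 57 * B"
proof -
  note ca = C1_per_cont[OF a(1)] C1_perD(2)[OF a(2)] C1_perD(3)[OF a(3)]
  have nm: "norm ((t * h) *\<^sub>R e) \<le> h" if "t \<in> unit_interval" "e = e1 \<or> e = e2" for t and e :: point
  proof -
    have "norm e = 1" using that(2) by auto
    moreover have "\<bar>t\<bar> * h \<le> 1 * h"
      using that(1) h by (intro mult_right_mono) (auto simp: mem_unit_interval)
    ultimately show ?thesis using h by (simp add: abs_mult del: scaleR_Pair)
  qed
  have hd: "half_diff h e (half_diff h e (line_mean h d a)) = line_mean h d (half_diff h e (half_diff h e a))" for e
    by (simp add: half_diff_line_mean continuous_half_diff ca)
  define K1 where "K1 = line_mean h d (line_mean h e1 (line_mean h e1 a11))"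
  define K2 where "K2 = line_mean h d (line_mean h e2 (line_mean h e2 a22))"
  have fp: "five_point h (line_mean h d a) x = K1 x + K2 x" for x
    unfolding K1_def K2_def using h
    by (simp add: five_point_eq_half_diff hd half_diff_twice_eq_line_mean[OF a h])
  have eq: "(- (a11 x + a22 x) + g x) - (- five_point h (line_mean h d a) x + half_diff h e q x) =
      (K1 x - a11 x) + (K2 x - a22 x) + - (line_mean h e g x - g x)" for x
    unfolding fp qe by simp
  have "\<mu> (\<lambda>x. ((K1 x - a11 x) + (K2 x - a22 x) + - (line_mean h e g x - g x))\<^sup>2)
      \<le> 3 * (9 * B + 9 * B + B)"
  proof (rule integral_square_sum3_le)
    show "\<mu> (\<lambda>x. (K1 x - a11 x)\<^sup>2) \<le> 9 * B"
      unfolding K1_def using d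
      by (intro integral_line_mean_thrice_deviation_le ca C1_per_periodic[OF a(2)] B nm) auto
    show "\<mu> (\<lambda>x. (K2 x - a22 x)\<^sup>2) \<le> 9 * B"
      unfolding K2_def using d
      by (intro integral_line_mean_thrice_deviation_le ca C1_per_periodic[OF a(3)] B nm) auto
    show "\<mu> (\<lambda>x. (- (line_mean h e g x - g x))\<^sup>2) \<le> B"
      unfolding power2_minus using e by (intro integral_line_mean_deviation_le c B nm) auto
  qed (auto simp: K1_def K2_def intro!: continuous_intros continuous_line_mean ca c)
  then show ?thesis unfolding eq by simp
qed

section \<open>The residual at the lattice points\<close>

lemma half_diff_box_mean:
  assumes c: "continuous_on UNIV g"
  shows "half_diff h' e (box_mean h g) = box_mean h (half_diff h' e g)"
proof -
  have "box_mean h k = line_mean h e1 (line_mean h e2 k)" if "continuous_on UNIV k" for k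
    using box_mean_eq(1)[OF that] by (rule ext)
  then show ?thesis
    by (simp add: half_diff_line_mean continuous_line_mean continuous_half_diff c)
qed

lemma box_mean_linear:
  assumes "continuous_on UNIV g" "continuous_on UNIV k"
  shows "box_mean h (\<lambda>x. g x + k x) = (\<lambda>x. box_mean h g x + box_mean h k x)"
    and "box_mean h (\<lambda>x. g x - k x) = (\<lambda>x. box_mean h g x - box_mean h k x)"
  unfolding box_mean_def
  by (intro ext integral_add integral_diff integrable_unit continuous_comp[OF assms(1)]
        continuous_comp[OF assms(2)] continuous_intros)+

lemma box_mean_minus: "box_mean h (\<lambda>x. - g x) = (\<lambda>x. - box_mean h g x)"
  by (simp add: box_mean_def fun_eq_iff)

lemma five_point_box_mean:
  assumes "continuous_on UNIV g" "h \<noteq> 0"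
  shows "five_point h (box_mean h g) = box_mean h (five_point h g)"
proof -
  have "five_point h k = (\<lambda>x. half_diff h e1 (half_diff h e1 k) x + half_diff h e2 (half_diff h e2 k) x)" for k
    using five_point_eq_half_diff[OF assms(2)] by (rule ext)
  then show ?thesis
    using assms by (simp add: box_mean_linear(1) half_diff_box_mean continuous_half_diff)
qed

definition gridpt :: "real \<Rightarrow> int \<Rightarrow> int \<Rightarrow> point" where
  "gridpt h k j = (of_int k * h, of_int j * h)"

lemma gridpt_step:
  "gridpt h (k + 1) j = gridpt h k j + h *\<^sub>R e1" "gridpt h (k - 1) j = gridpt h k j - h *\<^sub>R e1"
  "gridpt h k (j + 1) = gridpt h k j + h *\<^sub>R e2" "gridpt h k (j - 1) = gridpt h k j - h *\<^sub>R e2"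
  by (auto simp: gridpt_def algebra_simps)

lemma grid_periodic_sample:
  assumes p: "periodic g" and n: "0 < n"
  shows "grid_periodic n (\<lambda>k j. g (gridpt (1 / real n) k j + x))"
proof -
  have "gridpt (1 / real n) (k + int n) j + x = gridpt (1 / real n) k j + e1 + x"
    "gridpt (1 / real n) k (j + int n) + x = gridpt (1 / real n) k j + e2 + x" for k j
    using n by (auto simp: gridpt_def field_simps)
  then show ?thesis unfolding grid_periodic_def using periodic_add[OF p] by (simp only: simp_thms)
qed

lemma five_point_grid:
  assumes "0 < n" "h = 1 / real n"
  shows "five_point h g (gridpt h k j + x) = (real n)\<^sup>2 * grid_laplacian (\<lambda>k j. g (gridpt h k j + x)) k j"
proof -
  have step: "gridpt h (k + 1) j + x = gridpt h k j + x + h *\<^sub>R e1"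
    "gridpt h (k - 1) j + x = gridpt h k j + x - h *\<^sub>R e1"
    "gridpt h k (j + 1) + x = gridpt h k j + x + h *\<^sub>R e2"
    "gridpt h k (j - 1) + x = gridpt h k j + x - h *\<^sub>R e2"
    unfolding gridpt_step by (auto simp: algebra_simps simp del: scaleR_Pair)
  show ?thesis
    unfolding five_point_def grid_laplacian_def step using assms
    by (simp add: power_divide)
qed

lemma half_diff_grid:
  assumes "0 < n" "h = 1 / real n"
  shows "half_diff h e1 g (gridpt h k j + (h/2) *\<^sub>R e1) =
      real n * (g (gridpt h (k + 1) j) - g (gridpt h k j))" (is ?P1)
    and "half_diff h e2 g (gridpt h k j + (h/2) *\<^sub>R e2) =
      real n * (g (gridpt h k (j + 1)) - g (gridpt h k j))" (is ?P2)
    and "half_diff h e1 g (gridpt h k j) =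
      real n * (g (gridpt h k j + (h/2) *\<^sub>R e1) - g (gridpt h (k - 1) j + (h/2) *\<^sub>R e1))" (is ?P3)
    and "half_diff h e2 g (gridpt h k j) =
      real n * (g (gridpt h k j + (h/2) *\<^sub>R e2) - g (gridpt h k (j - 1) + (h/2) *\<^sub>R e2))" (is ?P4)
proof -
  have d: "x + (h/2) *\<^sub>R e + (h/2) *\<^sub>R e = x + h *\<^sub>R e" for x e :: point
    by (simp add: add.assoc flip: scaleR_add_left)
  have d': "x - h *\<^sub>R e + (h/2) *\<^sub>R e = x - (h/2) *\<^sub>R e" for x e :: point
    using d[of "x - h *\<^sub>R e" e] by (metis add_diff_cancel_right' diff_add_cancel)
  have "1 / h = real n" using assms by simp
  then have n: "c / h = real n * c" for c by (metis divide_inverse inverse_eq_divide mult.commute)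
  show ?P1 and ?P2 and ?P3 and ?P4
    unfolding half_diff_def gridpt_step d d' n by (simp_all del: scaleR_Pair)
qed

lemma grid_sum_box_mean:
  assumes c: "continuous_on UNIV g" and p: "periodic g" and n: "0 < n" and L: "0 < L"
  shows "grid_sum n (\<lambda>k j. box_mean (real L / real n) g (gridpt (1 / real n) k j + x)) =
    (real n)\<^sup>2 * \<mu> g"
  using sum_box_means[OF assms, of x] by (simp add: grid_sum_def gridpt_def add.commute)

text \<open>The square mean commutes with the scheme. So the residual at a staggered point is the
  square mean of the residual on the torus, plus the change from the mean of \<open>f\<close> about
  that point to the value of \<open>f\<close> at the lattice point. The former is handled by
  Jensen's inequality and exact summation, the latter by Hoelder continuity.\<close>

lemma Stokes_truncation_grid:
  assumes n: "0 < n" "h = 1 / real n"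
    and a: "C1_per a a1 a2" "C1_per a1 a11 a12" "C1_per a2 a21 a22" and q: "continuous_on UNIV q"
    and c: "continuous_on UNIV g" "periodic g"
    and d: "d = e1 \<or> d = e2" and e: "e = e1 \<or> e = e2" and qe: "half_diff h e q = line_mean h e g"
    and B: "\<And>y k. \<lbrakk>norm y \<le> h; k \<in> {a11, a22, g}\<rbrakk> \<Longrightarrow> \<mu> (\<lambda>x. (k (x + y) - k x)\<^sup>2) \<le> B"
    and f: "\<And>x. f x = - (a11 x + a22 x) + g x"
    and A: "\<And>x y. norm (x - y) \<le> 2 * h \<Longrightarrow> \<bar>f x - f y\<bar> \<le> A"
  shows "grid_sum n (\<lambda>k j. (f (gridpt h k j) -
      (- five_point h (box_mean h (line_mean h d a)) (gridpt h k j + (h/2) *\<^sub>R e)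
       + half_diff h e (box_mean h q) (gridpt h k j + (h/2) *\<^sub>R e)))\<^sup>2) \<le> (real n)\<^sup>2 * (2 * A\<^sup>2 + 114 * B)"
proof -
  let ?r = "\<lambda>k j. (f (gridpt h k j) -
      (- five_point h (box_mean h (line_mean h d a)) (gridpt h k j + (h/2) *\<^sub>R e)
       + half_diff h e (box_mean h q) (gridpt h k j + (h/2) *\<^sub>R e)))\<^sup>2"
  have h: "0 < h" using n by simp
  note ca = C1_per_cont[OF a(1)] C1_perD(2)[OF a(2)] C1_perD(3)[OF a(3)]
  have fe: "f = (\<lambda>x. - (a11 x + a22 x) + g x)" using f by auto
  have cf: "continuous_on UNIV f" unfolding fe by (intro continuous_intros ca c)
  define r where "r x = f x - (- five_point h (line_mean h d a) x + half_diff h e q x)" for x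
  have cfp: "continuous_on UNIV (five_point h (line_mean h d a))"
    unfolding five_point_def divide_inverse
    by (intro continuous_intros continuous_comp[OF continuous_line_mean[OF ca(1)]])
  have cr: "continuous_on UNIV r" unfolding r_def
    by (intro continuous_intros cf cfp continuous_half_diff q)
  have pa: "periodic (line_mean h d a)" by (intro periodic_line_mean C1_perD(1)[OF a(1)])
  have pr: "periodic r"
  proof -
    have "periodic a11" "periodic a22" using C1_per_periodic[OF a(2)] C1_per_periodic[OF a(3)] by auto
    then have pf: "periodic f" unfolding fe periodic_def using c(2) by (simp add: periodic_def)
    have "periodic (five_point h (line_mean h d a))"
      using periodic_half_diff[OF periodic_half_diff[OF pa], of h e1 h e1]
        periodic_half_diff[OF periodic_half_diff[OF pa], of h e2 h e2] h
      by (simp add: periodic_def five_point_eq_half_diff)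
    moreover have "periodic (half_diff h e q)" unfolding qe by (intro periodic_line_mean c)
    ultimately show ?thesis using pf by (simp add: r_def periodic_def)
  qed
  have r2: "\<nu> r \<le> 57 * B"
    unfolding r_def f by (rule Stokes_truncation_L2[OF h a c d e qe B])
  have *: "?r k j
      \<le> 2 * A\<^sup>2 + 2 * box_mean h (\<lambda>x. (r x)\<^sup>2) (gridpt h k j + (h/2) *\<^sub>R e)" for k j
  proof -
    let ?y = "gridpt h k j" and ?z = "gridpt h k j + (h/2) *\<^sub>R e"
    have "box_mean h r = (\<lambda>x. box_mean h f x - (- box_mean h (five_point h (line_mean h d a)) x + box_mean h (half_diff h e q) x))"
      unfolding r_def
      by (simp add: box_mean_linear box_mean_minus cf cfp continuous_half_diff q continuous_on_add continuous_on_minus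
          del: uminus_add_conv_diff)
    then have eq: "f ?y - (- five_point h (box_mean h (line_mean h d a)) ?z + half_diff h e (box_mean h q) ?z)
        = (f ?y - box_mean h f ?z) + box_mean h r ?z"
      using h by (simp add: five_point_box_mean half_diff_box_mean continuous_line_mean ca q)
    have "f ?y - box_mean h f ?z = \<mu> (\<lambda>x. f ?y - f (?z + h *\<^sub>R x))"
      unfolding box_mean_def
      by (subst integral_diff) (auto intro!: integrable_unit continuous_comp[OF cf] continuous_intros)
    also have "\<bar>\<dots>\<bar> \<le> \<mu> (\<lambda>x. A)"
      unfolding real_norm_def[symmetric]
    proof (rule integral_norm_bound_integral)
      fix x assume x: "x \<in> unit_square"
      have "norm x \<le> \<bar>fst x\<bar> + \<bar>snd x\<bar>"
        using norm_Pair_le[of "fst x" "snd x"] by simp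
      then have "norm x \<le> 1" using x by (auto simp: mem_unit_square)
      then have "norm (h *\<^sub>R x) \<le> h" using h by simp
      moreover have "norm ((h/2) *\<^sub>R e) \<le> h" using e h by auto
      moreover have "?y - (?z + h *\<^sub>R x) = - ((h/2) *\<^sub>R e + h *\<^sub>R x)"
        by (simp add: algebra_simps del: scaleR_Pair)
      then have "norm (?y - (?z + h *\<^sub>R x)) \<le> norm ((h/2) *\<^sub>R e) + norm (h *\<^sub>R x)"
        using norm_triangle_ineq[of "(h/2) *\<^sub>R e" "h *\<^sub>R x"] by (simp only: norm_minus_cancel)
      \<comment> \<open>One \<open>h\<close> bounds the offset of the staggered point from the
        lattice point, the other the reach of the averaging square.\<close>
      ultimately have "norm (?y - (?z + h *\<^sub>R x)) \<le> 2 * h" by linarith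
      then show "norm (f ?y - f (?z + h *\<^sub>R x)) \<le> A" using A by simp
    qed (auto intro!: integrable_unit continuous_comp[OF cf] continuous_intros)
    finally have "(f ?y - box_mean h f ?z)\<^sup>2 \<le> A\<^sup>2"
      by (simp add: power2_le_iff_abs_le abs_le_square_iff[symmetric])
    moreover have "(box_mean h r ?z)\<^sup>2 \<le> box_mean h (\<lambda>x. (r x)\<^sup>2) ?z" by (rule box_mean_square_le[OF cr])
    moreover have "((f ?y - box_mean h f ?z) + box_mean h r ?z)\<^sup>2 \<le> 2 * (f ?y - box_mean h f ?z)\<^sup>2 + 2 * (box_mean h r ?z)\<^sup>2"
      by (rule square_sum2_le)
    ultimately show ?thesis unfolding eq by linarith
  qed
  have pr2: "periodic (\<lambda>x. (r x)\<^sup>2)" using pr by (simp add: periodic_def)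
  have cr2: "continuous_on UNIV (\<lambda>x. (r x)\<^sup>2)" by (intro continuous_intros cr)
  have "grid_sum n (\<lambda>k j. ?r k j)
      \<le> grid_sum n (\<lambda>k j. 2 * A\<^sup>2 + 2 * box_mean h (\<lambda>x. (r x)\<^sup>2) (gridpt h k j + (h/2) *\<^sub>R e))"
    by (rule grid_sum_mono[OF *])
  also have "\<dots> = (real n)\<^sup>2 * (2 * A\<^sup>2) + 2 * ((real n)\<^sup>2 * \<nu> r)"
    unfolding grid_linear n(2)
    using grid_sum_box_mean[OF cr2 pr2 n(1), of 1 "(1 / real n / 2) *\<^sub>R e"] by simp
  also have "\<dots> \<le> (real n)\<^sup>2 * (2 * A\<^sup>2) + 2 * ((real n)\<^sup>2 * (57 * B))"
    using r2 by (intro add_mono mult_left_mono) auto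
  finally show ?thesis by (simp add: algebra_simps)
qed

text \<open>Stability applied to the difference of the discrete solution and the averages. With
  \<open>A = 2 * F * h powr \<beta>\<close> and
  \<open>B = 2 * F\<^sup>2 * (h powr \<beta>)\<^sup>2\<close>, each component contributes
  \<open>8 + 228\<close>, which gives 472 for both. The first bound has no factor
  \<open>(real n)\<^sup>2\<close> because its differences are undivided.\<close>

lemma (in periodic_Stokes) discrete_solution_error:
  fixes u w P :: "point \<Rightarrow> real" and n :: nat and h :: real
  defines "x1 \<equiv> (h/2) *\<^sub>R e1" and "x2 \<equiv> (h/2) *\<^sub>R e2"
  defines "X \<equiv> \<lambda>k j. u (gridpt h k j + x1) - box_mean h (line_mean h e2 a) (gridpt h k j + x1)"
    and "Y \<equiv> \<lambda>k j. w (gridpt h k j + x2) - box_mean h (line_mean h e1 b) (gridpt h k j + x2)"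
    and "Z \<equiv> \<lambda>k j. P (gridpt h k j) - box_mean h q (gridpt h k j)"
  assumes n: "0 < n" and hn: "h = 1 / real n"
    and per: "grid_periodic n (\<lambda>k j. u (gridpt h k j + x1))" "grid_periodic n (\<lambda>k j. w (gridpt h k j + x2))"
      "grid_periodic n (\<lambda>k j. P (gridpt h k j))"
    and sumP: "grid_sum n (\<lambda>k j. P (gridpt h k j)) = 0"
    and eq1: "\<And>k j. - five_point h u (gridpt h k j + x1) + half_diff h e1 P (gridpt h k j + x1)
        = f1 (gridpt h k j)"
    and eq2: "\<And>k j. - five_point h w (gridpt h k j + x2) + half_diff h e2 P (gridpt h k j + x2)
        = f2 (gridpt h k j)"
    and eq3: "\<And>k j. half_diff h e1 u (gridpt h k j) + half_diff h e2 w (gridpt h k j) = 0"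
  shows "grid_sum n (\<lambda>k j. grid_grad X k j
        + (Y (k + 1) j - Y k j)\<^sup>2 + (Y k (j + 1) - Y k j)\<^sup>2) \<le> 472 * F\<^sup>2 * (h powr \<beta>)\<^sup>2" (is ?P1)
    and "grid_sq n Z \<le> 472 * (real n)\<^sup>2 * F\<^sup>2 * (h powr \<beta>)\<^sup>2" (is ?P2)
proof -
  have h: "0 < h" using n hn by simp
  define A where "A = 2 * F * h powr \<beta>"
  define B where "B = 2 * F\<^sup>2 * (h powr \<beta>)\<^sup>2"
  define abar where "abar = box_mean h (line_mean h e2 a)"
  define bbar where "bbar = box_mean h (line_mean h e1 b)"
  define qbar where "qbar = box_mean h q"
  define g1 where "g1 k j = f1 (gridpt h k j) - (- five_point h abar (gridpt h k j + x1)
      + half_diff h e1 qbar (gridpt h k j + x1))" for k j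
  define g2 where "g2 k j = f2 (gridpt h k j) - (- five_point h bbar (gridpt h k j + x2)
      + half_diff h e2 qbar (gridpt h k j + x2))" for k j
  have A: "F * dist x y powr \<beta> \<le> A" if "norm (x - y) \<le> 2 * h" for x y :: point
  proof -
    have "dist x y powr \<beta> \<le> (2 * h) powr \<beta>"
      using that beta by (intro powr_mono2) (auto simp: dist_norm)
    also have "\<dots> = 2 powr \<beta> * h powr \<beta>" using h by (simp add: powr_mult)
    also have "\<dots> \<le> 2 powr 1 * h powr \<beta>" using beta by (intro mult_right_mono powr_mono) auto
    finally show ?thesis unfolding A_def using mult_left_mono[OF _ F_nonneg] by fastforce
  qed
  have B: "\<mu> (\<lambda>x. (k (x + y) - k x)\<^sup>2) \<le> B"
    if "norm y \<le> h" "k \<in> {a11, a12, a21, a22, b11, b12, b21, b22, q1, q2}" for k and y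
  proof -
    have "(norm y powr \<beta>)\<^sup>2 \<le> (h powr \<beta>)\<^sup>2"
      using that(1) beta by (intro power_mono powr_mono2) auto
    then have "2 * F\<^sup>2 * (norm y powr \<beta>)\<^sup>2 \<le> B" unfolding B_def by (intro mult_left_mono) auto
    then show ?thesis using L2_modulus[OF that(2), of y] by linarith
  qed
  have A1: "\<bar>f1 x - f1 y\<bar> \<le> A" if "norm (x - y) \<le> 2 * h" for x y
    using A[OF that] hoelder1[of x y] by linarith
  have A2: "\<bar>f2 x - f2 y\<bar> \<le> A" if "norm (x - y) \<le> 2 * h" for x y
    using A[OF that] hoelder2[of x y] by linarith
  have G1: "grid_sq n g1 \<le> (real n)\<^sup>2 * (2 * A\<^sup>2 + 114 * B)"
    unfolding g1_def abar_def qbar_def x1_def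
    by (rule Stokes_truncation_grid[OF n hn C1(1,2,3) continuous_derivs(3) continuous_derivs(12) periodic_derivs(12)])
       (use B A1 mom1 half_diff_eq_line_mean(1)[OF q h] in auto)
  have G2: "grid_sq n g2 \<le> (real n)\<^sup>2 * (2 * A\<^sup>2 + 114 * B)"
    unfolding g2_def bbar_def qbar_def x2_def
    by (rule Stokes_truncation_grid[OF n hn C1(4,5,6) continuous_derivs(3) continuous_derivs(13) periodic_derivs(13)])
       (use B A2 mom2 half_diff_eq_line_mean(2)[OF q h] in auto)
  have cs: "grid_sum n (\<lambda>k j. (g1 k j)\<^sup>2 + (g2 k j)\<^sup>2) \<le> 472 * (real n)\<^sup>2 * F\<^sup>2 * (h powr \<beta>)\<^sup>2"
    using G1 G2 unfolding grid_linear A_def B_def by (simp add: power_mult_distrib algebra_simps)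
  have pabar: "periodic abar" "periodic bbar" "periodic qbar"
    unfolding abar_def bbar_def qbar_def by (intro periodic_box_mean periodic_line_mean periodic_derivs)+
  note samp = grid_periodic_sample[OF pabar(1) n, of x1] grid_periodic_sample[OF pabar(2) n, of x2]
    grid_periodic_sample[OF pabar(3) n, of 0]
  have pX: "grid_periodic n X" "grid_periodic n Y" "grid_periodic n Z"
    using per samp unfolding X_def Y_def Z_def abar_def bbar_def qbar_def hn by (simp_all add: grid_periodic_def)
  have lap: "grid_laplacian (\<lambda>k j. k1 k j - k2 k j) k j = grid_laplacian k1 k j - grid_laplacian k2 k j"
    for k1 k2 :: "int \<Rightarrow> int \<Rightarrow> real" and k j
    by (simp add: grid_laplacian_def algebra_simps)
  have m1: "- (real n)\<^sup>2 * grid_laplacian X k j + real n * (Z (k + 1) j - Z k j) = g1 k j" for k j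
    using eq1[of k j] unfolding g1_def X_def Z_def lap abar_def[symmetric] qbar_def[symmetric]
      five_point_grid[OF n hn] half_diff_grid(1)[OF n hn] x1_def
    by (simp add: algebra_simps)
  have m2: "- (real n)\<^sup>2 * grid_laplacian Y k j + real n * (Z k (j + 1) - Z k j) = g2 k j" for k j
    using eq2[of k j] unfolding g2_def Y_def Z_def lap bbar_def[symmetric] qbar_def[symmetric]
      five_point_grid[OF n hn] half_diff_grid(2)[OF n hn] x2_def
    by (simp add: algebra_simps)
  \<comment> \<open>The difference quotient supplies the line mean in the flux direction and the
    averaging the transverse one; together they form a square mean of the derivative, and the
    divergence equation applies under the means.\<close>
  have dbar: "half_diff h e1 abar y + half_diff h e2 bbar y = 0" for y
  proof -
    have "half_diff h e1 abar = box_mean h (box_mean h a1)"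
      unfolding abar_def using continuous_derivs(1)
      by (simp add: half_diff_box_mean half_diff_line_mean continuous_line_mean half_diff_eq_line_mean(1)[OF C1(1) h]
          box_mean_eq(2)[OF C1_per_cont[OF C1(2)], THEN ext, symmetric])
    moreover have "half_diff h e2 bbar = box_mean h (box_mean h b2)"
      unfolding bbar_def using continuous_derivs(2)
      by (simp add: half_diff_box_mean half_diff_line_mean continuous_line_mean half_diff_eq_line_mean(2)[OF C1(4) h]
          box_mean_eq(1)[OF C1_per_cont[OF C1(6)], THEN ext, symmetric])
    moreover have "b2 = (\<lambda>x. - a1 x)" using div by (auto simp: fun_eq_iff eq_neg_iff_add_eq_0 add.commute)
    ultimately show ?thesis by (simp add: box_mean_minus)
  qed
  have dv: "X k j - X (k - 1) j + Y k j - Y k (j - 1) = 0" for k j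
  proof -
    have "real n * (X k j - X (k - 1) j + Y k j - Y k (j - 1)) = 0"
      using eq3[of k j] dbar[of "gridpt h k j"]
      unfolding half_diff_grid(3)[OF n hn] half_diff_grid(4)[OF n hn] X_def Y_def x1_def x2_def abar_def bbar_def
      by (simp add: algebra_simps)
    then show ?thesis using n by simp
  qed
  \<comment> \<open>The square means of \<open>q\<close> tile the torus, so their sum is
    \<open>(real n)\<^sup>2\<close> times the mean of \<open>q\<close>, which is zero.\<close>
  have sz: "grid_sum n Z = 0"
  proof -
    have "grid_sum n (\<lambda>k j. box_mean h q (gridpt h k j)) = 0"
      using grid_sum_box_mean[OF continuous_derivs(3) periodic_derivs(3) n, of 1 0] mean hn by simp
    then show ?thesis unfolding Z_def grid_linear sumP by simp
  qed
  note st = discrete_Stokes_stability[OF n pX m1 m2 dv sz]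
  from order_trans[OF st(1) cs]
  have "(real n)\<^sup>2 * grid_sum n (\<lambda>k j. grid_grad X k j
        + (Y (k + 1) j - Y k j)\<^sup>2 + (Y k (j + 1) - Y k j)\<^sup>2) \<le> (real n)\<^sup>2 * (472 * F\<^sup>2 * (h powr \<beta>)\<^sup>2)"
    by (simp only: mult.assoc mult.left_commute[of 472])
  then show ?P1
    by (rule mult_left_le_imp_le) (use n in simp)
  show ?P2
    by (rule order_trans[OF st(2) cs])
qed

section \<open>Interpolation estimates\<close>

text \<open>Mean value inequality for a parameter integral. The bound \<open>\<Phi>\<close> is
  differentiable only in the open interval, which admits multiples of \<open>t powr \<beta>\<close>
  with unbounded derivative at 0.\<close>

lemma integral_increment_le:
  fixes \<psi> \<psi>' :: "real \<Rightarrow> point \<Rightarrow> real"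
  assumes der: "\<And>t y. ((\<lambda>t. \<psi> t y) has_real_derivative \<psi>' t y) (at t)"
    and c: "continuous_on UNIV (\<lambda>(t, y). \<psi> t y)" "continuous_on UNIV (\<lambda>(t, y). \<psi>' t y)"
    and \<Phi>: "continuous_on {0..1} \<Phi>" "\<And>t. \<lbrakk>0 < t; t < 1\<rbrakk> \<Longrightarrow> (\<Phi> has_real_derivative \<Phi>' t) (at t)"
    and le: "\<And>t. \<lbrakk>0 < t; t < 1\<rbrakk> \<Longrightarrow> \<bar>\<mu> (\<psi>' t)\<bar> \<le> \<Phi>' t"
  shows "\<bar>\<mu> (\<psi> 1) - \<mu> (\<psi> 0)\<bar> \<le> \<Phi> 1 - \<Phi> 0"
proof -
  have "continuous_on S (\<psi> t)" for t S
    using continuous_comp[OF c(1), of S "\<lambda>y. (t, y)"] by (simp add: continuous_on_Pair)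
  then have i: "\<psi> t integrable_on cbox (-1/2, -1/2) (1/2, 1/2)" for t
    by (intro integrable_continuous)
  have d: "((\<lambda>t. \<mu> (\<psi> t)) has_real_derivative \<mu> (\<psi>' t)) (at t)" for t
    unfolding unit_square_def
    by (rule leibniz_rule_field_derivative[of UNIV, simplified])
       (use der i in \<open>auto intro: continuous_on_subset[OF c(2)]\<close>)
  have "norm (\<mu> (\<psi> 1) - \<mu> (\<psi> 0)) \<le> \<Phi> 1 - \<Phi> 0"
  proof (rule differentiable_bound_general[where f' = "\<lambda>t. \<mu> (\<psi>' t)" and \<phi>' = \<Phi>'])
    show "continuous_on {0..1} (\<lambda>t. \<mu> (\<psi> t))"
      by (rule continuous_integral_square[OF c(1)])
  qed (use \<Phi> d le in \<open>auto simp: has_real_derivative_iff_has_vector_derivative\<close>)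
  then show ?thesis by simp
qed

lemma abs_cell_mean_le:
  fixes f g :: "point \<Rightarrow> real"
  assumes "continuous_on unit_square f" "continuous_on unit_square g" "\<And>y. y \<in> unit_square \<Longrightarrow> \<bar>f y\<bar> \<le> g y"
  shows "\<bar>\<mu> f\<bar> \<le> \<mu> g"
  using integral_norm_bound_integral[of f unit_square g] assms by (simp add: integrable_unit)

text \<open>Jensen's inequality on the small square, then comparison with the large one: in two
  dimensions the Jacobian is \<open>\<sigma>\<^sup>2\<close>, whose root is the factor
  \<open>\<sigma>\<close>.\<close>

lemma box_mean_dilate_le:
  assumes c: "continuous_on UNIV w" and s: "0 < \<sigma>"
    and sub: "\<And>y. y \<in> unit_square \<Longrightarrow> c + \<sigma> *\<^sub>R y \<in> unit_square"
  shows "\<sigma> * \<bar>box_mean (\<sigma> * H) w (z + H *\<^sub>R c)\<bar> \<le> sqrt (box_mean H (\<lambda>x. (w x)\<^sup>2) z)"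
proof (rule real_le_rsqrt)
  have "(\<sigma> * \<bar>box_mean (\<sigma> * H) w (z + H *\<^sub>R c)\<bar>)\<^sup>2 = \<sigma>\<^sup>2 * (box_mean (\<sigma> * H) w (z + H *\<^sub>R c))\<^sup>2"
    by (simp add: power_mult_distrib)
  also have "\<dots> \<le> \<sigma>\<^sup>2 * box_mean (\<sigma> * H) (\<lambda>x. (w x)\<^sup>2) (z + H *\<^sub>R c)"
    by (intro mult_left_mono box_mean_square_le c) auto
  also have "\<dots> = \<sigma>\<^sup>2 * \<mu> (\<lambda>y. (\<lambda>y. (w (z + H *\<^sub>R y))\<^sup>2) (c + \<sigma> *\<^sub>R y))"
    unfolding box_mean_def by (simp add: scaleR_add_right add.assoc mult.commute)
  also have "\<dots> \<le> \<mu> (\<lambda>y. (w (z + H *\<^sub>R y))\<^sup>2)"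
    by (intro integral_dilate_le s sub) (auto intro!: continuous_intros continuous_comp[OF c])
  finally show "(\<sigma> * \<bar>box_mean (\<sigma> * H) w (z + H *\<^sub>R c)\<bar>)\<^sup>2 \<le> box_mean H (\<lambda>x. (w x)\<^sup>2) z"
    unfolding box_mean_def .
qed

lemma unit_square_convex_comb:
  assumes "y0 \<in> unit_square" "y \<in> unit_square" "0 \<le> t" "t \<le> 1"
  shows "t *\<^sub>R y0 + (1 - t) *\<^sub>R y \<in> unit_square"
  using convexD[of unit_square y0 y t "1 - t"] assms by (simp add: unit_square_def)

text \<open>Taylor's formula with base points averaged over the square of side \<open>H\<close>. Contracting the
  square to \<open>p\<close> costs a factor \<open>1 / (1 - t)\<close> in the \<open>L\<^sup>2\<close> mean, which the weight \<open>1 - t\<close> of the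
  second-order remainder absorbs; so the remainder is bounded by the \<open>L\<^sup>2\<close> mean of the Hessian.\<close>

lemma averaged_Taylor:
  assumes g: "C2_per g g1 g2 g11 g12 g21 g22" and H: "0 < H"
  shows "\<exists>c0 c1 c2. \<forall>p. \<bar>fst p - fst z\<bar> \<le> H / 2 \<and> \<bar>snd p - snd z\<bar> \<le> H / 2 \<longrightarrow>
    \<bar>g p - (c0 + c1 * fst p + c2 * snd p)\<bar> \<le>
      H\<^sup>2 * sqrt (box_mean H (\<lambda>x. (\<bar>g11 x\<bar> + \<bar>g12 x\<bar> + \<bar>g21 x\<bar> + \<bar>g22 x\<bar>)\<^sup>2) z)"
proof -
  have C: "C1_per g g1 g2" "C1_per g1 g11 g12" "C1_per g2 g21 g22" using g by (auto simp: C2_per_def)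
  note cg = C1_per_cont[OF C(1)] C1_per_cont[OF C(2)] C1_per_cont[OF C(3)]
    C1_perD(2,3)[OF C(2)] C1_perD(2,3)[OF C(3)]
  note cc = continuous_comp[OF cg(1)] continuous_comp[OF cg(2)] continuous_comp[OF cg(3)]
    continuous_comp[OF cg(4)] continuous_comp[OF cg(5)] continuous_comp[OF cg(6)]
    continuous_comp[OF cg(7)]
  define c1 where "c1 = box_mean H g1 z"
  define c2 where "c2 = box_mean H g2 z"
  \<comment> \<open>\<open>c0\<close>, \<open>c1\<close> and \<open>c2\<close> are the coefficients
    of the first-order Taylor polynomials, averaged over the base point; they do not depend on
    \<open>p\<close>.\<close>
  define c0 where "c0 = \<mu> (\<lambda>y. g (z + H *\<^sub>R y) - g1 (z + H *\<^sub>R y) * fst (z + H *\<^sub>R y)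
      - g2 (z + H *\<^sub>R y) * snd (z + H *\<^sub>R y))"
  define w where "w x = \<bar>g11 x\<bar> + \<bar>g12 x\<bar> + \<bar>g21 x\<bar> + \<bar>g22 x\<bar>" for x
  define W where "W = sqrt (box_mean H (\<lambda>x. (w x)\<^sup>2) z)"
  have cw: "continuous_on UNIV w" unfolding w_def by (intro continuous_intros cg)
  have "\<bar>g p - (c0 + c1 * fst p + c2 * snd p)\<bar> \<le> H\<^sup>2 * W"
    if p: "\<bar>fst p - fst z\<bar> \<le> H / 2" "\<bar>snd p - snd z\<bar> \<le> H / 2" for p
  proof -
    define y0 where "y0 = (1 / H) *\<^sub>R (p - z)"
    have py: "p = z + H *\<^sub>R y0" using H by (simp add: y0_def)
    have y0: "y0 \<in> unit_square" using p H unfolding py by (simp add: mem_unit_square abs_mult field_simps)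
    define \<xi> where "\<xi> y = H *\<^sub>R (y0 - y)" for y :: point
    define X where "X t y = (z + H *\<^sub>R y) + t *\<^sub>R \<xi> y" for t :: real and y
    \<comment> \<open>The value at \<open>p\<close> of the Taylor polynomial based at
      \<open>X t y\<close>, a point moving from the base point at \<open>t = 0\<close> to
      \<open>p\<close> at \<open>t = 1\<close>. In its derivative the first-order terms
      cancel.\<close>
    define \<psi> where "\<psi> t y = g (X t y) + (1 - t) * (g1 (X t y) * fst (\<xi> y) + g2 (X t y) * snd (\<xi> y))" for t y
    define \<psi>' where "\<psi>' t y = (1 - t) * ((g11 (X t y) * fst (\<xi> y) + g12 (X t y) * snd (\<xi> y)) * fst (\<xi> y)
      + (g21 (X t y) * fst (\<xi> y) + g22 (X t y) * snd (\<xi> y)) * snd (\<xi> y))" for t y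
    have Xc: "X t y = z + H *\<^sub>R (t *\<^sub>R y0) + ((1 - t) * H) *\<^sub>R y" for t y
      unfolding X_def \<xi>_def by (simp add: algebra_simps)
    have cX: "continuous_on S (\<lambda>v. X (fst v) (snd v))" "continuous_on S' (X t)" for S S' t
      unfolding X_def \<xi>_def by (intro continuous_intros)+
    have c\<xi>: "continuous_on S \<xi>" for S unfolding \<xi>_def by (intro continuous_intros)
    note c\<xi>' = continuous_comp[OF c\<xi>]
    have "\<bar>\<mu> (\<psi> 1) - \<mu> (\<psi> 0)\<bar> \<le> (H\<^sup>2 * W) * 1 - (H\<^sup>2 * W) * 0"
    proof (rule integral_increment_le)
      fix t y
      have X_der: "((\<lambda>t. k (X t y)) has_real_derivative k1 (X t y) * fst (\<xi> y) + k2 (X t y) * snd (\<xi> y)) (at t)"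
        if "C1_per k k1 k2" for k k1 k2
        unfolding X_def by (rule C1_per_along[OF that])
      show "((\<lambda>t. \<psi> t y) has_real_derivative \<psi>' t y) (at t)"
        unfolding \<psi>_def \<psi>'_def
        by (auto intro!: derivative_eq_intros X_der[OF C(1)] X_der[OF C(2)] X_der[OF C(3)] simp: algebra_simps)
    next
      show "continuous_on UNIV (\<lambda>(t, y). \<psi> t y)" "continuous_on UNIV (\<lambda>(t, y). \<psi>' t y)"
        unfolding \<psi>_def \<psi>'_def case_prod_unfold by (intro continuous_intros cc cX c\<xi>')+
      show "continuous_on {0..1} (\<lambda>t. (H\<^sup>2 * W) * t)" by (intro continuous_intros)
      show "((\<lambda>t. (H\<^sup>2 * W) * t) has_real_derivative H\<^sup>2 * W) (at t)" for t
        by (auto intro!: derivative_eq_intros)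
      fix t :: real assume t: "0 < t" "t < 1"
      have xi: "\<bar>fst (\<xi> y)\<bar> \<le> H" "\<bar>snd (\<xi> y)\<bar> \<le> H" if "y \<in> unit_square" for y
      proof -
        have "\<bar>fst y0 - fst y\<bar> \<le> 1" "\<bar>snd y0 - snd y\<bar> \<le> 1"
          using y0 that unfolding mem_unit_square by linarith+
        then show "\<bar>fst (\<xi> y)\<bar> \<le> H" "\<bar>snd (\<xi> y)\<bar> \<le> H" using H by (auto simp: \<xi>_def abs_mult)
      qed
      have "\<bar>\<mu> (\<psi>' t)\<bar> \<le> \<mu> (\<lambda>y. (1 - t) * H\<^sup>2 * w (X t y))"
      proof (rule abs_cell_mean_le)
        show "continuous_on unit_square (\<psi>' t)" unfolding \<psi>'_def
          by (intro continuous_intros cc cX c\<xi>)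
        show "continuous_on unit_square (\<lambda>y. (1 - t) * H\<^sup>2 * w (X t y))"
          by (intro continuous_intros continuous_comp[OF cw] cX)
        fix y assume y: "y \<in> unit_square"
        have m: "\<bar>k * s * s'\<bar> \<le> \<bar>k\<bar> * H\<^sup>2" if "\<bar>s\<bar> \<le> H" "\<bar>s'\<bar> \<le> H" for k s s' :: real
        proof -
          have "\<bar>s\<bar> * \<bar>s'\<bar> \<le> H * H" using that H by (intro mult_mono) auto
          then show ?thesis by (simp add: abs_mult power2_eq_square mult.assoc mult_left_mono)
        qed
        have "\<bar>(g11 (X t y) * fst (\<xi> y) + g12 (X t y) * snd (\<xi> y)) * fst (\<xi> y)
            + (g21 (X t y) * fst (\<xi> y) + g22 (X t y) * snd (\<xi> y)) * snd (\<xi> y)\<bar> \<le> H\<^sup>2 * w (X t y)"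
          using m[OF xi(1)[OF y] xi(1)[OF y], of "g11 (X t y)"] m[OF xi(2)[OF y] xi(1)[OF y], of "g12 (X t y)"]
            m[OF xi(1)[OF y] xi(2)[OF y], of "g21 (X t y)"] m[OF xi(2)[OF y] xi(2)[OF y], of "g22 (X t y)"]
          unfolding w_def distrib_left distrib_right mult.commute[of "H\<^sup>2"] by linarith
        then show "\<bar>\<psi>' t y\<bar> \<le> (1 - t) * H\<^sup>2 * w (X t y)"
          unfolding \<psi>'_def using t by (simp add: abs_mult mult.assoc mult_left_mono)
      qed
      \<comment> \<open>For fixed \<open>t\<close> the points \<open>X t y\<close> fill a square of
        side \<open>(1 - t) * H\<close>; the factor \<open>1 - t\<close> is exactly what
        \<open>box_mean_dilate_le\<close> requires.\<close>
      also have "\<dots> = H\<^sup>2 * ((1 - t) * box_mean ((1 - t) * H) w (z + H *\<^sub>R (t *\<^sub>R y0)))"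
        unfolding box_mean_def Xc by simp
      also have "\<dots> \<le> H\<^sup>2 * ((1 - t) * \<bar>box_mean ((1 - t) * H) w (z + H *\<^sub>R (t *\<^sub>R y0))\<bar>)"
        using t by (intro mult_left_mono) auto
      also have "\<dots> \<le> H\<^sup>2 * W"
        unfolding W_def using t
        by (intro mult_left_mono box_mean_dilate_le cw unit_square_convex_comb y0) auto
      finally show "\<bar>\<mu> (\<psi>' t)\<bar> \<le> H\<^sup>2 * W" .
    qed
    moreover have "\<mu> (\<psi> 1) = g p"
      unfolding \<psi>_def Xc using py by simp
    moreover have "\<mu> (\<psi> 0) = c0 + c1 * fst p + c2 * snd p"
    proof -
      let ?x = "\<lambda>y. z + H *\<^sub>R y"
      have "\<psi> 0 = (\<lambda>y. (g (?x y) - g1 (?x y) * fst (?x y) - g2 (?x y) * snd (?x y))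
          + g1 (?x y) * fst p + g2 (?x y) * snd p)"
        unfolding \<psi>_def Xc \<xi>_def py by (simp add: fun_eq_iff algebra_simps)
      then show ?thesis
        unfolding c0_def c1_def c2_def box_mean_def
        by (simp add: cell_mean_linear(1) continuous_on_add continuous_on_diff continuous_on_mult
            continuous_on_const continuous_on_fst continuous_on_snd continuous_on_scaleR continuous_on_id cc)
    qed
    ultimately show ?thesis by simp
  qed
  then show ?thesis unfolding W_def w_def by blast
qed

section \<open>Square means and point values of the pressure\<close>

lemma integral_unit_interval_ident: "\<mu>\<^sub>1 (\<lambda>t. t) = 0"
proof -
  have "((\<lambda>t::real. t) has_integral ((1/2)\<^sup>2 / 2 - (-1/2)\<^sup>2 / 2)) {-1/2..1/2}"
    by (rule fundamental_theorem_of_calculus)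
       (auto intro!: derivative_eq_intros simp: has_real_derivative_iff_has_vector_derivative[symmetric])
  then show ?thesis
    unfolding unit_interval_def by (auto dest: integral_unique simp: power2_eq_square)
qed

lemma cell_mean_coord:
  "\<mu> fst = 0" "\<mu> snd = 0"
  by (subst cell_mean_iterated;
      simp add: integral_unit_interval_ident continuous_on_fst continuous_on_snd continuous_on_id)+

text \<open>Subtracting the mean of \<open>k\<close> over the square and doubling the square, the first moment is an
  average of differences \<open>k (x + y) - k x\<close> with \<open>norm y \<le> 2 * r\<close>. This gains the factor
  \<open>r powr \<beta>\<close> that makes the bound integrable at \<open>r = 0\<close>.\<close>

lemma moment_le:
  assumes k: "continuous_on UNIV k" "periodic k"
    and B: "0 \<le> B" and beta: "0 < \<beta>" "\<beta> \<le> 1"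
    and mod: "\<And>y. \<mu> (\<lambda>x. (k (x + y) - k x)\<^sup>2) \<le> (B * norm y powr \<beta>)\<^sup>2"
    and r: "0 < r" "r \<le> 1"
    and l: "continuous_on UNIV l" "\<mu> l = 0" "\<And>y. y \<in> unit_square \<Longrightarrow> \<bar>l y\<bar> \<le> 1/2"
  shows "\<bar>\<mu> (\<lambda>y. k (p + r *\<^sub>R y) * l y)\<bar> \<le> 2 * B * r powr \<beta> / r"
proof -
  note ck = continuous_comp[OF k(1)]
  define m where "m = box_mean r k p"
  let ?d = "\<lambda>y \<eta>. (k (p + r *\<^sub>R y) - k (p + r *\<^sub>R y + (2 * r) *\<^sub>R \<eta>))\<^sup>2"
  define \<kappa> where "\<kappa> y = k (p + r *\<^sub>R y)" for y
  have c\<kappa>: "continuous_on S \<kappa>" for S unfolding \<kappa>_def by (intro ck continuous_intros)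
  note c\<kappa>' = continuous_comp[OF c\<kappa>]
  have cl: "continuous_on S l" for S by (rule continuous_on_subset[OF l(1)]) simp
  have m: "m = \<mu> \<kappa>" unfolding m_def box_mean_def \<kappa>_def ..
  \<comment> \<open>Substitute \<open>\<eta> = (w - y) / 2\<close>, which lies in the unit square
    again and has Jacobian \<open>1/4\<close>. The increment \<open>\<eta>\<close> is then
    independent of \<open>y\<close>, so the integrals can be exchanged.\<close>
  have dbl: "\<mu> (\<lambda>w. (\<kappa> y - \<kappa> w)\<^sup>2) \<le>
      4 * \<mu> (\<lambda>\<eta>. ?d y \<eta>)"
    if y: "y \<in> unit_square" for y
  proof -
    let ?K = "\<lambda>\<eta>. ?d y \<eta>"
    have "(1/2)\<^sup>2 * \<mu> (\<lambda>w. ?K (- ((1/2) *\<^sub>R y) + (1/2) *\<^sub>R w)) \<le> \<mu> ?K"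
    proof (intro integral_dilate_le)
      show "- ((1/2) *\<^sub>R y) + (1/2) *\<^sub>R w \<in> unit_square" if "w \<in> unit_square" for w
      proof -
        have "\<bar>- (1/2 * c) + 1/2 * d\<bar> \<le> 1/2" if "\<bar>c\<bar> \<le> 1/2" "\<bar>d\<bar> \<le> 1/2" for c d :: real
          using that by linarith
        from this[of "fst y" "fst w"] this[of "snd y" "snd w"] show ?thesis
          using y that by (simp add: mem_unit_square)
      qed
    qed (auto intro!: continuous_intros ck)
    moreover have "?K (- ((1/2) *\<^sub>R y) + (1/2) *\<^sub>R w) = (\<kappa> y - \<kappa> w)\<^sup>2" for w
      unfolding \<kappa>_def by (simp add: algebra_simps)
    ultimately show ?thesis by (simp add: power2_eq_square)
  qed
  \<comment> \<open>For a fixed increment the integral over the small square is at most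
    \<open>1 / r\<^sup>2\<close> times the one over the whole cell, where the L2 modulus
    applies.\<close>
  have inner: "\<mu> (\<lambda>y. ?d y \<eta>) \<le>
      (2 * B * r powr \<beta> / r)\<^sup>2" if eta: "\<eta> \<in> unit_square" for \<eta>
  proof -
    let ?D = "\<lambda>x. (k (x + (2 * r) *\<^sub>R \<eta>) - k x)\<^sup>2"
    have cD: "continuous_on UNIV ?D" by (intro continuous_intros ck k)
    have pD: "periodic ?D" using periodic_shift[OF k(2), of "(2 * r) *\<^sub>R \<eta>"] k(2) by (simp add: periodic_def)
    have "norm \<eta> \<le> \<bar>fst \<eta>\<bar> + \<bar>snd \<eta>\<bar>" using norm_Pair_le[of "fst \<eta>" "snd \<eta>"] by simp
    then have "norm \<eta> \<le> 1" using eta by (auto simp: mem_unit_square)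
    then have "norm ((2 * r) *\<^sub>R \<eta>) \<le> 2 * r" using r by (simp add: abs_mult)
    then have "norm ((2 * r) *\<^sub>R \<eta>) powr \<beta> \<le> (2 * r) powr \<beta>" using beta by (intro powr_mono2) auto
    also have "\<dots> = 2 powr \<beta> * r powr \<beta>" using r by (simp add: powr_mult)
    also have "\<dots> \<le> 2 powr 1 * r powr \<beta>" using beta by (intro mult_right_mono powr_mono) auto
    finally have "B * norm ((2 * r) *\<^sub>R \<eta>) powr \<beta> \<le> B * (2 * r powr \<beta>)"
      using B by (intro mult_left_mono) auto
    then have "(B * norm ((2 * r) *\<^sub>R \<eta>) powr \<beta>)\<^sup>2 \<le> (B * (2 * r powr \<beta>))\<^sup>2"
      using B by (intro power_mono) auto
    with mod have D: "\<mu> ?D \<le> (B * (2 * r powr \<beta>))\<^sup>2" by (rule order_trans)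
    have "r\<^sup>2 * \<mu> (\<lambda>y. (\<lambda>y. ?D (p + y)) (0 + r *\<^sub>R y)) \<le> \<mu> (\<lambda>y. ?D (p + y))"
    proof (rule integral_dilate_le)
      show "continuous_on UNIV (\<lambda>y. ?D (p + y))" by (intro continuous_intros ck)
      show "0 + r *\<^sub>R y \<in> unit_square" if y: "y \<in> unit_square" for y
        using that r mult_mono[of r 1 "\<bar>fst y\<bar>" "1/2"] mult_mono[of r 1 "\<bar>snd y\<bar>" "1/2"]
        by (simp add: mem_unit_square abs_mult)
    qed (use r in auto)
    also have "\<dots> = \<mu> ?D" by (rule cell_mean_shift[OF cD pD])
    finally have "r\<^sup>2 * \<mu> (\<lambda>y. ?D (p + r *\<^sub>R y)) \<le> (B * (2 * r powr \<beta>))\<^sup>2" using D by simp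
    then have "\<mu> (\<lambda>y. ?D (p + r *\<^sub>R y)) \<le> (B * (2 * r powr \<beta>))\<^sup>2 / r\<^sup>2"
      using r by (simp add: pos_le_divide_eq mult.commute)
    then show ?thesis by (simp add: power2_commute power_divide power_mult_distrib mult_ac)
  qed
  have "\<mu> (\<lambda>y. \<kappa> y * l y) = \<mu> (\<lambda>y. (\<kappa> y - m) * l y)"
  proof -
    have "\<mu> (\<lambda>y. (\<kappa> y - m) * l y) = \<mu> (\<lambda>y. \<kappa> y * l y - m * l y)"
      by (simp add: algebra_simps)
    also have "\<dots> = \<mu> (\<lambda>y. \<kappa> y * l y) - m * \<mu> l"
      by (subst cell_mean_linear(2)) (auto intro!: continuous_intros c\<kappa> cl)
    finally show ?thesis by (simp add: l)
  qed
  also have "\<bar>\<dots>\<bar> \<le> \<mu> (\<lambda>y. 1/2 * \<bar>\<kappa> y - m\<bar>)"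
  proof (rule abs_cell_mean_le)
    fix y assume "y \<in> unit_square"
    from mult_left_mono[OF l(3)[OF this], of "\<bar>\<kappa> y - m\<bar>"]
    show "\<bar>(\<kappa> y - m) * l y\<bar> \<le> 1/2 * \<bar>\<kappa> y - m\<bar>" by (simp add: abs_mult)
  qed (intro continuous_intros c\<kappa> cl)+
  also have "\<dots> = 1/2 * \<mu> (\<lambda>y. \<bar>\<kappa> y - m\<bar>)" by (rule integral_mult_right)
  also have "\<mu> (\<lambda>y. \<bar>\<kappa> y - m\<bar>) \<le> 2 * (2 * B * r powr \<beta> / r)"
  proof (rule power2_le_imp_le)
    have "(\<mu> (\<lambda>y. \<bar>\<kappa> y - m\<bar>))\<^sup>2 \<le> \<mu> (\<lambda>y. \<bar>\<kappa> y - m\<bar>\<^sup>2)"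
      by (intro cell_mean_le continuous_intros c\<kappa>)
    also have "\<dots> \<le> \<mu> (\<lambda>y. 4 * \<mu>
        (\<lambda>\<eta>. ?d y \<eta>))"
    proof (intro integral_le integrable_unit)
      show "continuous_on unit_square (\<lambda>y. 4 * \<mu>
          (\<lambda>\<eta>. ?d y \<eta>))"
        by (intro continuous_intros continuous_integral_square)
           (auto simp: case_prod_unfold intro!: continuous_intros ck)
      fix y assume y: "y \<in> unit_square"
      have "\<kappa> y - m = \<mu> (\<lambda>w. \<kappa> y - \<kappa> w)"
        unfolding m by (subst integral_diff) (auto intro!: integrable_unit c\<kappa> continuous_intros)
      then have "\<bar>\<kappa> y - m\<bar>\<^sup>2 \<le> \<mu> (\<lambda>w. (\<kappa> y - \<kappa> w)\<^sup>2)"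
        by (simp only: power2_abs) (intro cell_mean_le continuous_intros c\<kappa>)
      with dbl[OF y] show "\<bar>\<kappa> y - m\<bar>\<^sup>2 \<le> 4 * \<mu>
          (\<lambda>\<eta>. ?d y \<eta>)" by simp
    qed (intro continuous_intros c\<kappa>)
    also have "\<dots> = 4 * \<mu> (\<lambda>y. \<mu>
        (\<lambda>\<eta>. ?d y \<eta>))"
      by (rule integral_mult_right)
    also have "\<dots> = 4 * \<mu> (\<lambda>\<eta>. \<mu>
        (\<lambda>y. ?d y \<eta>))"
      by (subst cell_mean_swap) (auto simp: case_prod_unfold intro!: continuous_intros ck)
    also have "\<dots> \<le> 4 * \<mu> (\<lambda>\<eta>. (2 * B * r powr \<beta> / r)\<^sup>2)"
      by (intro mult_left_mono integral_le integrable_unit inner continuous_integral_square)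
         (auto simp: case_prod_unfold intro!: continuous_intros ck)
    finally show "(\<mu> (\<lambda>y. \<bar>\<kappa> y - m\<bar>))\<^sup>2 \<le> (2 * (2 * B * r powr \<beta> / r))\<^sup>2"
      unfolding power_mult_distrib[of 2] by simp
  qed (use B r in auto)
  finally show ?thesis by (simp add: \<kappa>_def)
qed

text \<open>Shrink the square to \<open>p\<close>: the derivative of the mean over the square of
  side \<open>s * h\<close> with respect to \<open>s\<close> is \<open>h\<close> times first moments
  of the gradient, hence at most \<open>4 * B * h powr \<beta> * s powr (\<beta> - 1)\<close>.
  Integration over \<open>s\<close> produces the factor \<open>1 / \<beta>\<close>.\<close>

lemma box_mean_pointwise_error:
  assumes q: "C1_per q q1 q2" and B: "0 \<le> B" and beta: "0 < \<beta>" "\<beta> \<le> 1"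
    and mod: "\<And>k y. k \<in> {q1, q2} \<Longrightarrow> \<mu> (\<lambda>x. (k (x + y) - k x)\<^sup>2) \<le> (B * norm y powr \<beta>)\<^sup>2"
    and h: "0 < h" "h \<le> 1"
  shows "\<bar>box_mean h q p - q p\<bar> \<le> 4 * B / \<beta> * h powr \<beta>"
proof -
  note cq = continuous_comp[OF C1_per_cont[OF q]] continuous_comp[OF C1_perD(2)[OF q]]
    continuous_comp[OF C1_perD(3)[OF q]]
  define \<psi> where "\<psi> s y = q (p + s *\<^sub>R (h *\<^sub>R y))" for s y
  define \<psi>' where "\<psi>' s y = h * (q1 (p + s *\<^sub>R (h *\<^sub>R y)) * fst y + q2 (p + s *\<^sub>R (h *\<^sub>R y)) * snd y)" for s y
  define \<Phi> where "\<Phi> s = 4 * B / \<beta> * h powr \<beta> * s powr \<beta>" for s :: real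
  have "\<bar>\<mu> (\<psi> 1) - \<mu> (\<psi> 0)\<bar> \<le> \<Phi> 1 - \<Phi> 0"
  proof (rule integral_increment_le)
    show "((\<lambda>t. \<psi> t y) has_real_derivative \<psi>' t y) (at t)" for t y
      unfolding \<psi>_def \<psi>'_def
      by (rule DERIV_cong[OF C1_per_along[OF q]]) (simp add: algebra_simps)
    show "continuous_on UNIV (\<lambda>(t, y). \<psi> t y)" "continuous_on UNIV (\<lambda>(t, y). \<psi>' t y)"
      unfolding \<psi>_def \<psi>'_def case_prod_unfold by (intro continuous_intros cq)+
    show "continuous_on {0..1} \<Phi>" unfolding \<Phi>_def
      using beta by (intro continuous_intros continuous_on_powr') auto
    fix s :: real assume s: "0 < s" "s < 1"
    show "(\<Phi> has_real_derivative 4 * B * h powr \<beta> * (s powr \<beta> / s)) (at s)"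
      unfolding \<Phi>_def using s beta
      by (auto intro!: derivative_eq_intros simp: powr_diff)
    have sh: "0 < s * h" "s * h \<le> 1" using s h by (auto intro: mult_le_one)
    have "\<mu> (\<psi>' s) = h * (\<mu> (\<lambda>y. q1 (p + (s * h) *\<^sub>R y) * fst y) +
        \<mu> (\<lambda>y. q2 (p + (s * h) *\<^sub>R y) * snd y))"
      unfolding \<psi>'_def scaleR_scaleR
      by (subst integral_mult_right, subst cell_mean_linear(1)) (intro continuous_intros cq refl)+
    also have "\<bar>\<dots>\<bar> \<le> h * (2 * B * (s * h) powr \<beta> / (s * h) + 2 * B * (s * h) powr \<beta> / (s * h))"
    proof -
      have "\<bar>\<mu> (\<lambda>y. q1 (p + (s * h) *\<^sub>R y) * fst y)\<bar> \<le> 2 * B * (s * h) powr \<beta> / (s * h)"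
        "\<bar>\<mu> (\<lambda>y. q2 (p + (s * h) *\<^sub>R y) * snd y)\<bar> \<le> 2 * B * (s * h) powr \<beta> / (s * h)"
        using C1_perD(2,3)[OF q] C1_per_periodic[OF q] mod B beta sh cell_mean_coord
        by (auto intro!: moment_le continuous_on_fst continuous_on_snd continuous_on_id simp: mem_unit_square)
      then have "\<bar>\<mu> (\<lambda>y. q1 (p + (s * h) *\<^sub>R y) * fst y) +
          \<mu> (\<lambda>y. q2 (p + (s * h) *\<^sub>R y) * snd y)\<bar> \<le>
          2 * B * (s * h) powr \<beta> / (s * h) + 2 * B * (s * h) powr \<beta> / (s * h)"
        by (rule order_trans[OF abs_triangle_ineq add_mono])
      from mult_left_mono[OF this, of h] h show ?thesis by (simp only: abs_mult abs_of_pos)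
    qed
    also have "\<dots> = 4 * B * h powr \<beta> * (s powr \<beta> / s)"
      using s h by (simp add: powr_mult field_simps)
    finally show "\<bar>\<mu> (\<psi>' s)\<bar> \<le> 4 * B * h powr \<beta> * (s powr \<beta> / s)" .
  qed
  then show ?thesis unfolding \<psi>_def \<Phi>_def box_mean_def by simp
qed

text \<open>Sliding the square of side \<open>h\<close> from \<open>z\<close> to \<open>p\<close>
  keeps it within the square of side \<open>L * h\<close> about \<open>z\<close>, as
  \<open>(L - 1) * h / 2 + h / 2 = L * h / 2\<close>. One factor \<open>L\<close> comes from the
  length of the path, the other from comparing the two squares.\<close>

lemma box_mean_oscillation_le:
  assumes q: "C1_per q q1 q2" and h: "0 < h" and L: "1 \<le> L"
    and p: "\<bar>fst p - fst z\<bar> \<le> (L - 1) * h / 2" "\<bar>snd p - snd z\<bar> \<le> (L - 1) * h / 2"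
  shows "\<bar>box_mean h q p - box_mean h q z\<bar> \<le>
    L\<^sup>2 * h * sqrt (box_mean (L * h) (\<lambda>x. (\<bar>q1 x\<bar> + \<bar>q2 x\<bar>)\<^sup>2) z)"
proof -
  note cq = continuous_comp[OF C1_per_cont[OF q]] continuous_comp[OF C1_perD(2)[OF q]]
    continuous_comp[OF C1_perD(3)[OF q]]
  define H where "H = L * h"
  have H: "0 < H" "0 < L" using h L by (auto simp: H_def)
  define \<eta> where "\<eta> = p - z"
  have eta: "\<bar>fst \<eta>\<bar> \<le> H" "\<bar>snd \<eta>\<bar> \<le> H"
  proof -
    have "(L - 1) * h / 2 \<le> H" using h L by (simp add: H_def algebra_simps)
    then show "\<bar>fst \<eta>\<bar> \<le> H" "\<bar>snd \<eta>\<bar> \<le> H" using p by (auto simp: \<eta>_def)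
  qed
  define w where "w x = \<bar>q1 x\<bar> + \<bar>q2 x\<bar>" for x
  define W where "W = sqrt (box_mean H (\<lambda>x. (w x)\<^sup>2) z)"
  have cw: "continuous_on UNIV w" unfolding w_def by (intro continuous_intros C1_perD(2,3)[OF q])
  define \<psi> where "\<psi> t y = q (z + h *\<^sub>R y + t *\<^sub>R \<eta>)" for t y
  define \<psi>' where "\<psi>' t y = q1 (z + h *\<^sub>R y + t *\<^sub>R \<eta>) * fst \<eta> + q2 (z + h *\<^sub>R y + t *\<^sub>R \<eta>) * snd \<eta>" for t y
  have "\<bar>\<mu> (\<psi> 1) - \<mu> (\<psi> 0)\<bar> \<le> (H * L * W) * 1 - (H * L * W) * 0"
  proof (rule integral_increment_le)
    show "((\<lambda>t. \<psi> t y) has_real_derivative \<psi>' t y) (at t)" for t y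
      unfolding \<psi>_def \<psi>'_def by (rule C1_per_along[OF q])
    show "continuous_on UNIV (\<lambda>(t, y). \<psi> t y)" "continuous_on UNIV (\<lambda>(t, y). \<psi>' t y)"
      unfolding \<psi>_def \<psi>'_def case_prod_unfold by (intro continuous_intros cq)+
    show "continuous_on {0..1} (\<lambda>t. (H * L * W) * t)" by (intro continuous_intros)
    show "((\<lambda>t. (H * L * W) * t) has_real_derivative H * L * W) (at t)" for t
      by (auto intro!: derivative_eq_intros)
    fix t :: real assume t: "0 < t" "t < 1"
    have "\<bar>\<mu> (\<psi>' t)\<bar> \<le> \<mu> (\<lambda>y. H * w (z + h *\<^sub>R y + t *\<^sub>R \<eta>))"
    proof (rule abs_cell_mean_le)
      show "continuous_on unit_square (\<psi>' t)" unfolding \<psi>'_def by (intro continuous_intros cq)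
      show "continuous_on unit_square (\<lambda>y. H * w (z + h *\<^sub>R y + t *\<^sub>R \<eta>))"
        by (intro continuous_intros continuous_comp[OF cw])
      fix y
      let ?x = "z + h *\<^sub>R y + t *\<^sub>R \<eta>"
      have "\<bar>q1 ?x * fst \<eta>\<bar> \<le> H * \<bar>q1 ?x\<bar>" "\<bar>q2 ?x * snd \<eta>\<bar> \<le> H * \<bar>q2 ?x\<bar>"
        using mult_right_mono[OF eta(1), of "\<bar>q1 ?x\<bar>"] mult_right_mono[OF eta(2), of "\<bar>q2 ?x\<bar>"]
        by (auto simp: abs_mult mult.commute)
      then show "\<bar>\<psi>' t y\<bar> \<le> H * w ?x" unfolding \<psi>'_def w_def distrib_left by linarith
    qed
    also have "\<dots> = H * box_mean (1 / L * H) w (z + H *\<^sub>R ((t / H) *\<^sub>R \<eta>))"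
      unfolding box_mean_def using H by (simp add: H_def algebra_simps)
    also have "\<dots> \<le> H * (L * (1 / L * \<bar>box_mean (1 / L * H) w (z + H *\<^sub>R ((t / H) *\<^sub>R \<eta>))\<bar>))"
      using H by (intro mult_left_mono) auto
    also have "\<dots> \<le> H * (L * W)"
      unfolding W_def
    proof (intro mult_left_mono box_mean_dilate_le cw)
      fix y assume y: "y \<in> unit_square"
      have *: "\<bar>t / H * e + 1 / L * d\<bar> \<le> 1/2" if "\<bar>e\<bar> \<le> (L - 1) * h / 2" "\<bar>d\<bar> \<le> 1/2" for e d
      proof -
        have "t * \<bar>e\<bar> \<le> 1 * ((L - 1) * h / 2)" using that t by (intro mult_mono) auto
        then have "t * \<bar>e\<bar> / H \<le> (L - 1) * h / 2 / H" using H by (intro divide_right_mono) auto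
        also have "\<dots> = (L - 1) / (2 * L)" using h by (simp add: H_def)
        finally have "\<bar>t / H * e\<bar> \<le> (L - 1) / (2 * L)" using t H by (simp add: abs_mult)
        moreover have "\<bar>1 / L * d\<bar> \<le> 1 / (2 * L)" using that(2) H by (simp add: abs_mult field_simps)
        moreover have "(L - 1) / (2 * L) + 1 / (2 * L) = 1/2" using H by (simp add: field_simps)
        ultimately show ?thesis by linarith
      qed
      show "(t / H) *\<^sub>R \<eta> + (1 / L) *\<^sub>R y \<in> unit_square"
        using *[OF p(1), of "fst y"] *[OF p(2), of "snd y"] y unfolding mem_unit_square \<eta>_def by simp
    qed (use H in auto)
    finally show "\<bar>\<mu> (\<psi>' t)\<bar> \<le> H * L * W" by (simp add: mult.assoc)
  qed
  moreover have "\<mu> (\<psi> 1) = box_mean h q p" "\<mu> (\<psi> 0) = box_mean h q z"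
    unfolding \<psi>_def box_mean_def \<eta>_def by (simp_all add: algebra_simps)
  ultimately show ?thesis
    unfolding W_def w_def H_def by (simp add: power2_eq_square mult_ac)
qed

section \<open>Shape functions\<close>

text \<open>\<open>invertible_mat\<close> speaks of some two-sided inverse of unspecified
  dimensions, \<open>mat_inverse\<close> of units in the ring of square matrices; the dimensions are
  recovered from the two products.\<close>

lemma mat_inverse_of_invertible:
  fixes A :: "'a :: field mat"
  assumes A: "A \<in> carrier_mat n n" and inv: "invertible_mat A"
  obtains B where "mat_inverse A = Some B" "B * A = 1\<^sub>m n" "B \<in> carrier_mat n n"
proof -
  obtain C where C: "A * C = 1\<^sub>m n" "C * A = 1\<^sub>m (dim_row C)"
    using inv A unfolding invertible_mat_def inverts_mat_def by auto
  have "dim_col C = n" using arg_cong[OF C(1), of dim_col] by simp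
  moreover have "dim_row C = n" using arg_cong[OF C(2), of dim_col] A by simp
  ultimately have "C \<in> carrier_mat n n" by auto
  then have "A \<in> Units (ring_mat TYPE('a) n n)"
    using A C unfolding Units_def by (auto simp: ring_mat_simps)
  then obtain B where "mat_inverse A = Some B"
    using mat_inverse(1)[OF A, of n] by (cases "mat_inverse A") auto
  with mat_inverse(2)[OF A this] that show thesis by blast
qed

lemma dim_monomials [simp]: "dim_vec (monomials m x) = length (exponents m)"
  by (simp add: monomials_def)

lemma index_monomials:
  "i < length (exponents m) \<Longrightarrow>
    vec_index (monomials m x) i = fst x ^ fst (exponents m ! i) * snd x ^ snd (exponents m ! i)"
  by (simp add: monomials_def vec_of_list_index case_prod_unfold)

lemma mem_exponents: "a + b \<le> m \<Longrightarrow> (a, b) \<in> set (exponents m)"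
  by (auto simp: exponents_def less_Suc_eq_le intro!: bexI[of _ a])

lemma shape_eq_sum:
  assumes B: "mat_inverse (moment_matrix m \<Phi> \<rho> R x) = Some B"
    "B \<in> carrier_mat (length (exponents m)) (length (exponents m))"
  shows "shape m \<Phi> \<rho> R y x = (\<Sum>k<length (exponents m). \<Sum>l<length (exponents m).
    vec_index (monomials m 0) k * (B $$ (k, l) * (vec_index (monomials m (scaled_diff \<rho> x y)) l * weight \<Phi> \<rho> x y)))"
proof -
  have "scalar_prod (monomials m 0) (mult_mat_vec B (monomials m (scaled_diff \<rho> x y))) =
      (\<Sum>k<length (exponents m). vec_index (monomials m 0) k * (\<Sum>l<length (exponents m).
        B $$ (k, l) * vec_index (monomials m (scaled_diff \<rho> x y)) l))"
    unfolding scalar_prod_def using B(2)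
    by (auto simp: scalar_prod_def lessThan_atLeast0 intro!: sum.cong)
  then show ?thesis
    unfolding shape_def B(1) option.sel
    by (simp add: sum_distrib_left sum_distrib_right mult.assoc)
qed

text \<open>Summing over the nodes turns the products of monomials and weights into column
  \<open>i\<close> of the moment matrix. Its inverse maps this column to the unit vector, from which
  the monomials at 0 select entry \<open>i\<close>.\<close>

lemma shape_reproduces_monomials:
  assumes R: "regular_nodes m \<Phi> \<rho> R" and i: "i < length (exponents m)"
  shows "(\<Sum>y\<in>R. shape m \<Phi> \<rho> R y x * vec_index (monomials m (scaled_diff \<rho> x y)) i) = vec_index (monomials m 0) i"
proof -
  let ?N = "length (exponents m)" and ?M = "moment_matrix m \<Phi> \<rho> R x"
  let ?P = "\<lambda>y. vec_index (monomials m (scaled_diff \<rho> x y))"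
  let ?p = "vec_index (monomials m 0)"
  have M: "?M \<in> carrier_mat ?N ?N" by (simp add: moment_matrix_def)
  obtain B where B: "mat_inverse ?M = Some B" "B * ?M = 1\<^sub>m ?N" "B \<in> carrier_mat ?N ?N"
  proof -
    have "invertible_mat ?M" using R unfolding regular_nodes_def by blast
    from mat_inverse_of_invertible[OF M this] that show thesis by blast
  qed
  have "(\<Sum>y\<in>R. shape m \<Phi> \<rho> R y x * ?P y i) =
      (\<Sum>y\<in>R. \<Sum>k<?N. \<Sum>l<?N. ?p k * (B $$ (k, l) * (?P y l * ?P y i * weight \<Phi> \<rho> x y)))"
    unfolding shape_eq_sum[OF B(1,3)] sum_distrib_right by (simp add: mult_ac)
  also have "\<dots> = (\<Sum>k<?N. \<Sum>y\<in>R. \<Sum>l<?N. ?p k * (B $$ (k, l) * (?P y l * ?P y i * weight \<Phi> \<rho> x y)))"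
    by (rule sum.swap)
  also have "\<dots> = (\<Sum>k<?N. \<Sum>l<?N. \<Sum>y\<in>R. ?p k * (B $$ (k, l) * (?P y l * ?P y i * weight \<Phi> \<rho> x y)))"
    by (intro sum.cong refl sum.swap)
  also have "\<dots> = (\<Sum>k<?N. ?p k * (\<Sum>l<?N. B $$ (k, l) * ?M $$ (l, i)))"
    using i by (simp add: sum_distrib_left moment_matrix_def)
  also have "\<dots> = (\<Sum>k<?N. if k = i then ?p k else 0)"
  proof (intro sum.cong refl)
    fix k assume k: "k \<in> {..<?N}"
    have "(\<Sum>l<?N. B $$ (k, l) * ?M $$ (l, i)) = (B * ?M) $$ (k, i)"
      using k i B(3) M by (auto simp: scalar_prod_def lessThan_atLeast0 intro!: sum.cong)
    then show "?p k * (\<Sum>l<?N. B $$ (k, l) * ?M $$ (l, i)) = (if k = i then ?p k else 0)"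
      unfolding B(2) using k i by simp
  qed
  also have "\<dots> = ?p i" using i by simp
  finally show ?thesis .
qed

text \<open>Since \<open>0 ^ 0 = 1\<close>, this says that the shape functions form a partition of
  unity and that their other moments up to order \<open>m\<close> vanish.\<close>

lemma shape_moments:
  assumes R: "regular_nodes m \<Phi> \<rho> R" and ab: "a + b \<le> m"
  shows "(\<Sum>y\<in>R. shape m \<Phi> \<rho> R y x * (fst (scaled_diff \<rho> x y) ^ a * snd (scaled_diff \<rho> x y) ^ b)) = 0 ^ a * 0 ^ b"
proof -
  obtain i where i: "i < length (exponents m)" "exponents m ! i = (a, b)"
    using mem_exponents[OF ab] by (auto simp: in_set_conv_nth)
  show ?thesis using shape_reproduces_monomials[OF R i(1), of x] i by (simp add: index_monomials)
qed

section \<open>Periodicity and locality of the discrete projection\<close>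

lemma wrap_eq: "wrap t = t - of_int \<lfloor>t + 1/2\<rfloor>"
  by (simp add: wrap_def frac_def)

lemma wrap_add_1: "wrap (t + 1) = wrap t"
proof -
  have "\<lfloor>t + 1 + 1/2\<rfloor> = \<lfloor>t + 1/2\<rfloor> + 1"
    by (rule floor_unique; unfold of_int_add of_int_1) (use floor_correct[of "t + 1/2"] in linarith)+
  then show ?thesis unfolding wrap_eq by simp
qed

lemma scaled_diff_periodic:
  "scaled_diff \<rho> (x + e1) y = scaled_diff \<rho> x y" "scaled_diff \<rho> (x + e2) y = scaled_diff \<rho> x y"
  using wrap_add_1[of "fst x - fst y"] wrap_add_1[of "snd x - snd y"]
  by (simp_all add: scaled_diff_def algebra_simps)

lemma periodic_combination: "periodic (combination m \<Phi> \<rho> R c)"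
  unfolding periodic_def combination_def shape_def moment_matrix_def weight_def
  by (simp add: scaled_diff_periodic)

lemma window_function_radius:
  assumes "window_function \<Phi>"
  obtains r where "0 < r" "\<And>x. \<Phi> x \<noteq> 0 \<Longrightarrow> \<bar>fst x\<bar> \<le> r \<and> \<bar>snd x\<bar> \<le> r"
proof -
  have "bounded {x. \<Phi> x \<noteq> 0}"
    using assms unfolding window_function_def
    by (meson bounded_subset closure_subset compact_imp_bounded)
  then obtain r where r: "0 < r" "\<And>x. \<Phi> x \<noteq> 0 \<Longrightarrow> norm x \<le> r"
    unfolding bounded_pos by auto
  have "\<bar>fst x\<bar> \<le> norm x" "\<bar>snd x\<bar> \<le> norm x" for x :: point
    using norm_fst_le[of "fst x" "snd x"] norm_snd_le[of "snd x" "fst x"] by simp_all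
  with r that show thesis by (meson order_trans)
qed

text \<open>The projection reproduces affine functions and sees only nodes within
  \<open>r * \<rho>\<close> of \<open>z\<close>, so it magnifies the local approximation error by at
  most the Lebesgue bound.\<close>

lemma projection_affine_error:
  assumes R: "regular_nodes m \<Phi> \<rho> R" and m: "1 \<le> m" and rho: "0 < \<rho>" and g: "periodic g"
    and rad: "\<And>x. \<Phi> x \<noteq> 0 \<Longrightarrow> \<bar>fst x\<bar> \<le> r \<and> \<bar>snd x\<bar> \<le> r"
    and K: "(\<Sum>y\<in>R. \<bar>shape m \<Phi> \<rho> R y z\<bar>) \<le> K"
    and err: "\<And>p. \<lbrakk>\<bar>fst p - fst z\<bar> \<le> r * \<rho>; \<bar>snd p - snd z\<bar> \<le> r * \<rho>\<rbrakk> \<Longrightarrow>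
      \<bar>g p - (c0 + c1 * fst p + c2 * snd p)\<bar> \<le> \<epsilon>" and eps: "0 \<le> \<epsilon>"
  shows "\<bar>projection m \<Phi> \<rho> R g z - (c0 + c1 * fst z + c2 * snd z)\<bar> \<le> K * \<epsilon>"
proof -
  let ?s = "\<lambda>y. shape m \<Phi> \<rho> R y z"
  let ?d = "\<lambda>y. scaled_diff \<rho> z y"
  define A where "A p = c0 + c1 * fst p + c2 * snd p" for p :: point
  \<comment> \<open>The periodic copy of the node \<open>y\<close> selected by
    \<open>scaled_diff\<close>. An affine function is not periodic in general, so it must be
    evaluated at this copy, whereas \<open>g\<close> has the same value at both.\<close>
  define p where "p y = z - \<rho> *\<^sub>R ?d y" for y
  have gp: "g (p y) = g y" for y
  proof -
    have "p y = y + (of_int \<lfloor>fst z - fst y + 1/2\<rfloor>, of_int \<lfloor>snd z - snd y + 1/2\<rfloor>)"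
      using rho by (simp add: p_def scaled_diff_def wrap_eq prod_eq_iff)
    then show ?thesis using periodic_shift_int[OF g] by simp
  qed
  have "(\<Sum>y\<in>R. ?s y * A (p y)) = A z"
  proof -
    have "(\<Sum>y\<in>R. ?s y * A (p y)) = (\<Sum>y\<in>R. A z * ?s y - \<rho> * c1 * (?s y * fst (?d y)) - \<rho> * c2 * (?s y * snd (?d y)))"
      by (intro sum.cong refl) (simp add: A_def p_def algebra_simps)
    also have "\<dots> = A z * (\<Sum>y\<in>R. ?s y) - \<rho> * c1 * (\<Sum>y\<in>R. ?s y * fst (?d y)) - \<rho> * c2 * (\<Sum>y\<in>R. ?s y * snd (?d y))"
      by (simp add: sum_subtractf sum_distrib_left)
    also have "\<dots> = A z"
      using shape_moments[OF R, of 0 0 z] shape_moments[OF R, of 1 0 z] shape_moments[OF R, of 0 1 z] m by simp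
    finally show ?thesis .
  qed
  then have "projection m \<Phi> \<rho> R g z - A z = (\<Sum>y\<in>R. ?s y * (g (p y) - A (p y)))"
    unfolding combination_def gp by (simp add: algebra_simps sum_subtractf)
  also have "\<bar>\<dots>\<bar> \<le> (\<Sum>y\<in>R. \<bar>?s y\<bar> * \<epsilon>)"
  proof (rule order_trans[OF sum_abs], rule sum_mono)
    fix y
    show "\<bar>?s y * (g (p y) - A (p y))\<bar> \<le> \<bar>?s y\<bar> * \<epsilon>"
    proof (cases "?s y = 0")
      case False
      then have "\<Phi> (?d y) \<noteq> 0" by (auto simp: shape_def weight_def)
      from rad[OF this] have "\<bar>fst (p y) - fst z\<bar> \<le> r * \<rho>" "\<bar>snd (p y) - snd z\<bar> \<le> r * \<rho>"
        using rho by (auto simp: p_def abs_mult mult.commute)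
      from err[OF this] show ?thesis unfolding A_def abs_mult by (intro mult_left_mono) auto
    qed simp
  qed
  also have "\<dots> \<le> K * \<epsilon>"
    using K eps by (simp add: mult_right_mono flip: sum_distrib_right)
  finally show ?thesis unfolding A_def .
qed

section \<open>Projection errors\<close>

text \<open>The cell is half-open and the offset is less than \<open>h\<close>, so each shifted
  lattice has exactly the indices from 0 to \<open>n - 1\<close> in it.\<close>

lemma gridpt_in_cell_iff:
  assumes n: "0 < n" and h: "h = 1 / real n" and x: "0 \<le> fst x" "fst x < h" "0 \<le> snd x" "snd x < h"
  shows "gridpt h k j + x \<in> cell \<longleftrightarrow> 0 \<le> k \<and> k < int n \<and> 0 \<le> j \<and> j < int n"
proof -
  have *: "0 \<le> of_int k * h + t \<and> of_int k * h + t < 1 \<longleftrightarrow> 0 \<le> k \<and> k < int n"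
    if t: "0 \<le> t" "t < h" for k t
  proof -
    have hp: "0 < h" and nh: "real n * h = 1" using n h by auto
    have "0 \<le> k" if "0 \<le> of_int k * h + t"
    proof (rule ccontr)
      assume "\<not> 0 \<le> k"
      then have "real_of_int k * h \<le> (-1) * h" using hp by (intro mult_right_mono) auto
      with that t show False by linarith
    qed
    moreover have "k < int n" if "of_int k * h + t < 1"
    proof (rule ccontr)
      assume "\<not> k < int n"
      then have "real n * h \<le> real_of_int k * h" using hp by (intro mult_right_mono) auto
      with that t nh show False by linarith
    qed
    moreover have "0 \<le> of_int k * h + t" if "0 \<le> k" using that hp t by simp
    moreover have "of_int k * h + t < 1" if "k < int n"
    proof -
      have "real_of_int (k + 1) \<le> real_of_int (int n)" using that by linarith
      then have "real_of_int (k + 1) * h \<le> real n * h" using hp by (intro mult_right_mono) auto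
      with nh t show ?thesis by (simp add: algebra_simps)
    qed
    ultimately show ?thesis by blast
  qed
  show ?thesis
    using *[OF x(1,2), of k] *[OF x(3,4), of j] unfolding cell_def gridpt_def mem_Times_iff
    by (simp add: plus_prod_def)
qed

lemma sum_lattice:
  assumes n: "0 < n" and h: "h = 1 / real n" and x: "0 \<le> fst x" "fst x < h" "0 \<le> snd x" "snd x < h"
  shows "(\<Sum>y\<in>(\<lambda>y. y + x) ` lattice_T h \<inter> cell. f y) = grid_sum n (\<lambda>k j. f (gridpt h k j + x))"
proof -
  let ?g = "\<lambda>(i, j). gridpt h (int i) (int j) + x"
  have hp: "h \<noteq> 0" using n h by simp
  have "(\<lambda>y. y + x) ` lattice_T h \<inter> cell = ?g ` ({..<n} \<times> {..<n})"
  proof (intro equalityI subsetI)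
    fix y assume "y \<in> (\<lambda>y. y + x) ` lattice_T h \<inter> cell"
    then obtain k j where y: "y = gridpt h k j + x" "y \<in> cell"
      unfolding lattice_T_def gridpt_def by auto
    then have "0 \<le> k" "k < int n" "0 \<le> j" "j < int n" using gridpt_in_cell_iff[OF n h x] by auto
    then show "y \<in> ?g ` ({..<n} \<times> {..<n})"
      unfolding y by (intro image_eqI[of _ _ "(nat k, nat j)"]) auto
  next
    fix y assume "y \<in> ?g ` ({..<n} \<times> {..<n})"
    then obtain i j where "i < n" "j < n" "y = gridpt h (int i) (int j) + x" by auto
    moreover have "gridpt h (int i) (int j) \<in> lattice_T h"
      unfolding lattice_T_def gridpt_def by blast
    ultimately show "y \<in> (\<lambda>y. y + x) ` lattice_T h \<inter> cell"
      using gridpt_in_cell_iff[OF n h x, of "int i" "int j"] by simp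
  qed
  moreover have "inj_on ?g ({..<n} \<times> {..<n})"
    using hp by (auto simp: inj_on_def gridpt_def)
  ultimately show ?thesis
    by (simp add: sum.reindex sum.cartesian_product grid_sum_def case_prod_unfold)
qed

text \<open>Monotonicity with the index range kept, because the Lebesgue bound is known only for
  lattice points in the cell.\<close>

lemma grid_sum_mono_grid:
  "(\<And>k j. \<lbrakk>0 \<le> k; k < int n; 0 \<le> j; j < int n\<rbrakk> \<Longrightarrow> a k j \<le> b k j) \<Longrightarrow> grid_sum n a \<le> grid_sum n b"
  unfolding grid_sum_def by (intro sum_mono) auto

lemma line_mean_affine:
  fixes c0 c1 c2 :: real
  defines "A \<equiv> \<lambda>p. c0 + c1 * fst p + c2 * snd p"
  shows "line_mean h d A = A"
proof
  fix x
  have "line_mean h d A x = \<mu>\<^sub>1 (\<lambda>t. A x + (h * (c1 * fst d + c2 * snd d)) * t)"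
    unfolding line_mean_def A_def by (intro integral_cong) (simp add: algebra_simps)
  also have "\<dots> = A x + (h * (c1 * fst d + c2 * snd d)) * \<mu>\<^sub>1 (\<lambda>t. t)"
    by (subst integral_add) (auto intro!: integrable_unit continuous_intros)
  finally show "line_mean h d A x = A x" by (simp add: integral_unit_interval_ident)
qed

lemma box_mean_affine:
  fixes c0 c1 c2 :: real
  defines "A \<equiv> \<lambda>p. c0 + c1 * fst p + c2 * snd p"
  shows "box_mean h A = A"
proof -
  have "continuous_on UNIV A" unfolding A_def by (intro continuous_intros)
  from box_mean_eq(1)[OF this] show ?thesis
    unfolding A_def by (simp add: line_mean_affine fun_eq_iff)
qed

text \<open>Both means reproduce affine functions and average the rest. The square and the segment
  each reach \<open>h / 2\<close>, so their combined reach \<open>h\<close> must not exceed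
  \<open>H / 2\<close>.\<close>

lemma double_mean_affine_error:
  assumes g: "continuous_on UNIV g" and h: "0 < h" "2 * h \<le> H" and d: "d = e1 \<or> d = e2"
    and err: "\<And>p. \<lbrakk>\<bar>fst p - fst z\<bar> \<le> H / 2; \<bar>snd p - snd z\<bar> \<le> H / 2\<rbrakk> \<Longrightarrow>
      \<bar>g p - (c0 + c1 * fst p + c2 * snd p)\<bar> \<le> \<epsilon>"
  shows "\<bar>box_mean h (line_mean h d g) z - (c0 + c1 * fst z + c2 * snd z)\<bar> \<le> \<epsilon>"
proof -
  define A where "A p = c0 + c1 * fst p + c2 * snd p" for p :: point
  have A: "A = (\<lambda>p. c0 + c1 * fst p + c2 * snd p)" by (simp add: A_def fun_eq_iff)
  have cA: "continuous_on UNIV A" unfolding A by (intro continuous_intros)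
  define r where "r x = g x - A x" for x
  have cr: "continuous_on UNIV r" unfolding r_def by (intro continuous_intros g cA)
  have "box_mean h (line_mean h d r) z = box_mean h (line_mean h d g) z - A z"
    unfolding r_def line_mean_diff[OF g cA]
    by (simp add: box_mean_linear(2) continuous_line_mean g cA) (simp add: A line_mean_affine box_mean_affine)
  moreover have "\<bar>box_mean h (line_mean h d r) z\<bar> \<le> \<mu> (\<lambda>y. \<epsilon>)"
    unfolding box_mean_def
  proof (rule abs_cell_mean_le)
    show "continuous_on unit_square (\<lambda>y. line_mean h d r (z + h *\<^sub>R y))"
      by (intro continuous_comp[OF continuous_line_mean[OF cr]] continuous_intros)
    fix y assume y: "y \<in> unit_square"
    have "norm (line_mean h d r (z + h *\<^sub>R y)) \<le> \<mu>\<^sub>1 (\<lambda>t. \<epsilon>)"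
      unfolding line_mean_def
    proof (rule integral_norm_bound_integral)
      fix t assume t: "t \<in> unit_interval"
      have b: "\<bar>h * c\<bar> \<le> h / 2" if "\<bar>c\<bar> \<le> 1/2" for c
        using mult_left_mono[OF that, of h] h by (simp add: abs_mult)
      have t': "\<bar>h * t\<bar> \<le> h / 2" using b[of t] t by (simp add: mem_unit_interval)
      have y': "\<bar>h * fst y\<bar> \<le> h / 2" "\<bar>h * snd y\<bar> \<le> h / 2" using b y by (auto simp: mem_unit_square)
      have "\<bar>fst (z + h *\<^sub>R y + (t * h) *\<^sub>R d) - fst z\<bar> \<le> H / 2" "\<bar>snd (z + h *\<^sub>R y + (t * h) *\<^sub>R d) - snd z\<bar> \<le> H / 2"
      proof -
        have "\<bar>a + b\<bar> \<le> H / 2" if "\<bar>a\<bar> \<le> h / 2" "\<bar>b\<bar> \<le> h / 2" for a b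
          using that h by linarith
        from this[OF y'(1) t'] this[OF y'(2) t'] d y' h
        show "\<bar>fst (z + h *\<^sub>R y + (t * h) *\<^sub>R d) - fst z\<bar> \<le> H / 2" "\<bar>snd (z + h *\<^sub>R y + (t * h) *\<^sub>R d) - snd z\<bar> \<le> H / 2"
          by (auto simp: mult.commute[of t])
      qed
      from err[OF this] show "norm (r (z + h *\<^sub>R y + (t * h) *\<^sub>R d)) \<le> \<epsilon>" by (simp add: r_def A_def)
    qed (auto intro!: integrable_unit continuous_comp[OF cr] continuous_intros)
    then show "\<bar>line_mean h d r (z + h *\<^sub>R y)\<bar> \<le> \<epsilon>" by simp
  qed (intro continuous_intros)
  ultimately show ?thesis by (simp add: A_def)
qed

lemma integral_square_sum_abs_le:
  fixes k1 k2 k3 k4 :: "point \<Rightarrow> real"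
  assumes c: "continuous_on UNIV k1" "continuous_on UNIV k2" "continuous_on UNIV k3" "continuous_on UNIV k4"
    and B: "\<And>k. k \<in> {k1, k2, k3, k4} \<Longrightarrow> \<nu> k \<le> B"
  shows "\<mu> (\<lambda>x. (\<bar>k1 x\<bar> + \<bar>k2 x\<bar> + \<bar>k3 x\<bar> + \<bar>k4 x\<bar>)\<^sup>2) \<le> 16 * B"
proof -
  have cS: "continuous_on S k" if "k \<in> {k1, k2, k3, k4}" for k S
    using that c continuous_on_subset[of UNIV _ S] by auto
  have four: "(s + t + u + v)\<^sup>2 \<le> 4 * (s\<^sup>2 + t\<^sup>2 + (u\<^sup>2 + v\<^sup>2))" for s t u v :: real
  proof -
    have "0 \<le> (s - t)\<^sup>2 + (s - u)\<^sup>2 + (s - v)\<^sup>2 + (t - u)\<^sup>2 + (t - v)\<^sup>2 + (u - v)\<^sup>2" by simp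
    then show ?thesis by (simp add: power2_eq_square algebra_simps)
  qed
  have "\<mu> (\<lambda>x. (\<bar>k1 x\<bar> + \<bar>k2 x\<bar> + \<bar>k3 x\<bar> + \<bar>k4 x\<bar>)\<^sup>2) \<le>
      \<mu> (\<lambda>x. 4 * ((k1 x)\<^sup>2 + (k2 x)\<^sup>2 + ((k3 x)\<^sup>2 + (k4 x)\<^sup>2)))"
  proof (intro integral_le integrable_unit)
    show "(\<bar>k1 x\<bar> + \<bar>k2 x\<bar> + \<bar>k3 x\<bar> + \<bar>k4 x\<bar>)\<^sup>2 \<le> 4 * ((k1 x)\<^sup>2 + (k2 x)\<^sup>2 + ((k3 x)\<^sup>2 + (k4 x)\<^sup>2))" for x
      using four[of "\<bar>k1 x\<bar>" "\<bar>k2 x\<bar>" "\<bar>k3 x\<bar>" "\<bar>k4 x\<bar>"] by simp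
  qed (intro continuous_intros cS; simp)+
  also have "\<dots> = 4 * (\<nu> k1 + \<nu> k2
      + (\<nu> k3 + \<nu> k4))"
    using c by (simp add: cell_mean_linear(1) continuous_on_add continuous_on_mult_left continuous_on_power)
  also have "\<dots> \<le> 16 * B" using B[of k1] B[of k2] B[of k3] B[of k4] by simp
  finally show ?thesis .
qed

lemma grid_sum_shift:
  assumes "grid_periodic n a"
  shows "grid_sum n (\<lambda>k j. a (k + 1) j) = grid_sum n a" "grid_sum n (\<lambda>k j. a k (j + 1)) = grid_sum n a"
  using grid_sum_telescope[OF assms] unfolding grid_linear by simp_all

text \<open>\<open>N\<close> will be the distance between average and projection, small enough that
  its undivided differences can be bounded by its values; the loss of \<open>1 / h\<close> in the
  quotients is affordable.\<close>

lemma grid_difference_square_le: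
  assumes X: "grid_periodic n X" and N: "grid_periodic n N"
  shows "grid_sum n (\<lambda>k j. ((X (k + 1) j + N (k + 1) j) - (X k j + N k j))\<^sup>2
        + ((X k (j + 1) + N k (j + 1)) - (X k j + N k j))\<^sup>2)
    \<le> 2 * grid_sum n (\<lambda>k j. grid_grad X k j)
      + 16 * grid_sq n N"
proof -
  have *: "((x' + y') - (x + y))\<^sup>2 \<le> 2 * (x' - x)\<^sup>2 + 4 * y'\<^sup>2 + 4 * y\<^sup>2" for x x' y y' :: real
    using zero_le_power2[of "(x' - x) - (y' - y)"] zero_le_power2[of "y' + y"]
    by (simp add: power2_eq_square algebra_simps)
  have pN: "grid_periodic n (\<lambda>k j. (N k j)\<^sup>2)" using N by (simp add: grid_periodic_def)
  have "grid_sum n (\<lambda>k j. ((X (k + 1) j + N (k + 1) j) - (X k j + N k j))\<^sup>2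
        + ((X k (j + 1) + N k (j + 1)) - (X k j + N k j))\<^sup>2) \<le>
      grid_sum n (\<lambda>k j. (2 * (X (k + 1) j - X k j)\<^sup>2 + 4 * (N (k + 1) j)\<^sup>2 + 4 * (N k j)\<^sup>2)
        + (2 * (X k (j + 1) - X k j)\<^sup>2 + 4 * (N k (j + 1))\<^sup>2 + 4 * (N k j)\<^sup>2))"
    by (intro grid_sum_mono add_mono *)
  also have "\<dots> = 2 * grid_sum n (\<lambda>k j. grid_grad X k j)
      + 16 * grid_sq n N"
    unfolding grid_linear grid_sum_shift[OF pN] by simp
  finally show ?thesis .
qed

text \<open>\<open>L * h\<close> is the side of a square about a lattice point that contains all
  nodes acting there, with a margin of \<open>h / 2\<close> for a further square mean.
  \<open>L\<close> is a natural number, so means over such overlapping squares sum exactly.\<close>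

locale node_projection = periodic_Stokes +
  fixes n m :: nat and \<Phi> :: "point \<Rightarrow> real" and h \<rho> K r C0 :: real and R :: "point set" and L :: nat
  assumes n: "0 < n" and hn: "h = 1 / real n" and m: "1 \<le> m"
    and rho: "0 < \<rho>" "\<rho> < C0 * h" and R: "regular_nodes m \<Phi> \<rho> R"
    and leb: "lebesgue_bound m \<Phi> \<rho> R ((lattice_S1 h \<union> lattice_S2 h \<union> lattice_T h) \<inter> cell) K"
    and r: "0 < r" "\<And>x. \<Phi> x \<noteq> 0 \<Longrightarrow> \<bar>fst x\<bar> \<le> r \<and> \<bar>snd x\<bar> \<le> r"
    and L: "3 \<le> L" "2 * r * C0 + 1 \<le> real L" and K0: "0 \<le> K"

abbreviation (in node_projection) "\<Gamma> \<equiv> projection m \<Phi> \<rho> R"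

lemma (in node_projection) h_pos: "0 < h" "h \<le> 1" "real n * h = 1"
  using n hn by auto

lemma (in node_projection) radius: "r * \<rho> \<le> (real L - 1) * h / 2"
proof -
  have "r * \<rho> \<le> r * (C0 * h)" using rho r by (intro mult_left_mono) auto
  also have "\<dots> \<le> (real L - 1) * h / 2"
    using mult_right_mono[OF L(2), of h] h_pos by (simp add: algebra_simps)
  finally show ?thesis .
qed

lemma (in node_projection) lebesgue:
  assumes "x0 \<in> {0, (h/2) *\<^sub>R e1, (h/2) *\<^sub>R e2}" and "0 \<le> k" "k < int n" "0 \<le> j" "j < int n"
  shows "(\<Sum>y\<in>R. \<bar>shape m \<Phi> \<rho> R y (gridpt h k j + x0)\<bar>) \<le> K"
proof -
  have "gridpt h k j + x0 \<in> cell"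
    using gridpt_in_cell_iff[OF n hn, of x0 k j] assms h_pos by auto
  moreover have "gridpt h k j \<in> lattice_T h"
    unfolding lattice_T_def gridpt_def by blast
  then have "gridpt h k j + x0 \<in> lattice_S1 h \<union> lattice_S2 h \<union> lattice_T h"
    using assms(1) unfolding lattice_S1_def lattice_S2_def by auto
  ultimately show ?thesis using leb unfolding lebesgue_bound_def by blast
qed

text \<open>Average and projection are compared with the same affine function, the averaged Taylor
  polynomial on the square of side \<open>L * h\<close>; the projection contributes the factor
  \<open>K\<close>. The constant 32 is 16 from adding four second derivatives times 2 from
  \<open>L2_bound\<close>.\<close>

lemma (in node_projection) velocity_projection_error:
  assumes g: "C2_per g g1 g2 g11 g12 g21 g22"
    and B: "\<And>k. k \<in> {g11, g12, g21, g22} \<Longrightarrow> \<nu> k \<le> 2 * F\<^sup>2"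
    and d: "d = e1 \<or> d = e2" and x0: "x0 \<in> {0, (h/2) *\<^sub>R e1, (h/2) *\<^sub>R e2}"
  shows "grid_sum n (\<lambda>k j. (box_mean h (line_mean h d g) (gridpt h k j + x0)
      - \<Gamma> g (gridpt h k j + x0))\<^sup>2) \<le> 32 * ((1 + K) * (real L)\<^sup>2)\<^sup>2 * F\<^sup>2 * h\<^sup>2"
proof -
  have C: "C1_per g g1 g2" "C1_per g1 g11 g12" "C1_per g2 g21 g22" using g by (auto simp: C2_per_def)
  define H where "H = real L * h"
  have H: "0 < H" "2 * h \<le> H" using h_pos L by (auto simp: H_def)
  define w where "w x = (\<bar>g11 x\<bar> + \<bar>g12 x\<bar> + \<bar>g21 x\<bar> + \<bar>g22 x\<bar>)\<^sup>2" for x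
  have cw: "continuous_on UNIV w" unfolding w_def
    by (intro continuous_intros C1_perD(2,3)[OF C(2)] C1_perD(2,3)[OF C(3)])
  have pw: "periodic w" unfolding w_def
    using C1_per_periodic[OF C(2)] C1_per_periodic[OF C(3)] by (simp add: periodic_def)
  have w0: "0 \<le> box_mean H w z" for z
    using box_mean_nonneg[OF cw] by (simp add: w_def)
  have pt: "(box_mean h (line_mean h d g) z - \<Gamma> g z)\<^sup>2 \<le> ((1 + K) * H\<^sup>2)\<^sup>2 * box_mean H w z"
    if z: "(\<Sum>y\<in>R. \<bar>shape m \<Phi> \<rho> R y z\<bar>) \<le> K" for z
  proof -
    define \<epsilon> where "\<epsilon> = H\<^sup>2 * sqrt (box_mean H w z)"
    have eps: "0 \<le> \<epsilon>" using w0 by (simp add: \<epsilon>_def)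
    obtain c0 c1 c2 where c: "\<And>p. \<lbrakk>\<bar>fst p - fst z\<bar> \<le> H / 2; \<bar>snd p - snd z\<bar> \<le> H / 2\<rbrakk> \<Longrightarrow>
        \<bar>g p - (c0 + c1 * fst p + c2 * snd p)\<bar> \<le> \<epsilon>"
      using averaged_Taylor[OF g H(1), of z] unfolding \<epsilon>_def w_def by blast
    have rH: "r * \<rho> \<le> H / 2" using radius h_pos by (simp add: H_def algebra_simps)
    have "\<bar>\<Gamma> g z - (c0 + c1 * fst z + c2 * snd z)\<bar> \<le> K * \<epsilon>"
      by (rule projection_affine_error[OF R m rho(1) C1_perD(1)[OF C(1)] r(2) z _ eps]) (use c rH in force)+
    moreover have "\<bar>box_mean h (line_mean h d g) z - (c0 + c1 * fst z + c2 * snd z)\<bar> \<le> \<epsilon>"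
      by (rule double_mean_affine_error[OF C1_per_cont[OF C(1)] h_pos(1) H(2) d c])
    ultimately have "\<bar>box_mean h (line_mean h d g) z - \<Gamma> g z\<bar> \<le> (1 + K) * \<epsilon>"
      unfolding distrib_right by linarith
    then have "(box_mean h (line_mean h d g) z - \<Gamma> g z)\<^sup>2 \<le> ((1 + K) * \<epsilon>)\<^sup>2"
      by (metis abs_ge_zero power2_abs power_mono)
    also have "\<dots> = ((1 + K) * H\<^sup>2)\<^sup>2 * box_mean H w z"
      using w0 by (simp add: \<epsilon>_def power_mult_distrib)
    finally show ?thesis .
  qed
  have "grid_sum n (\<lambda>k j. (box_mean h (line_mean h d g) (gridpt h k j + x0)
      - \<Gamma> g (gridpt h k j + x0))\<^sup>2) \<le>
      grid_sum n (\<lambda>k j. ((1 + K) * H\<^sup>2)\<^sup>2 * box_mean H w (gridpt h k j + x0))"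
    by (intro grid_sum_mono_grid pt lebesgue x0)
  also have "\<dots> = ((1 + K) * H\<^sup>2)\<^sup>2 * ((real n)\<^sup>2 * \<mu> w)"
    unfolding grid_linear(3) H_def hn
    using grid_sum_box_mean[OF cw pw n, of L x0] L by simp
  also have "\<dots> \<le> ((1 + K) * H\<^sup>2)\<^sup>2 * ((real n)\<^sup>2 * (16 * (2 * F\<^sup>2)))"
    unfolding w_def
    by (intro mult_left_mono integral_square_sum_abs_le B C1_perD(2,3)[OF C(2)] C1_perD(2,3)[OF C(3)]) auto
  also have "\<dots> = 32 * ((1 + K) * (real L)\<^sup>2)\<^sup>2 * F\<^sup>2 * h\<^sup>2 * (real n * h)\<^sup>2"
    unfolding H_def by (simp add: power_mult_distrib power2_eq_square mult_ac)
  finally show ?thesis using h_pos by simp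
qed

text \<open>Here the comparison function is the constant \<open>box_mean h q z\<close> itself. A
  node value differs from it by the passage from the point value to the mean about the node, which
  uses the modulus of the gradient, and by sliding that mean to \<open>z\<close>, which uses its L2
  norm.\<close>

lemma (in node_projection) pressure_projection_error:
  "grid_sum n (\<lambda>k j. (box_mean h q (gridpt h k j) - \<Gamma> q (gridpt h k j))\<^sup>2)
    \<le> K\<^sup>2 * (64 / \<beta>\<^sup>2 * (real n)\<^sup>2 * F\<^sup>2 * (h powr \<beta>)\<^sup>2 + 64 * (real L)^4 * F\<^sup>2)"
proof -
  define B where "B = sqrt 2 * F"
  have B0: "0 \<le> B" using F_nonneg by (simp add: B_def)
  have mod: "\<mu> (\<lambda>x. (k (x + y) - k x)\<^sup>2) \<le> (B * norm y powr \<beta>)\<^sup>2" if "k \<in> {q1, q2}" for k y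
    using L2_modulus[of k y] that by (auto simp: B_def power_mult_distrib)
  define D where "D = 4 * B / \<beta> * h powr \<beta>"
  define H where "H = real L * h"
  define w where "w x = (\<bar>q1 x\<bar> + \<bar>q2 x\<bar>)\<^sup>2" for x
  have cw: "continuous_on UNIV w" unfolding w_def by (intro continuous_intros continuous_derivs)
  have pw: "periodic w" unfolding w_def using periodic_derivs(12,13) by (simp add: periodic_def)
  have w0: "0 \<le> box_mean H w z" for z
    using box_mean_nonneg[OF cw] by (simp add: w_def)
  have D0: "0 \<le> D" using B0 beta by (simp add: D_def)
  have D2: "D\<^sup>2 = 32 / \<beta>\<^sup>2 * F\<^sup>2 * (h powr \<beta>)\<^sup>2"
    by (simp add: D_def B_def power_mult_distrib power_divide)
  have iw: "\<mu> w \<le> 16 * (2 * F\<^sup>2)"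
  proof -
    have "\<nu> k \<le> 2 * F\<^sup>2" if "k \<in> {q1, q2, \<lambda>_. 0, \<lambda>_. 0}" for k
      using that L2_bound[of q1] L2_bound[of q2] by auto
    from integral_square_sum_abs_le[of q1 q2 "\<lambda>_. 0" "\<lambda>_. 0", OF continuous_derivs(12,13) continuous_on_const continuous_on_const this]
    show ?thesis unfolding w_def by simp
  qed
  have pt: "(box_mean h q z - \<Gamma> q z)\<^sup>2 \<le> K\<^sup>2 * (2 * D\<^sup>2 + 2 * ((real L)\<^sup>2 * h)\<^sup>2 * box_mean H w z)"
    if z: "(\<Sum>y\<in>R. \<bar>shape m \<Phi> \<rho> R y z\<bar>) \<le> K" for z
  proof -
    define \<epsilon> where "\<epsilon> = D + (real L)\<^sup>2 * h * sqrt (box_mean H w z)"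
    have eps: "0 \<le> \<epsilon>" using w0 D0 h_pos by (simp add: \<epsilon>_def)
    have "\<bar>\<Gamma> q z - (box_mean h q z + 0 * fst z + 0 * snd z)\<bar> \<le> K * \<epsilon>"
    proof (rule projection_affine_error[OF R m rho(1) C1_perD(1)[OF q] r(2) z _ eps])
      fix p assume p: "\<bar>fst p - fst z\<bar> \<le> r * \<rho>" "\<bar>snd p - snd z\<bar> \<le> r * \<rho>"
      have "\<bar>box_mean h q p - q p\<bar> \<le> D"
        unfolding D_def by (rule box_mean_pointwise_error[OF q B0 beta mod h_pos(1,2)])
      moreover have "\<bar>box_mean h q p - box_mean h q z\<bar> \<le> (real L)\<^sup>2 * h * sqrt (box_mean H w z)"
        unfolding H_def w_def using p radius L h_pos
        by (intro box_mean_oscillation_le[OF q]) auto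
      ultimately show "\<bar>q p - (box_mean h q z + 0 * fst p + 0 * snd p)\<bar> \<le> \<epsilon>"
        unfolding \<epsilon>_def by simp
    qed
    then have "\<bar>box_mean h q z - \<Gamma> q z\<bar> \<le> K * \<epsilon>" by simp
    then have "(box_mean h q z - \<Gamma> q z)\<^sup>2 \<le> (K * \<epsilon>)\<^sup>2"
      by (metis abs_ge_zero power2_abs power_mono)
    also have "\<dots> = K\<^sup>2 * \<epsilon>\<^sup>2" by (simp add: power_mult_distrib)
    also have "\<epsilon>\<^sup>2 \<le> 2 * D\<^sup>2 + 2 * ((real L)\<^sup>2 * h)\<^sup>2 * box_mean H w z"
      using square_sum2_le[of D "(real L)\<^sup>2 * h * sqrt (box_mean H w z)"] w0[of z]
      unfolding \<epsilon>_def power_mult_distrib[of _ "sqrt _"] by (simp add: mult.assoc)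
    finally show ?thesis by (simp add: mult_left_mono)
  qed
  have "grid_sum n (\<lambda>k j. (box_mean h q (gridpt h k j) - \<Gamma> q (gridpt h k j))\<^sup>2) \<le>
      grid_sum n (\<lambda>k j. K\<^sup>2 * (2 * D\<^sup>2 + 2 * ((real L)\<^sup>2 * h)\<^sup>2 * box_mean H w (gridpt h k j)))"
    using lebesgue[of 0] by (intro grid_sum_mono_grid pt) simp
  also have "\<dots> = K\<^sup>2 * ((real n)\<^sup>2 * (2 * D\<^sup>2) + 2 * ((real L)\<^sup>2 * h)\<^sup>2 * ((real n)\<^sup>2 * \<mu> w))"
    unfolding grid_linear H_def hn
    using grid_sum_box_mean[OF cw pw n, of L 0] L by simp
  also have "\<dots> \<le> K\<^sup>2 * ((real n)\<^sup>2 * (2 * D\<^sup>2) + 2 * ((real L)\<^sup>2 * h)\<^sup>2 * ((real n)\<^sup>2 * (16 * (2 * F\<^sup>2))))"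
    by (intro mult_left_mono add_left_mono iw) auto
  also have "2 * ((real L)\<^sup>2 * h)\<^sup>2 * ((real n)\<^sup>2 * (16 * (2 * F\<^sup>2))) = 64 * (real L)^4 * F\<^sup>2 * (real n * h)\<^sup>2"
    by (simp add: power_mult_distrib mult_ac flip: power_mult)
  finally show ?thesis unfolding h_pos(3) D2 by (simp add: algebra_simps)
qed

lemma (in node_projection) grid_sum_gradient:
  "(\<Sum>z\<in>(\<lambda>y. y + x0) ` lattice_T h \<inter> cell. \<Sum>e\<in>{e1, e2}. (fwd_diff h e E z)\<^sup>2) =
    (real n)\<^sup>2 * grid_sum n (\<lambda>k j. (E (gridpt h (k + 1) j + x0) - E (gridpt h k j + x0))\<^sup>2
      + (E (gridpt h k (j + 1) + x0) - E (gridpt h k j + x0))\<^sup>2)"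
  if "x0 \<in> {0, (h/2) *\<^sub>R e1, (h/2) *\<^sub>R e2}"
proof -
  have x: "0 \<le> fst x0" "fst x0 < h" "0 \<le> snd x0" "snd x0 < h" using that h_pos by auto
  have c: "t / h = real n * t" for t using h_pos by (simp add: field_simps)
  have s: "gridpt h k j + x0 + h *\<^sub>R e1 = gridpt h (k + 1) j + x0"
    "gridpt h k j + x0 + h *\<^sub>R e2 = gridpt h k (j + 1) + x0" for k j
    unfolding gridpt_step by (simp_all only: add_ac)
  have "(\<Sum>e\<in>{e1, e2}. (fwd_diff h e E (gridpt h k j + x0))\<^sup>2) =
      (real n)\<^sup>2 * ((E (gridpt h (k + 1) j + x0) - E (gridpt h k j + x0))\<^sup>2
      + (E (gridpt h k (j + 1) + x0) - E (gridpt h k j + x0))\<^sup>2)" for k j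
  proof -
    have "(\<Sum>e\<in>{e1, e2}. (fwd_diff h e E (gridpt h k j + x0))\<^sup>2) =
        (fwd_diff h e1 E (gridpt h k j + x0))\<^sup>2 + (fwd_diff h e2 E (gridpt h k j + x0))\<^sup>2" by simp
    then show ?thesis unfolding fwd_diff_def s c by (simp add: power_mult_distrib distrib_left)
  qed
  then show ?thesis unfolding sum_lattice[OF n hn x] grid_linear(3)[symmetric] by simp
qed

text \<open>Discrete unknowns are constrained only on the lattice, where they inherit periodicity
  from the shape functions.\<close>

lemma (in node_projection) grid_periodic_unknown:
  assumes "\<And>y. y \<in> X \<Longrightarrow> g y = combination m \<Phi> \<rho> R c y" and "\<And>k j. gridpt h k j + x0 \<in> X"
  shows "grid_periodic n (\<lambda>k j. g (gridpt h k j + x0))"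
  using grid_periodic_sample[OF periodic_combination n, of m \<Phi> \<rho> R c x0] assms hn by simp

abbreviation (in node_projection) "z1 k j \<equiv> gridpt h k j + (h/2) *\<^sub>R e1"
abbreviation (in node_projection) "z2 k j \<equiv> gridpt h k j + (h/2) *\<^sub>R e2"

lemma (in node_projection) total_error:
  assumes sol: "discrete_stokes_solution m \<Phi> \<rho> R h f u w P"
    and f: "\<And>x. fst (f x) = f1 x" "\<And>x. snd (f x) = f2 x"
  shows "grad_l2 h (\<lambda>z. u z - \<Gamma> a z) (\<lambda>z. w z - \<Gamma> b z)
      + pressure_l2 h (\<lambda>y. P y - \<Gamma> q y)
    \<le> (sqrt (944 + 1024 * ((1 + K) * (real L)\<^sup>2)\<^sup>2) + sqrt (944 + 128 * K\<^sup>2 / \<beta>\<^sup>2 + 128 * K\<^sup>2 * (real L)^4))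
      * F * h powr (\<beta> - 1)"
proof -
  let ?g = "grad_l2 h (\<lambda>z. u z - \<Gamma> a z) (\<lambda>z. w z - \<Gamma> b z)"
  let ?x1 = "(h/2) *\<^sub>R e1" and ?x2 = "(h/2) *\<^sub>R e2"
  have T: "gridpt h k j \<in> lattice_T h" for k j
    unfolding lattice_T_def gridpt_def by blast
  have S1: "z1 k j \<in> lattice_S1 h" for k j
    unfolding lattice_S1_def using T by blast
  have S2: "z2 k j \<in> lattice_S2 h" for k j
    unfolding lattice_S2_def using T by blast
  have sT: "(\<lambda>y. y + 0) ` lattice_T h = lattice_T h" by simp
  have perX: "grid_periodic n (\<lambda>k j. u (z1 k j))"
    "grid_periodic n (\<lambda>k j. w (z2 k j))" "grid_periodic n (\<lambda>k j. P (gridpt h k j))"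
  proof -
    obtain c1 c2 c3 where c: "\<And>y. y \<in> lattice_S1 h \<Longrightarrow> u y = combination m \<Phi> \<rho> R c1 y"
      "\<And>y. y \<in> lattice_S2 h \<Longrightarrow> w y = combination m \<Phi> \<rho> R c2 y"
      "\<And>y. y \<in> lattice_T h \<Longrightarrow> P y = combination m \<Phi> \<rho> R c3 y"
      using sol unfolding discrete_stokes_solution_def discrete_unknown_def by blast
    have "gridpt h k j + 0 \<in> lattice_T h" for k j using T by simp
    from grid_periodic_unknown[OF c(1) S1] grid_periodic_unknown[OF c(2) S2] grid_periodic_unknown[OF c(3) this]
    show "grid_periodic n (\<lambda>k j. u (z1 k j))" "grid_periodic n (\<lambda>k j. w (z2 k j))"
      "grid_periodic n (\<lambda>k j. P (gridpt h k j))" by simp_all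
  qed
  have sumP: "grid_sum n (\<lambda>k j. P (gridpt h k j)) = 0"
    using sol sum_lattice[OF n hn, of 0 P] h_pos unfolding discrete_stokes_solution_def sT by simp
  have eqs: "- five_point h u (z1 k j) + half_diff h e1 P (z1 k j) = f1 (gridpt h k j)"
    "- five_point h w (z2 k j) + half_diff h e2 P (z2 k j) = f2 (gridpt h k j)"
    "half_diff h e1 u (gridpt h k j) + half_diff h e2 w (gridpt h k j) = 0" for k j
    using sol T[of k j] unfolding discrete_stokes_solution_def f by blast+
  define X where "X k j = u (z1 k j) - box_mean h (line_mean h e2 a) (z1 k j)" for k j
  define Y where "Y k j = w (z2 k j) - box_mean h (line_mean h e1 b) (z2 k j)" for k j
  define Z where "Z k j = P (gridpt h k j) - box_mean h q (gridpt h k j)" for k j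
  define NX where "NX k j = box_mean h (line_mean h e2 a) (z1 k j)
      - \<Gamma> a (z1 k j)" for k j
  define NY where "NY k j = box_mean h (line_mean h e1 b) (z2 k j)
      - \<Gamma> b (z2 k j)" for k j
  define NZ where "NZ k j = box_mean h q (gridpt h k j) - \<Gamma> q (gridpt h k j)" for k j
  define \<eta> where "\<eta> = h powr \<beta>"
  note err = discrete_solution_error[OF n hn perX sumP eqs, folded X_def Y_def Z_def \<eta>_def]
  \<comment> \<open>As \<open>h \<le> 1\<close> and \<open>\<beta> \<le> 1\<close>, the errors of
    order \<open>h\<close> in the projection are dominated by \<open>h powr \<beta>\<close>.\<close>
  have hb: "h \<le> \<eta>" unfolding \<eta>_def using powr_mono'[of \<beta> 1 h] h_pos beta by simp
  then have hb2: "h\<^sup>2 \<le> \<eta>\<^sup>2" using h_pos by (intro power_mono) auto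
  have e0: "0 \<le> \<eta>" by (simp add: \<eta>_def)
  define V where "V = ((1 + K) * (real L)\<^sup>2)\<^sup>2"
  have V0: "0 \<le> V" by (simp add: V_def)
  have "32 * V * F\<^sup>2 * h\<^sup>2 \<le> 32 * V * F\<^sup>2 * \<eta>\<^sup>2" using hb2 V0 by (intro mult_left_mono) auto
  moreover have "grid_sq n NX \<le> 32 * V * F\<^sup>2 * h\<^sup>2" "grid_sq n NY \<le> 32 * V * F\<^sup>2 * h\<^sup>2"
    unfolding NX_def NY_def V_def
    by (rule velocity_projection_error[OF a L2_bound] velocity_projection_error[OF b L2_bound]; auto)+
  ultimately have NX: "grid_sq n NX \<le> 32 * V * F\<^sup>2 * \<eta>\<^sup>2" and NY: "grid_sq n NY \<le> 32 * V * F\<^sup>2 * \<eta>\<^sup>2"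
    by simp_all
  have NZ: "grid_sq n NZ \<le> (64 * K\<^sup>2 / \<beta>\<^sup>2 + 64 * K\<^sup>2 * (real L)^4) * ((real n)\<^sup>2 * F\<^sup>2 * \<eta>\<^sup>2)"
  proof -
    have "F\<^sup>2 = (real n)\<^sup>2 * F\<^sup>2 * h\<^sup>2"
      using arg_cong[OF h_pos(3), of "\<lambda>t. t\<^sup>2 * F\<^sup>2"] by (simp add: power_mult_distrib mult_ac)
    also have "\<dots> \<le> (real n)\<^sup>2 * F\<^sup>2 * \<eta>\<^sup>2" using hb2 by (intro mult_left_mono) auto
    finally have F2: "F\<^sup>2 \<le> (real n)\<^sup>2 * F\<^sup>2 * \<eta>\<^sup>2" .
    have "grid_sq n NZ \<le> K\<^sup>2 * (64 / \<beta>\<^sup>2 * (real n)\<^sup>2 * F\<^sup>2 * \<eta>\<^sup>2 + 64 * (real L)^4 * F\<^sup>2)"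
      unfolding NZ_def \<eta>_def by (rule pressure_projection_error)
    also have "\<dots> \<le> K\<^sup>2 * (64 / \<beta>\<^sup>2 * (real n)\<^sup>2 * F\<^sup>2 * \<eta>\<^sup>2 + 64 * (real L)^4 * ((real n)\<^sup>2 * F\<^sup>2 * \<eta>\<^sup>2))"
      by (intro mult_left_mono add_left_mono F2) auto
    finally show ?thesis by (simp add: algebra_simps)
  qed
  have pN: "grid_periodic n X" "grid_periodic n Y" "grid_periodic n NX" "grid_periodic n NY"
  proof -
    have "periodic (box_mean h (line_mean h e2 a))" "periodic (box_mean h (line_mean h e1 b))"
      by (intro periodic_box_mean periodic_line_mean periodic_derivs)+
    note s = grid_periodic_sample[OF this(1) n, folded hn, of ?x1] grid_periodic_sample[OF this(2) n, folded hn, of ?x2]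
      grid_periodic_sample[OF periodic_combination n, folded hn, of m \<Phi> \<rho> R a ?x1]
      grid_periodic_sample[OF periodic_combination n, folded hn, of m \<Phi> \<rho> R b ?x2]
    show "grid_periodic n X" "grid_periodic n Y" "grid_periodic n NX" "grid_periodic n NY"
      using perX s unfolding X_def Y_def NX_def NY_def by (simp_all add: grid_periodic_def)
  qed
  have G: "(?g)\<^sup>2
      \<le> (944 + 1024 * V) * ((real n)\<^sup>2 * F\<^sup>2 * \<eta>\<^sup>2)"
  proof -
    have e1: "u (z1 k j) - \<Gamma> a (z1 k j) = X k j + NX k j" for k j
      by (simp add: X_def NX_def)
    have e2: "w (z2 k j) - \<Gamma> b (z2 k j) = Y k j + NY k j" for k j
      by (simp add: Y_def NY_def)
    let ?G1 = "grid_sum n (\<lambda>k j. ((X (k + 1) j + NX (k + 1) j) - (X k j + NX k j))\<^sup>2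
        + ((X k (j + 1) + NX k (j + 1)) - (X k j + NX k j))\<^sup>2)"
    let ?G2 = "grid_sum n (\<lambda>k j. ((Y (k + 1) j + NY (k + 1) j) - (Y k j + NY k j))\<^sup>2
        + ((Y k (j + 1) + NY k (j + 1)) - (Y k j + NY k j))\<^sup>2)"
    have nn: "0 \<le> ?G1" "0 \<le> ?G2" by (intro grid_sum_nonneg; simp)+
    have m1: "?x1 \<in> {0, ?x1, ?x2}" "?x2 \<in> {0, ?x1, ?x2}" by auto
    have "?g =
        sqrt ((real n)\<^sup>2 * ?G1 + (real n)\<^sup>2 * ?G2)"
      unfolding grad_l2_def lattice_S1_def lattice_S2_def grid_sum_gradient[OF m1(1)] grid_sum_gradient[OF m1(2)] e1 e2 ..
    then have "(?g)\<^sup>2 =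
        (real n)\<^sup>2 * (?G1 + ?G2)"
      using nn by (simp add: distrib_left)
    \<comment> \<open>Here \<open>944 = 2 * 472\<close> and \<open>1024 = 2 * (16 * 32)\<close>,
      from \<open>grid_difference_square_le\<close> applied to both components.\<close>
    also have "\<dots> \<le> (real n)\<^sup>2 * ((944 + 1024 * V) * (F\<^sup>2 * \<eta>\<^sup>2))"
    proof (rule mult_left_mono)
      have "?G1 + ?G2 \<le> 2 * grid_sum n (\<lambda>k j. grid_grad X k j
          + (Y (k + 1) j - Y k j)\<^sup>2 + (Y k (j + 1) - Y k j)\<^sup>2)
          + 16 * grid_sq n NX + 16 * grid_sq n NY"
        using grid_difference_square_le[OF pN(1,3)] grid_difference_square_le[OF pN(2,4)]
        unfolding grid_linear by simp
      also have "\<dots> \<le> 2 * (472 * F\<^sup>2 * \<eta>\<^sup>2) + 16 * (32 * V * F\<^sup>2 * \<eta>\<^sup>2) + 16 * (32 * V * F\<^sup>2 * \<eta>\<^sup>2)"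
        using err(1) NX NY by (intro add_mono mult_left_mono) auto
      finally show "?G1 + ?G2 \<le> (944 + 1024 * V) * (F\<^sup>2 * \<eta>\<^sup>2)" by (simp add: algebra_simps)
    qed simp
    finally show ?thesis by (simp add: mult_ac)
  qed
  have Pr: "(pressure_l2 h (\<lambda>y. P y - \<Gamma> q y))\<^sup>2
      \<le> (944 + 128 * K\<^sup>2 / \<beta>\<^sup>2 + 128 * K\<^sup>2 * (real L)^4) * ((real n)\<^sup>2 * F\<^sup>2 * \<eta>\<^sup>2)"
  proof -
    have "(pressure_l2 h (\<lambda>y. P y - \<Gamma> q y))\<^sup>2 = grid_sum n (\<lambda>k j. (Z k j + NZ k j)\<^sup>2)"
      using sum_lattice[OF n hn, of 0 "\<lambda>y. (P y - \<Gamma> q y)\<^sup>2"] h_pos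
      unfolding pressure_l2_def L2_set_def sT Z_def NZ_def by (simp add: sum_nonneg grid_sum_nonneg)
    also have "\<dots> \<le> 2 * grid_sq n Z + 2 * grid_sq n NZ"
      unfolding grid_linear[symmetric] by (intro grid_sum_mono square_sum2_le)
    also have "\<dots> \<le> 2 * (472 * (real n)\<^sup>2 * F\<^sup>2 * \<eta>\<^sup>2)
        + 2 * ((64 * K\<^sup>2 / \<beta>\<^sup>2 + 64 * K\<^sup>2 * (real L)^4) * ((real n)\<^sup>2 * F\<^sup>2 * \<eta>\<^sup>2))"
      using err(2) NZ by (intro add_mono mult_left_mono) auto
    finally show ?thesis by (simp add: algebra_simps)
  qed
  \<comment> \<open>The loss of one power of \<open>h\<close>: since \<open>n = 1 / h\<close>, the
    product \<open>real n * \<eta>\<close> is \<open>h powr (\<beta> - 1)\<close>.\<close>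
  have root: "s \<le> sqrt c * F * h powr (\<beta> - 1)" if s: "s\<^sup>2 \<le> c * ((real n)\<^sup>2 * F\<^sup>2 * \<eta>\<^sup>2)" for s c
  proof -
    have "s \<le> sqrt (c * ((real n)\<^sup>2 * F\<^sup>2 * \<eta>\<^sup>2))" using s by (rule real_le_rsqrt)
    also have "\<dots> = sqrt c * F * (real n * \<eta>)"
      using F_nonneg e0 by (simp add: real_sqrt_mult)
    also have "real n * \<eta> = h powr (\<beta> - 1)"
      using h_pos by (simp add: \<eta>_def powr_diff field_simps)
    finally show ?thesis .
  qed
  show ?thesis using root[OF G] root[OF Pr] unfolding V_def distrib_right by linarith
qed

section \<open>Proof of the error estimate\<close>

lemma dist_powr_tendsto_zero:
  assumes "0 < a"
  shows "((\<lambda>y. dist y x powr a) \<longlongrightarrow> 0) (at x)"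
proof -
  have "((\<lambda>y. dist y x) \<longlongrightarrow> dist x x) (at x)" by (intro tendsto_intros)
  then show ?thesis by (intro tendsto_zero_powrI[OF _ tendsto_const]) (use assms in auto)
qed

lemma hoelder_continuous:
  assumes "0 < \<alpha>" "hoelder \<alpha> g"
  shows "continuous_on UNIV g"
proof -
  obtain B where B: "\<And>x y. norm (g x - g y) \<le> B * dist x y powr \<alpha>"
    using assms(2) unfolding hoelder_def by blast
  have "(g \<longlongrightarrow> g x) (at x)" for x
  proof -
    from tendsto_mult_right_zero[OF dist_powr_tendsto_zero[OF assms(1)], of B]
    have "((\<lambda>y. g y - g x) \<longlongrightarrow> 0) (at x)"
      by (rule Lim_null_comparison[rotated]) (simp add: B)
    then show ?thesis by (rule LIM_zero_cancel)
  qed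
  then show ?thesis by (simp add: continuous_on_def)
qed

text \<open>The difference quotients at a point are at most a multiple of
  \<open>dist y x powr (\<alpha> - 1)\<close>, so the derivative vanishes everywhere.\<close>

lemma hoelder_exponent_gt_1_constant:
  assumes "1 < \<alpha>" "hoelder \<alpha> g"
  shows "g x = g y"
proof -
  obtain B where B: "\<And>x y. norm (g x - g y) \<le> B * dist x y powr \<alpha>"
    using assms(2) unfolding hoelder_def by blast
  have "(g has_derivative (\<lambda>_. 0)) (at x within UNIV)" for x
    unfolding has_derivative_iff_norm
  proof (intro conjI)
    from tendsto_mult_right_zero[OF dist_powr_tendsto_zero[of "\<alpha> - 1"], of B] assms(1)
    have "((\<lambda>y. B * dist y x powr (\<alpha> - 1)) \<longlongrightarrow> 0) (at x)" by simp
    then show "((\<lambda>y. norm (g y - g x - 0) / norm (y - x)) \<longlongrightarrow> 0) (at x)"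
    proof (rule Lim_null_comparison[rotated], intro always_eventually allI)
      fix y
      have "norm (g y - g x) / norm (y - x) \<le> B * dist y x powr (\<alpha> - 1)"
      proof (cases "y = x")
        case False
        then show ?thesis using B[of y x] by (simp add: powr_diff dist_norm field_simps)
      qed simp
      then show "norm (norm (g y - g x - 0) / norm (y - x)) \<le> B * dist y x powr (\<alpha> - 1)" by simp
    qed
  qed simp
  then obtain c where "\<forall>x\<in>UNIV. g x = c"
    using has_derivative_zero_constant[of UNIV g] by blast
  then show ?thesis by (metis UNIV_I)
qed

text \<open>Real suprema are upper bounds only for bounded sets. The values are bounded by
  continuity and periodicity, the quotients by the Hoelder constant.\<close>

lemma hoelder_norm_bounds:
  assumes p: "periodic f" and \<alpha>: "0 < \<alpha>" and f: "hoelder \<alpha> f"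
  shows "norm (f x) \<le> hoelder_norm \<alpha> f" (is ?P1) "norm (f x - f y) \<le> hoelder_norm \<alpha> f * dist x y powr \<alpha>"
    "0 \<le> hoelder_norm \<alpha> f"
proof -
  obtain B where B: "\<And>x y. norm (f x - f y) \<le> B * dist x y powr \<alpha>"
    using f unfolding hoelder_def by blast
  let ?D = "{(x, y). x \<noteq> y} :: (point \<times> point) set"
  let ?s = "SUP x. norm (f x)" and ?r = "\<lambda>(x, y). norm (f x - f y) / dist x y powr \<alpha>"
  have "bounded (f ` cbox (0, 0) (1, 1))"
    by (intro compact_imp_bounded compact_continuous_image continuous_on_subset[OF hoelder_continuous[OF \<alpha> f]]) auto
  then obtain A where A: "\<And>x. x \<in> cbox (0, 0) (1, 1) \<Longrightarrow> norm (f x) \<le> A"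
    unfolding bounded_iff by blast
  have "norm (f x) \<le> A" for x
  proof -
    have "x = (frac (fst x), frac (snd x)) + (of_int \<lfloor>fst x\<rfloor>, of_int \<lfloor>snd x\<rfloor>)"
      by (simp add: frac_def prod_eq_iff)
    then have "f x = f (frac (fst x), frac (snd x))" using periodic_shift_int[OF p] by metis
    moreover have "(frac (fst x), frac (snd x)) \<in> cbox (0, 0) (1, 1)"
      using frac_lt_1[of "fst x"] frac_lt_1[of "snd x"] by (simp add: cbox_Pair_eq)
    ultimately show ?thesis using A by simp
  qed
  then have b1: "bdd_above (range (\<lambda>x. norm (f x)))" by (intro bdd_aboveI[of _ A]) auto
  have b2: "bdd_above (?r ` ?D)"
  proof (rule bdd_aboveI)
    fix t assume "t \<in> ?r ` ?D"
    then obtain z where z: "z \<in> ?D" "t = ?r z" by blast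
    obtain x y where xy: "z = (x, y)" by (cases z)
    then have "0 < dist x y powr \<alpha>" using z by simp
    then show "t \<le> B" using z B[of x y] unfolding xy by (simp add: pos_divide_le_eq)
  qed
  have n1: "norm (f x) \<le> ?s" for x by (rule cSUP_upper[OF UNIV_I b1])
  have n2: "norm (f x - f y) / dist x y powr \<alpha> \<le> Sup (?r ` ?D)" if "x \<noteq> y" for x y
    using cSUP_upper[OF _ b2, of "(x, y)"] that by simp
  have s0: "0 \<le> ?s" using n1[of 0] norm_ge_zero[of "f 0"] by linarith
  \<comment> \<open>Any pair of distinct points shows that the supremum of the quotients is
    nonnegative.\<close>
  have "0 \<le> norm (f e1 - f 0) / dist e1 0 powr \<alpha>" by simp
  also have "\<dots> \<le> Sup (?r ` ?D)" by (rule n2) (simp add: zero_prod_def)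
  finally have r0: "0 \<le> Sup (?r ` ?D)" .
  have hn: "hoelder_norm \<alpha> f = ?s + Sup (?r ` ?D)" unfolding hoelder_norm_def by (simp add: case_prod_unfold)
  show ?P1 "0 \<le> hoelder_norm \<alpha> f" using n1[of x] s0 r0 unfolding hn by linarith+
  show "norm (f x - f y) \<le> hoelder_norm \<alpha> f * dist x y powr \<alpha>"
  proof (cases "x = y")
    case False
    then have "norm (f x - f y) / dist x y powr \<alpha> \<le> hoelder_norm \<alpha> f" using n2[OF False] s0 unfolding hn by linarith
    then show ?thesis using False by (simp add: divide_le_eq)
  qed simp
qed

lemma C1_per_partial_deriv:
  assumes p: "periodic g" and d: "\<And>x. g differentiable (at x)"
    and c: "continuous_on UNIV (partial_deriv e1 g)" "continuous_on UNIV (partial_deriv e2 g)"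
  shows "C1_per g (partial_deriv e1 g) (partial_deriv e2 g)"
  unfolding C1_per_def
proof (intro conjI allI p c)
  fix x
  have D: "(g has_derivative frechet_derivative g (at x)) (at x)"
    using d frechet_derivative_works by blast
  interpret linear "frechet_derivative g (at x)"
    using D by (rule has_derivative_linear)
  have "frechet_derivative g (at x) d = partial_deriv e1 g x * fst d + partial_deriv e2 g x * snd d" for d
  proof -
    have "frechet_derivative g (at x) (fst d *\<^sub>R e1 + snd d *\<^sub>R e2) =
        partial_deriv e1 g x * fst d + partial_deriv e2 g x * snd d"
      unfolding add scale partial_deriv_def by simp
    moreover have "fst d *\<^sub>R e1 + snd d *\<^sub>R e2 = d" by (simp add: prod_eq_iff)
    ultimately show ?thesis by simp
  qed
  then have eq: "frechet_derivative g (at x) = (\<lambda>d. partial_deriv e1 g x * fst d + partial_deriv e2 g x * snd d)"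
    by (rule ext)
  show "(g has_derivative (\<lambda>d. partial_deriv e1 g x * fst d + partial_deriv e2 g x * snd d)) (at x)"
    using D unfolding eq .
qed

lemma C_per_1_imp:
  assumes "0 < \<alpha>" "C_per 1 \<alpha> g"
  shows "C1_per g (partial_deriv e1 g) (partial_deriv e2 g)"
  using assms hoelder_continuous by (auto simp: C_per_def intro!: C1_per_partial_deriv)

lemma C_per_2_imp:
  assumes \<alpha>: "0 < \<alpha>" and g: "C_per 2 \<alpha> g"
  shows "C2_per g (partial_deriv e1 g) (partial_deriv e2 g)
    (partial_deriv e1 (partial_deriv e1 g)) (partial_deriv e2 (partial_deriv e1 g))
    (partial_deriv e1 (partial_deriv e2 g)) (partial_deriv e2 (partial_deriv e2 g))"
proof -
  have d: "\<And>x. g differentiable (at x)" "\<And>x. partial_deriv e1 g differentiable (at x)"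
    "\<And>x. partial_deriv e2 g differentiable (at x)"
    and c: "continuous_on UNIV (partial_deriv e1 (partial_deriv e1 g))"
      "continuous_on UNIV (partial_deriv e2 (partial_deriv e1 g))"
      "continuous_on UNIV (partial_deriv e1 (partial_deriv e2 g))"
      "continuous_on UNIV (partial_deriv e2 (partial_deriv e2 g))"
    using g hoelder_continuous[OF \<alpha>] by (auto simp: C_per_def numeral_2_eq_2)
  have "continuous_on UNIV (partial_deriv e1 g)" "continuous_on UNIV (partial_deriv e2 g)"
    using differentiable_imp_continuous_within[OF d(2)] differentiable_imp_continuous_within[OF d(3)]
    by (simp_all add: continuous_on_eq_continuous_at)
  then have 1: "C1_per g (partial_deriv e1 g) (partial_deriv e2 g)"
    using g d(1) by (intro C1_per_partial_deriv) (auto simp: C_per_def)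
  show ?thesis unfolding C2_per_def
    by (intro conjI 1 C1_per_partial_deriv C1_per_periodic[OF 1] d c)
qed

lemma integral_Omega_eq:
  fixes g :: "point \<Rightarrow> real"
  assumes "continuous_on UNIV g" "periodic g"
  shows "integral Omega g = \<mu> g"
proof -
  have O: "Omega = box (0, 0) (1, 1)" by (auto simp: Omega_def mem_box Basis_prod_def)
  have "integral Omega g = integral (cbox (0, 0) (1, 1)) g"
    unfolding O by (rule integral_open_interval)
  also have "\<dots> = \<mu> (\<lambda>x. g (x + (1/2, 1/2)))"
    using integral_shift_cbox[of "(0, 0)" "(1/2, 1/2)" "(1, 1)" g] by (simp add: unit_square_def)
  also have "\<dots> = \<mu> g" by (rule cell_mean_shift'[OF assms])
  finally show ?thesis .
qed

text \<open>The Laplacian and the pressure gradient have zero mean on the torus. Hence a constant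
  force vanishes, which settles exponents above 1.\<close>

lemma (in periodic_Stokes) mean_force: "\<mu> f1 = 0" "\<mu> f2 = 0"
proof -
  have "f1 = (\<lambda>x. - (a11 x + a22 x) + q1 x)" "f2 = (\<lambda>x. - (b11 x + b22 x) + q2 x)"
    using mom1 mom2 by auto
  then show "\<mu> f1 = 0" "\<mu> f2 = 0"
    using integral_partial_zero(1)[OF C1(2)] integral_partial_zero(2)[OF C1(3)] integral_partial_zero[OF q]
      integral_partial_zero(1)[OF C1(5)] integral_partial_zero(2)[OF C1(6)] continuous_derivs
    by (simp_all add: cell_mean_linear continuous_on_add continuous_on_minus del: minus_add_distrib)
qed

lemma periodic_Stokes_of_solution:
  assumes \<alpha>: "0 < \<alpha>" and p: "periodic f" and f: "hoelder \<alpha> f" and sol: "stokes_solution \<alpha> f v q"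
    and F: "\<And>x. norm (f x) \<le> F" "\<And>x y. norm (f x - f y) \<le> F * dist x y powr \<beta>" and beta: "0 < \<beta>" "\<beta> \<le> 1"
  shows "periodic_Stokes (fst \<circ> v) (partial_deriv e1 (fst \<circ> v)) (partial_deriv e2 (fst \<circ> v))
    (partial_deriv e1 (partial_deriv e1 (fst \<circ> v))) (partial_deriv e2 (partial_deriv e1 (fst \<circ> v)))
    (partial_deriv e1 (partial_deriv e2 (fst \<circ> v))) (partial_deriv e2 (partial_deriv e2 (fst \<circ> v)))
    (snd \<circ> v) (partial_deriv e1 (snd \<circ> v)) (partial_deriv e2 (snd \<circ> v))
    (partial_deriv e1 (partial_deriv e1 (snd \<circ> v))) (partial_deriv e2 (partial_deriv e1 (snd \<circ> v)))
    (partial_deriv e1 (partial_deriv e2 (snd \<circ> v))) (partial_deriv e2 (partial_deriv e2 (snd \<circ> v)))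
    q (partial_deriv e1 q) (partial_deriv e2 q) (\<lambda>x. fst (f x)) (\<lambda>x. snd (f x)) F \<beta>"
proof
  note sol' = sol[unfolded stokes_solution_def laplacian_def]
  have q: "C1_per q (partial_deriv e1 q) (partial_deriv e2 q)"
    using sol' by (intro C_per_1_imp[OF \<alpha>]) blast
  then show "C1_per q (partial_deriv e1 q) (partial_deriv e2 q)" .
  show "\<mu> q = 0"
    using integral_Omega_eq[OF C1_per_cont[OF q] C1_perD(1)[OF q]] sol' by simp
  have c: "\<bar>fst z\<bar> \<le> norm z" "\<bar>snd z\<bar> \<le> norm z" for z :: point
    using norm_fst_le[of "fst z" "snd z"] norm_snd_le[of "snd z" "fst z"] by simp_all
  show "\<bar>fst (f x)\<bar> \<le> F" "\<bar>snd (f x)\<bar> \<le> F" for x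
    using c[of "f x"] F(1)[of x] by linarith+
  show "\<bar>fst (f x) - fst (f y)\<bar> \<le> F * dist x y powr \<beta>" "\<bar>snd (f x) - snd (f y)\<bar> \<le> F * dist x y powr \<beta>" for x y
    using c[of "f x - f y"] F(2)[of x y] by simp_all
qed (use sol[unfolded stokes_solution_def laplacian_def] C_per_2_imp[OF \<alpha>] beta in auto)

theorem theorem3p4:
  fixes \<alpha> C0 K :: real and m :: nat and \<Phi> :: "point \<Rightarrow> real"
  assumes "0 < \<alpha>" and "2 \<le> m" and "window_function \<Phi>"
  shows "\<exists>C::real. \<forall>(n::nat) (h::real) (\<rho>::real) (R::point set)
            (f::point \<Rightarrow> point) (v::point \<Rightarrow> point) (q::point \<Rightarrow> real)
            (u::point \<Rightarrow> real) (w::point \<Rightarrow> real) (P::point \<Rightarrow> real).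
     0 < n \<and> h = 1 / real n \<and> 0 < \<rho> \<and> \<rho> < C0 * h \<and>
     regular_nodes m \<Phi> \<rho> R \<and>
     lebesgue_bound m \<Phi> \<rho> R ((lattice_S1 h \<union> lattice_S2 h \<union> lattice_T h) \<inter> cell) K \<and>
     realizes m \<Phi> \<rho> R ((lattice_S1 h \<union> lattice_S2 h) \<inter> cell) \<and>
     realizes m \<Phi> \<rho> R (lattice_T h \<inter> cell) \<and>
     periodic f \<and> hoelder \<alpha> f \<and>
     stokes_solution \<alpha> f v q \<and>
     discrete_stokes_solution m \<Phi> \<rho> R h f u w P
     \<longrightarrow> grad_l2 h (\<lambda>z. u z - projection m \<Phi> \<rho> R (fst \<circ> v) z)
                   (\<lambda>z. w z - projection m \<Phi> \<rho> R (snd \<circ> v) z)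
         + pressure_l2 h (\<lambda>y. P y - projection m \<Phi> \<rho> R q y)
         \<le> C * h powr (\<alpha> - 1) * hoelder_norm \<alpha> f"
proof -
  obtain r where r: "0 < r" "\<And>x. \<Phi> x \<noteq> 0 \<Longrightarrow> \<bar>fst x\<bar> \<le> r \<and> \<bar>snd x\<bar> \<le> r"
    using window_function_radius[OF assms(3)] by blast
  define \<beta> where "\<beta> = min \<alpha> 1"
  \<comment> \<open>The sign of \<open>C0\<close> is not assumed; for negative values
    \<open>nat\<close> yields 0.\<close>
  define L where "L = nat \<lceil>2 * r * C0\<rceil> + 3"
  define C where "C = sqrt (944 + 1024 * ((1 + K) * (real L)\<^sup>2)\<^sup>2) + sqrt (944 + 128 * K\<^sup>2 / \<beta>\<^sup>2 + 128 * K\<^sup>2 * (real L)^4)"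
  have beta: "0 < \<beta>" "\<beta> \<le> 1" using assms(1) by (auto simp: \<beta>_def)
  have L: "3 \<le> L" "2 * r * C0 + 1 \<le> real L" unfolding L_def by linarith+
  show ?thesis
  proof (intro exI[of _ C] allI impI, elim conjE)
    fix n h \<rho> R f v q u w P
    assume n: "0 < (n::nat)" and h: "h = 1 / real n" and rho: "0 < \<rho>" "\<rho> < C0 * h"
      and R: "regular_nodes m \<Phi> \<rho> R"
      and leb: "lebesgue_bound m \<Phi> \<rho> R ((lattice_S1 h \<union> lattice_S2 h \<union> lattice_T h) \<inter> cell) K"
      and pf: "periodic f" and hf: "hoelder \<alpha> f" and sol: "stokes_solution \<alpha> f v q"
      and dsol: "discrete_stokes_solution m \<Phi> \<rho> R h f u w P"
    \<comment> \<open>The Lebesgue bound at the origin, which lies on the lattice, forces the sign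
      of \<open>K\<close>.\<close>
    have K0: "0 \<le> K"
    proof -
      have "(0, 0) \<in> lattice_T h" unfolding lattice_T_def by (auto intro!: exI[of _ 0])
      then have "(\<Sum>y\<in>R. \<bar>shape m \<Phi> \<rho> R y (0, 0)\<bar>) \<le> K"
        using leb unfolding lebesgue_bound_def by (auto simp: cell_def)
      moreover have "0 \<le> (\<Sum>y\<in>R. \<bar>shape m \<Phi> \<rho> R y (0, 0)\<bar>)" by (intro sum_nonneg) simp
      ultimately show ?thesis by linarith
    qed
    have C0: "0 \<le> C" using K0 unfolding C_def by (intro add_nonneg_nonneg real_sqrt_ge_zero) auto
    note hn = hoelder_norm_bounds[OF pf assms(1) hf]
    \<comment> \<open>For exponents above 1 the force turns out to be zero, so \<open>F = 0\<close>
      is a valid bound with \<open>\<beta> = 1\<close>.\<close>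
    define F where "F = (if \<alpha> \<le> 1 then hoelder_norm \<alpha> f else 0)"
    have F: "norm (f x) \<le> F" "norm (f x - f y) \<le> F * dist x y powr \<beta>" for x y
    proof -
      have "norm (f x) \<le> F \<and> norm (f x - f y) \<le> F * dist x y powr \<beta>"
      proof (cases "\<alpha> \<le> 1")
        case True
        then show ?thesis using hn by (simp add: F_def \<beta>_def)
      next
        case False
        have const: "f z = f 0" for z
          using False hf by (intro hoelder_exponent_gt_1_constant) auto
        \<comment> \<open>Provisional bounds for the constant force, which give access to
          \<open>mean_force\<close> before its vanishing is known.\<close>
        have "norm (f x) \<le> norm (f 0)" "norm (f x - f y) \<le> norm (f 0) * dist x y powr 1" for x y
          using const[of x] const[of y] by simp_all
        note const' = this
        have "0 < (1::real)" "(1::real) \<le> 1" by simp_all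
        note mean = periodic_Stokes.mean_force[OF periodic_Stokes_of_solution[OF assms(1) pf hf sol const' this]]
        have "(\<lambda>x. fst (f x)) = (\<lambda>_. fst (f 0))" "(\<lambda>x. snd (f x)) = (\<lambda>_. snd (f 0))"
          using const by metis+
        then have "f 0 = 0" using mean by (simp add: prod_eq_iff)
        then show ?thesis using const[of x] const[of y] False by (simp add: F_def)
      qed
      then show "norm (f x) \<le> F" "norm (f x - f y) \<le> F * dist x y powr \<beta>" by auto
    qed
    have N: "node_projection_axioms n m \<Phi> h \<rho> K r C0 R L"
      using assms(2) n h rho R leb r L K0 by unfold_locales auto
    note total = node_projection.total_error[OF node_projection.intro[OF
        periodic_Stokes_of_solution[OF assms(1) pf hf sol F beta] N] dsol refl refl]
    \<comment> \<open>Equality for \<open>\<alpha> \<le> 1\<close>; otherwise the left side is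
      zero.\<close>
    have "C * F * h powr (\<beta> - 1) \<le> C * h powr (\<alpha> - 1) * hoelder_norm \<alpha> f"
      using C0 hn(3) by (auto simp: F_def \<beta>_def mult_ac)
    with total show "grad_l2 h (\<lambda>z. u z - projection m \<Phi> \<rho> R (fst \<circ> v) z) (\<lambda>z. w z - projection m \<Phi> \<rho> R (snd \<circ> v) z)
         + pressure_l2 h (\<lambda>y. P y - projection m \<Phi> \<rho> R q y) \<le> C * h powr (\<alpha> - 1) * hoelder_norm \<alpha> f"
      unfolding C_def by (rule order_trans)
  qed
qed

end
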